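(* Let $d\geq 1$ and let $\mathcal{P}$ be a simplex in $\mathbb{R}^{d}$ with vertices $\mathbf{0},\mathbf{m}_{1},\ldots,\mathbf{m}_{d}\in\mathbb{Z}^{d}$, and let $M$ be the nonsingular $d\times d$ integer matrix with columns $\mathbf{m}_{1},\ldots,\mathbf{m}_{d}$, which maps the standard simplex $S_d$ onto $\mathcal{P}$. Let $q\in C^{\infty}(\mathbb{R}^{d})$, let $\tau>0$ and $q_{\tau,M}(x)=q(\tau Mx)$. Assume that for some $c,\delta>0$, for every $w\in\mathbb{N}$, $$\sup_{|\alpha|=w}\ \sup_{x\in S_{d}}\left\vert \frac{\partial^{\alpha}q_{\tau,M}}{\partial x^{\alpha}}(x)\right\vert \leqslant c\,\tau^{w}(2^{d-2}\pi^{-1}+\delta)^{-w}.$$ Then $\sum_{n\in\mathbb{Z}^{d}}\omega_{\tau\mathcal{P}}(x+n)q(x+n)$ can be expanded in a uniformly convergent series of Bernoulli polynomials: $$\sum_{n\in\mathbb{Z}^{d}}\omega_{\tau\mathcal{P}}(x+n)q(x+n)=|\det M|\sum_{V\in\{1,2\}^{d}}\ \sum_{I\in\{0,1\}^{d}}\ \sum_{|J|\geq0,\ J\sqsubseteq I}\tau^{d-|I|-|J|}\left\langle \mu(V,I,J),q_{\tau,M}\right\rangle \mathfrak{B}_{J+I,(MD_{V})^{t}}(x-\tau M\lambda_{V}),$$ where the series is the limit, as $w\to+\infty$, of the sums restricted to $|J|\le w$, uniformly in $x\in\mathbb{R}^d$.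
   Context: Standard simplex: $S_d=\{x\in\mathbb{R}^d: x_j\ge 0,\ \sum_{j=1}^d x_j\le 1\}$. For a multi-index, $|J|=j_1+\dots+j_d$. For $I\in\{0,1\}^d$ and a multi-index $J$ of non-negative integers, $J\sqsubseteq I$ means $j_k=0$ whenever $i_k=0$. $L^t$ is the transpose and $\mathbf 1_m=(1,\dots,1)\in\mathbb{R}^m$. $\mathbb{N}=\{0,1,2,\dots\}$. Solid angle: $\omega_{A}(x)=\lim_{\varepsilon\to0+}\frac{1}{|\{|y|\le1\}|}\int_{|y|\le1}\chi_{A}(x-\varepsilon y)\,dy$ (the limit exists for every $x$ when $A$ is a convex polytope). Bernoulli polynomials: $\{B_n\}_{n\in\mathbb{N}}$ are the $1$-periodic functions on $\mathbb{R}$ defined on $(0,1)$ by $B_0=1$, $B_{n+1}'=B_n$, $\int_0^1B_{n+1}=0$, with value at integers $B_n(x)=\lim_{\varepsilon\to0+}\frac{B_n(x+\varepsilon)+B_n(x-\varepsilon)}2$. For a multi-index $J=(j_1,\dots,j_d)$ of non-negative integers, $B_J(x)=B_{j_1}(x_1)\cdots B_{j_d}(x_d)$ if $0\le x_k<1$ for all $k$, and $B_J(x)=0$ otherwise. For a nonsingular integer matrix $L$, $B_{J,L}(x)=|\det L|^{-1}B_J((L^{-1})^tx)$ and $\mathfrak{B}_{J,L}(x)=\sum_{n\in\mathbb{Z}^d}B_{J,L}(x+n)$, where at points of discontinuity $\mathfrak B_{J,L}$ is regularized so that $\mathfrak{B}_{J,L}(x)=\lim_{\varepsilon\to0+}\frac1{|\{|y|\le1\}|}\int_{|y|\le1}\mathfrak{B}_{J,L}(x-\varepsilon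 y)\,dy$. Bases: for each $d\ge1$, $\mathcal{F}^{(d)}$ is a collection of $2^{d-1}$ ordered bases of $\mathbb{R}^d$ indexed by $(v_2,\dots,v_d)\in\{1,2\}^{d-1}$, defined recursively. For $d=1$ the only basis is $\{1\}$. For $d\ge2$, let $\{b_1',\dots,b_{d-1}'\}\in\mathcal F^{(d-1)}$ be the basis with index $(v_2,\dots,v_{d-1})$; the basis $\{b_1,\dots,b_d\}$ with index $(v_2,\dots,v_d)$ has $b_d=(0,\dots,0,1)$ and, for $1\le k\le d-1$, $b_k=(b_k',0)$ if $v_d=1$, $b_k=(b_k',-b_k'\cdot\mathbf 1_{d-1})$ if $v_d=2$. For $V=(v_1,\dots,v_d)\in\{1,2\}^d$, $\mathcal B_V$ is the basis with index $(v_2,\dots,v_d)$, and $D_V=[b_1|\cdots|b_d]$ is the matrix whose columns are the vectors of $\mathcal B_V$. Vectors $\lambda_V\in\mathbb{R}^d$: for $d=1$, $\lambda_1=0$, $\lambda_2=1$. For $d\ge2$, with $V'=(v_1,\dots,v_{d-1})$: $\lambda_V=(\lambda_{V'},0)$ if $v_d=1$, and $\lambda_V=(\lambda_{V'},1-\lambda_{V'}\cdot\mathbf 1_{d-1})$ if $v_d=2$. Functionals $\mu(V,I,J)$ (for $V\in\{1,2\}^d$, $I\in\{0,1\}^d$, $J\sqsubseteq I$): $\mu(V,I,J)=T_1^{v_1,i_1,j_1}T_2^{v_2,i_2,j_2}\cdots T_d^{v_d,i_d,j_d}$ (composition, $T_d$ applied first), where $T_h^{v,i,j}$ maps (sufficiently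 smooth) functions on $\mathbb{R}^h$ to functions on $\mathbb{R}^{h-1}$ (to numbers if $h=1$). For $h=1$: $T_1^{1,0,0}g=\int_0^1g(x_1)dx_1$, $T_1^{2,0,0}g=0$, $T_1^{1,1,j}g=-g^{(j)}(0)$, $T_1^{2,1,j}g=g^{(j)}(1)$. For $h\ge2$ and $x'\in\mathbb{R}^{h-1}$: $T_h^{1,0,0}g(x')=\int_0^{1-x'\cdot\mathbf 1_{h-1}}g(x',x_h)dx_h$, $T_h^{2,0,0}g(x')=0$, $T_h^{1,1,j}g(x')=-\frac{\partial^jg}{\partial x_h^j}(x',0)$, $T_h^{2,1,j}g(x')=\frac{\partial^jg}{\partial x_h^j}(x',1-x'\cdot\mathbf 1_{h-1})$. $\langle\mu(V,I,J),g\rangle$ is the resulting number. *)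

theory Defs
  imports "HOL-Analysis.Analysis"
begin

text \<open>
  The normalisation is \<open>B\<^sub>n\<^sub>+\<^sub>1' = B\<^sub>n\<close> (no factor \<open>n + 1\<close>), so on \<open>(0,1)\<close> these are the classical
  Bernoulli polynomials divided by \<open>n!\<close>; at the integers they take the mean of the one-sided
  limits.
\<close>

definition is_bernoulli :: "(nat \<Rightarrow> real \<Rightarrow> real) \<Rightarrow> bool" where
  "is_bernoulli B \<longleftrightarrow>
     (\<forall>n x. B n (x + 1) = B n x) \<and>
     (\<forall>x\<in>{0<..<1}. B 0 x = 1) \<and>
     (\<forall>n. \<forall>x\<in>{0<..<1}. (B (Suc n) has_real_derivative B n x) (at x)) \<and>
     (\<forall>n. (B (Suc n) has_integral 0) {0..1}) \<and>
     (\<forall>n. \<forall>x\<in>\<int>. ((\<lambda>\<epsilon>. (B n (x + \<epsilon>) + B n (x - \<epsilon>)) / 2) \<longlongrightarrow> B n x) (at_right 0))"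

definition bernoulli :: "nat \<Rightarrow> real \<Rightarrow> real" where
  "bernoulli = (THE B. is_bernoulli B)"

lemma poly_antiderivative_mean_zero:
  fixes p :: "real poly"
  shows "\<exists>P. pderiv P = p \<and> (poly P has_integral 0) {0..1}"
proof -
  define Q where "Q = (\<Sum>i\<le>degree p. monom (coeff p i / real (Suc i)) (Suc i))"
  have Q: "pderiv Q = p"
  proof -
    have "pderiv (sum f A) = (\<Sum>i\<in>A. pderiv (f i))" for f :: "nat \<Rightarrow> real poly" and A
      by (induction A rule: infinite_finite_induct) (auto simp: pderiv_add)
    then have "pderiv Q = (\<Sum>i\<le>degree p. monom (coeff p i) i)"
      by (simp add: Q_def pderiv_monom del: of_nat_Suc)
    then show ?thesis by (simp add: poly_as_sum_of_monoms)
  qed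
  define c where "c = integral {0..1} (poly Q)"
  have "(poly Q has_integral c) {0..1}"
    unfolding c_def
    by (intro integrable_integral integrable_continuous_real continuous_intros)
  moreover have "((\<lambda>x. c) has_integral c) {0..1::real}"
    using has_integral_const_real[of c 0 1] by simp
  ultimately have "((\<lambda>x. poly Q x - c) has_integral (c - c)) {0..1}"
    by (rule has_integral_diff)
  moreover have "poly (Q - [:c:]) = (\<lambda>x. poly Q x - c)" by auto
  ultimately show ?thesis
    using Q by (intro exI[of _ "Q - [:c:]"]) (simp add: pderiv_diff pderiv_pCons)
qed

lemma is_bernoulli_exists: "\<exists>B. is_bernoulli B"
proof -
  define R :: "nat \<Rightarrow> real poly \<Rightarrow> real poly \<Rightarrow> bool"
    where "R = (\<lambda>n p P. pderiv P = p \<and> (poly P has_integral 0) {0..1})"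
  obtain b where b0: "b 0 = 1" and b: "\<And>n. R n (b n) (b (Suc n))"
    using dependent_nat_choice[of "\<lambda>n p. n = 0 \<longrightarrow> p = 1" R] poly_antiderivative_mean_zero
    unfolding R_def by auto
  have bd: "pderiv (b (Suc n)) = b n" and bi: "(poly (b (Suc n)) has_integral 0) {0..1}" for n
    using b[of n] by (auto simp: R_def)
  define B where "B = (\<lambda>n x. if x \<in> \<int> then (poly (b n) 0 + poly (b n) 1) / 2
                             else poly (b n) (frac x))"
  have B01: "B n x = poly (b n) x" if "x \<in> {0<..<1}" for n x
  proof -
    have "frac x = x" using that by (simp add: frac_eq)
    moreover have "x \<notin> \<int>" using that frac_eq_0_iff[of x] \<open>frac x = x\<close> by auto
    ultimately show ?thesis by (simp add: B_def)
  qed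
  have per: "B n (x + 1) = B n x" for n x
  proof -
    have "x + 1 \<in> \<int> \<longleftrightarrow> x \<in> \<int>"
      by (metis Ints_1 Ints_add Ints_diff add_diff_cancel_right')
    then show ?thesis by (simp add: B_def frac_1_eq)
  qed
  have shift: "B n (of_int k + x) = B n x" for n k x
  proof -
    have "of_int k + x \<in> \<int> \<longleftrightarrow> x \<in> \<int>"
      by (metis Ints_add Ints_diff Ints_of_int add_diff_cancel_left')
    moreover have "frac (of_int k + x) = frac x" by (simp add: frac_def)
    ultimately show ?thesis by (simp add: B_def)
  qed
  have deriv: "(B (Suc n) has_real_derivative B n x) (at x)" if "x \<in> {0<..<1}" for n x
  proof -
    have "(poly (b (Suc n)) has_real_derivative B n x) (at x)"
      using poly_DERIV[of "b (Suc n)" x] bd[of n] B01[OF that] by simp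
    then show ?thesis
      by (rule has_field_derivative_transform_within_open[OF _ open_greaterThanLessThan that])
         (simp add: B01)
  qed
  have int: "(B (Suc n) has_integral 0) {0..1}" for n
    by (rule has_integral_spike_finite[OF _ _ bi[of n], of "{0,1}"]) (auto simp: B01)
  have lim: "((\<lambda>\<epsilon>. (B n (x + \<epsilon>) + B n (x - \<epsilon>)) / 2) \<longlongrightarrow> B n x) (at_right 0)"
    if "x \<in> \<int>" for n x
  proof -
    from that obtain k where k: "x = of_int k" by (rule Ints_cases)
    have eq: "(B n (x + \<epsilon>) + B n (x - \<epsilon>)) / 2 = (poly (b n) \<epsilon> + poly (b n) (1 - \<epsilon>)) / 2"
      if "\<epsilon> \<in> {0<..<1}" for \<epsilon>
    proof -
      have "B n (x + \<epsilon>) = poly (b n) \<epsilon>"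
        using shift[of n k \<epsilon>] B01[OF that] k by simp
      moreover have "B n (x - \<epsilon>) = B n (- \<epsilon> + 1)"
        using shift[of n k "- \<epsilon>"] per[of n "- \<epsilon>"] k by simp
      moreover have "B n (- \<epsilon> + 1) = poly (b n) (1 - \<epsilon>)"
        using B01[of "- \<epsilon> + 1" n] that by simp
      ultimately show ?thesis by simp
    qed
    have "((\<lambda>\<epsilon>. (poly (b n) \<epsilon> + poly (b n) (1 - \<epsilon>)) / 2)
            \<longlongrightarrow> (poly (b n) 0 + poly (b n) (1 - 0)) / 2) (at_right 0)"
      by (intro tendsto_intros) auto
    then have 1: "((\<lambda>\<epsilon>. (poly (b n) \<epsilon> + poly (b n) (1 - \<epsilon>)) / 2) \<longlongrightarrow> B n x) (at_right 0)"
      using that by (simp add: B_def)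
    have "\<forall>\<^sub>F \<epsilon> in at_right 0. \<epsilon> \<in> {0<..<1::real}"
      by (rule eventually_at_right_real) simp
    then have "\<forall>\<^sub>F \<epsilon> in at_right 0. (poly (b n) \<epsilon> + poly (b n) (1 - \<epsilon>)) / 2
        = (B n (x + \<epsilon>) + B n (x - \<epsilon>)) / 2"
      by eventually_elim (simp add: eq)
    with 1 show ?thesis by (rule Lim_transform_eventually)
  qed
  have "B 0 x = 1" if "x \<in> {0<..<1}" for x using B01[OF that] b0 by simp
  then show ?thesis
    using per deriv int lim unfolding is_bernoulli_def by blast
qed

lemma is_bernoulli_unique:
  assumes B: "is_bernoulli B" and C: "is_bernoulli C"
  shows "B = C"
proof -
  have eq01: "\<forall>x\<in>{0<..<1}. B n x = C n x" for n
  proof (induction n)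
    case 0
    then show ?case using B C by (simp add: is_bernoulli_def)
  next
    case (Suc n)
    have "((\<lambda>x. B (Suc n) x - C (Suc n) x) has_real_derivative 0) (at x within {0<..<1})"
      if "x \<in> {0<..<1}" for x
    proof -
      have "(B (Suc n) has_real_derivative B n x) (at x)"
        and "(C (Suc n) has_real_derivative C n x) (at x)"
        using B C that by (auto simp: is_bernoulli_def)
      from DERIV_diff[OF this] show ?thesis
        using Suc that by (simp add: has_field_derivative_at_within)
    qed
    then obtain c where c: "\<And>x. x \<in> {0<..<1} \<Longrightarrow> B (Suc n) x - C (Suc n) x = c"
      using has_field_derivative_zero_constant[of "{0<..<1::real}"] by (metis convex_real_interval(8))
    have diff: "((\<lambda>x. B (Suc n) x - C (Suc n) x) has_integral 0 - 0) {0..1}"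
      using B C by (intro has_integral_diff) (auto simp: is_bernoulli_def)
    have "((\<lambda>x. c) has_integral 0 - 0) {0..1::real}"
      by (rule has_integral_spike_finite[OF _ _ diff, of "{0,1}"]) (auto simp: c)
    then have "((\<lambda>x. c) has_integral 0) {0..1::real}" by simp
    moreover have "((\<lambda>x. c) has_integral c) {0..1::real}"
      using has_integral_const_real[of c 0 1] by simp
    ultimately have "c = 0" by (rule has_integral_unique[symmetric])
    then show ?case using c by fastforce
  qed
  have shift: "F n (x + of_int k) = F n x" if F: "is_bernoulli F" for F n x k
  proof (induction k rule: int_induct[where k = 0])
    case base
    then show ?case by simp
  next
    case (step1 i)
    have "F n ((x + of_int i) + 1) = F n (x + of_int i)"
      using F unfolding is_bernoulli_def by blast
    then show ?case using step1 by (simp add: algebra_simps)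
  next
    case (step2 i)
    have "F n ((x + of_int (i - 1)) + 1) = F n (x + of_int (i - 1))"
      using F unfolding is_bernoulli_def by blast
    then show ?case using step2 by (simp add: algebra_simps)
  qed
  have eq: "B n x = C n x" if "x \<notin> \<int>" for n x
  proof -
    have "frac x \<in> {0<..<1}" using that by (simp add: frac_gt_0_iff frac_lt_1)
    then have "B n (frac x) = C n (frac x)" using eq01 by blast
    moreover have "x = frac x + of_int \<lfloor>x\<rfloor>" by (simp add: frac_def)
    ultimately show ?thesis using shift[OF B] shift[OF C] by metis
  qed
  have "B n x = C n x" if x: "x \<in> \<int>" for n x
  proof -
    have lB: "((\<lambda>\<epsilon>. (B n (x + \<epsilon>) + B n (x - \<epsilon>)) / 2) \<longlongrightarrow> B n x) (at_right 0)"
      and lC: "((\<lambda>\<epsilon>. (C n (x + \<epsilon>) + C n (x - \<epsilon>)) / 2) \<longlongrightarrow> C n x) (at_right 0)"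
      using B C x by (auto simp: is_bernoulli_def)
    have ni: "x + \<epsilon> \<notin> \<int>" "x - \<epsilon> \<notin> \<int>" if "\<epsilon> \<in> {0<..<1}" for \<epsilon>
    proof -
      have "\<epsilon> \<notin> \<int>" using that frac_eq_0_iff[of \<epsilon>] frac_eq[of \<epsilon>] by auto
      then show "x + \<epsilon> \<notin> \<int>" "x - \<epsilon> \<notin> \<int>"
        using x Ints_diff[of "x + \<epsilon>" x] Ints_diff[of x "x - \<epsilon>"] by auto
    qed
    have "\<forall>\<^sub>F \<epsilon> in at_right 0. \<epsilon> \<in> {0<..<1::real}"
      by (rule eventually_at_right_real) simp
    then have "\<forall>\<^sub>F \<epsilon> in at_right 0. (B n (x + \<epsilon>) + B n (x - \<epsilon>)) / 2
        = (C n (x + \<epsilon>) + C n (x - \<epsilon>)) / 2"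
      by eventually_elim (simp add: eq ni)
    with lB have "((\<lambda>\<epsilon>. (C n (x + \<epsilon>) + C n (x - \<epsilon>)) / 2) \<longlongrightarrow> B n x) (at_right 0)"
      by (rule Lim_transform_eventually)
    from tendsto_unique[OF _ this lC] show ?thesis by simp
  qed
  with eq show ?thesis by blast
qed

lemma is_bernoulli_bernoulli: "is_bernoulli bernoulli"
  unfolding bernoulli_def
  using is_bernoulli_exists is_bernoulli_unique theI[of is_bernoulli] by metis

definition regularize :: "(real ^ 'n \<Rightarrow> real) \<Rightarrow> real ^ 'n \<Rightarrow> real" where
  "regularize f x =
     Lim (at_right 0)
       (\<lambda>\<epsilon>. (1 / measure lborel (cball (0 :: real ^ 'n) 1)) *
             (LINT y:cball 0 1|lborel. f (x - \<epsilon> *\<^sub>R y)))"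

definition solid_angle :: "(real ^ 'n) set \<Rightarrow> real ^ 'n \<Rightarrow> real" where
  "solid_angle A = regularize (indicator A)"

definition int_lattice :: "(real ^ 'n) set" where
  "int_lattice = {n. \<forall>i. n $ i \<in> \<int>}"

definition bernoulli_multi :: "('n \<Rightarrow> nat) \<Rightarrow> real ^ 'n \<Rightarrow> real" where
  "bernoulli_multi J x =
     (if \<forall>k. 0 \<le> x $ k \<and> x $ k < 1 then \<Prod>k\<in>UNIV. bernoulli (J k) (x $ k) else 0)"

definition bernoulli_mat :: "('n \<Rightarrow> nat) \<Rightarrow> real ^ 'n ^ 'n \<Rightarrow> real ^ 'n \<Rightarrow> real" where
  "bernoulli_mat J L x =
     inverse \<bar>det L\<bar> * bernoulli_multi J (transpose (matrix_inv L) *v x)"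

text \<open>
  The lattice sum has only finitely many nonzero terms. Regularisation changes its value only at
  points of discontinuity, and leaves the ball averages themselves unchanged.
\<close>

definition bernoulli_per :: "('n \<Rightarrow> nat) \<Rightarrow> real ^ 'n ^ 'n \<Rightarrow> real ^ 'n \<Rightarrow> real" where
  "bernoulli_per J L =
     regularize (\<lambda>x. \<Sum>\<^sub>\<infinity>n\<in>int_lattice. bernoulli_mat J L (x + n))"

definition set_coord :: "real ^ 'n \<Rightarrow> 'n \<Rightarrow> real \<Rightarrow> real ^ 'n" where
  "set_coord x i t = (\<chi> k. if k = i then t else x $ k)"

definition partial ::
    "'n \<Rightarrow> (real ^ 'n \<Rightarrow> 'b::real_normed_vector) \<Rightarrow> real ^ 'n \<Rightarrow> 'b" where
  "partial i f x = vector_derivative (\<lambda>t. f (set_coord x i t)) (at (x $ i))"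

definition multi_partial ::
    "('n::{finite,linorder} \<Rightarrow> nat) \<Rightarrow> (real ^ 'n::_ \<Rightarrow> 'b::real_normed_vector) \<Rightarrow> real ^ 'n::_ \<Rightarrow> 'b" where
  "multi_partial \<alpha> f = foldr (\<lambda>i. partial i ^^ \<alpha> i) (sorted_list_of_set UNIV) f"

primrec C_k :: "nat \<Rightarrow> (real ^ 'n \<Rightarrow> 'b::real_normed_vector) \<Rightarrow> bool" where
  "C_k 0 f \<longleftrightarrow> continuous_on UNIV f"
| "C_k (Suc k) f \<longleftrightarrow> continuous_on UNIV f \<and>
     (\<forall>i. (\<forall>x. (\<lambda>t. f (set_coord x i t)) differentiable at (x $ i)) \<and> C_k k (partial i f))"

definition C_infinity :: "(real ^ 'n \<Rightarrow> 'b::real_normed_vector) \<Rightarrow> bool" where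
  "C_infinity f \<longleftrightarrow> (\<forall>k. C_k k f)"

text \<open>
  The coordinates are indexed by a finite linearly ordered type \<open>'n\<close>, so \<open>d = CARD('n) \<ge> 1\<close>, and
  the order of \<open>'n\<close> plays the role of \<open>1 < 2 < \<dots> < d\<close>. A recursion on the dimension becomes a
  traversal of the coordinates in increasing order: the space \<open>\<real>\<^sup>h\<close> is identified with the vectors
  whose coordinates after the \<open>h\<close>-th vanish, and functions on \<open>\<real>\<^sup>h\<close> with functions that do not
  depend on those coordinates.
\<close>

definition std_simplex :: "(real ^ 'n) set" where
  "std_simplex = {x. (\<forall>j. 0 \<le> x $ j) \<and> (\<Sum>j\<in>UNIV. x $ j) \<le> 1}"

text \<open>
  When coordinate \<open>i\<close> is appended, the basis vector with number \<open>i\<close> is created as the unit vector,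
  and those created earlier are extended by \<open>0\<close> or by minus the sum of their entries. Vectors not
  yet created are \<open>0\<close> and stay so. For the first coordinate the value of \<open>V\<close> is irrelevant.
\<close>

definition basis_vec :: "('n::{finite,linorder} \<Rightarrow> nat) \<Rightarrow> 'n \<Rightarrow> real ^ 'n::_" where
  "basis_vec V k =
     fold (\<lambda>i b. set_coord b i
             (if i = k then 1 else if V i = 1 then 0 else - (\<Sum>l | l < i. b $ l)))
       (sorted_list_of_set UNIV) 0"

definition basis_mat :: "('n::{finite,linorder} \<Rightarrow> nat) \<Rightarrow> real ^ 'n::_ ^ 'n::_" where
  "basis_mat V = (\<chi> i k. basis_vec V k $ i)"

definition lambda_vec :: "('n::{finite,linorder} \<Rightarrow> nat) \<Rightarrow> real ^ 'n::_" where
  "lambda_vec V =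
     fold (\<lambda>i x. set_coord x i (if V i = 1 then 0 else 1 - (\<Sum>l | l < i. x $ l)))
       (sorted_list_of_set UNIV) 0"

text \<open>
  The integral must be the oriented one: derivatives of the resulting function are later taken at
  points where the upper limit is \<open>0\<close>. The empty sum at the first coordinate gives the upper
  limit \<open>1\<close>, hence the case \<open>h = 1\<close>. The pair \<open>e = 0\<close>, \<open>j > 0\<close> is never used.
\<close>

definition T_op ::
    "'n::{finite,linorder} \<Rightarrow> nat \<Rightarrow> nat \<Rightarrow> nat \<Rightarrow>
     (real ^ 'n::_ \<Rightarrow> 'b::{banach,second_countable_topology}) \<Rightarrow> real ^ 'n::_ \<Rightarrow> 'b" where
  "T_op h v e j g x =
     (let s = 1 - (\<Sum>l | l < h. x $ l) in
      if e = 0 then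
        if v = 1 then interval_lebesgue_integral lborel 0 (ereal s) (\<lambda>t. g (set_coord x h t))
        else 0
      else
        if v = 1 then - (partial h ^^ j) g (set_coord x h 0)
        else (partial h ^^ j) g (set_coord x h s))"

definition mu ::
    "('n::{finite,linorder} \<Rightarrow> nat) \<Rightarrow> ('n \<Rightarrow> nat) \<Rightarrow> ('n \<Rightarrow> nat) \<Rightarrow>
     (real ^ 'n::_ \<Rightarrow> 'b::{banach,second_countable_topology}) \<Rightarrow> 'b" where
  "mu V I J g = foldr (\<lambda>h. T_op h (V h) (I h) (J h)) (sorted_list_of_set UNIV) g 0"

definition subordinate :: "('n \<Rightarrow> nat) \<Rightarrow> ('n \<Rightarrow> nat) \<Rightarrow> bool" (infix "\<sqsubseteq>" 50) where
  "J \<sqsubseteq> I \<longleftrightarrow> (\<forall>k. I k = 0 \<longrightarrow> J k = 0)"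

definition dilated :: "real \<Rightarrow> real ^ 'n ^ 'n \<Rightarrow> (real ^ 'n \<Rightarrow> 'b) \<Rightarrow> real ^ 'n \<Rightarrow> 'b" where
  "dilated \<tau> M q x = q (\<tau> *\<^sub>R (M *v x))"

abbreviation multi_sum :: "('n::finite \<Rightarrow> nat) \<Rightarrow> nat" where
  "multi_sum J \<equiv> \<Sum>k\<in>UNIV. J k"

end

theory Submission
  imports Defs "HOL-Complex_Analysis.Cauchy_Integral_Formula"
begin

text \<open>
  In dimension 1 the statement is the Euler-Maclaurin formula for an interval whose endpoints need
  not be lattice points, in the form of a series. The remainder after \<open>n\<close> terms pairs the \<open>n\<close>-th
  derivative with a Bernoulli polynomial, and it tends to 0 because the latter are \<open>O(r\<^sup>-\<^sup>n)\<close> for every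
  \<open>r < 2 \<pi>\<close>: they are built from the Taylor coefficients of \<open>z / (exp z - 1)\<close>, whose nearest poles
  are at distance \<open>2 \<pi>\<close> from the origin (\<open>bernoulli_bound\<close>, \<open>euler_maclaurin_series\<close>).

  For the standard simplex this formula is applied to the last coordinate, then to the one before,
  and so on. Over a point \<open>x\<close> of the smaller simplex the last coordinate ranges over the segment from
  0 to \<open>1 - (x\<^sub>1 + \<dots> + x\<^sub>d\<^sub>-\<^sub>1)\<close>, and the terms of the formula are exactly the operators \<open>T_op\<close>. At
  a lattice point \<open>x\<close> the position of the far endpoint relative to the lattice is independent of \<open>x\<close>
  modulo 1; hence the Bernoulli factors come out of the sum over \<open>x\<close>, and the argument can be
  repeated with functions of one variable less (\<open>euler_maclaurin_coordinate\<close>,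
  \<open>simplex_expansion_prefix\<close>). The arguments of the Bernoulli factors are \<open>y\<^sub>k\<close> or
  \<open>y\<^sub>1 + \<dots> + y\<^sub>k - \<tau>\<close>, which are the coordinates of \<open>y - \<tau> \<lambda>\<^sub>V\<close> in the basis of index \<open>V\<close>.

  Restriction to the slanted facet replaces \<open>\<partial>\<^sub>i\<close> by \<open>\<partial>\<^sub>i - \<partial>\<^sub>h\<close> and so doubles the growth rate of
  the derivatives. After \<open>d - 1\<close> restrictions the rate is \<open>2\<^sup>d\<^sup>-\<^sup>1\<close> times the original one, which the
  hypothesis on \<open>q\<close> keeps below \<open>2 \<pi> \<tau>\<close>. Thus all series have a common geometric majorant, and the
  truncation error is at most the tail of a series of constants that do not depend on \<open>y\<close>
  (\<open>letter_op_bound\<close>, \<open>simplex_expansion_uniform\<close>).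

  For a general \<open>M\<close> the coordinates of the simplex turn \<open>\<int>\<^sup>d\<close> into \<open>M\<^sup>-\<^sup>1 \<int>\<^sup>d\<close>, a finite union of
  translates of \<open>\<int>\<^sup>d\<close>. The expansion is summed over the translates; since the bases are unimodular,
  this sum of products of periodic Bernoulli polynomials is the lattice sum of truncated ones
  (\<open>polytope_lattice_sum\<close>, \<open>bernoulli_lattice_sum\<close>).

  So far the shift must avoid countably many hyperplanes. For an arbitrary shift both sides are
  limits of averages over shrinking balls, and an inequality that holds almost everywhere passes to
  the averages and to their limits (\<open>norm_regularize_combination_le\<close>). The limits exist because all
  functions involved have a limit along almost every ray.
\<close>

section \<open>Smooth functions of several variables\<close>

lemma set_coord_eq: "set_coord x i t = x + (t - x $ i) *\<^sub>R axis i 1"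
  by (simp add: set_coord_def axis_def vec_eq_iff)

lemma set_coord_nth [simp]: "set_coord x i t $ k = (if k = i then t else x $ k)"
  by (simp add: set_coord_def)

lemma set_coord_triv [simp]: "set_coord x i (x $ i) = x"
  by (simp add: vec_eq_iff)

lemma set_coord_twice [simp]: "set_coord (set_coord x i s) i t = set_coord x i t"
  by (simp add: vec_eq_iff)

lemma set_coord_commute: "i \<noteq> j \<Longrightarrow> set_coord (set_coord x i s) j t = set_coord (set_coord x j t) i s"
  by (simp add: vec_eq_iff)

lemma continuous_on_set_coord [continuous_intros]:
  assumes "continuous_on S f" "continuous_on S g"
  shows "continuous_on S (\<lambda>x. set_coord (f x) i (g x))"
  unfolding set_coord_eq using assms by (auto intro!: continuous_intros)

lemma C_k_continuous: "C_k k f \<Longrightarrow> continuous_on UNIV f"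
  by (cases k) auto

lemma C_k_partial: "C_k (Suc k) f \<Longrightarrow> C_k k (partial i f)"
  by simp

lemma C_k_partial_derivative:
  assumes "C_k (Suc k) f"
  shows "((\<lambda>t. f (set_coord x i t)) has_vector_derivative partial i f (set_coord x i t)) (at t)"
proof -
  have "(\<lambda>s. f (set_coord (set_coord x i t) i s)) differentiable at (set_coord x i t $ i)"
    using assms unfolding C_k.simps by blast
  then have "(\<lambda>s. f (set_coord x i s)) differentiable at t" by simp
  then show ?thesis
    by (simp add: partial_def vector_derivative_works)
qed

lemma C_k_partial_derivative0:
  "C_k (Suc k) f \<Longrightarrow>
    ((\<lambda>t. f (set_coord x i t)) has_vector_derivative partial i f x) (at (x $ i))"
  using C_k_partial_derivative[of k f x i "x $ i"] by simp

lemma partial_eqI: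
  assumes "((\<lambda>t. f (set_coord x i t)) has_vector_derivative d) (at (x $ i))"
  shows "partial i f x = d"
  using assms by (simp add: partial_def vector_derivative_at)

lemma C_k_SucI:
  assumes "continuous_on UNIV f"
    and "\<And>i x. ((\<lambda>t. f (set_coord x i t)) has_vector_derivative f' i x) (at (x $ i))"
    and "\<And>i. C_k k (f' i)"
  shows "C_k (Suc k) f"
proof -
  have "partial i f = f' i" for i
    by (rule ext) (rule partial_eqI[OF assms(2)])
  moreover have "(\<lambda>t. f (set_coord x i t)) differentiable at (x $ i)" for i x
    using assms(2) by (rule differentiableI_vector)
  ultimately show ?thesis using assms by simp
qed

lemma C_k_mono_Suc: "C_k (Suc k) f \<Longrightarrow> C_k k f"
proof (induction k arbitrary: f)
  case 0
  then show ?case by (simp add: C_k_continuous)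
next
  case (Suc k)
  have "C_k k (partial i f)" for i
    using Suc.IH[of "partial i f"] Suc.prems C_k_partial[of "Suc k" f i] by simp
  then show ?case using Suc.prems by simp
qed

lemma partial_add:
  assumes "C_k (Suc k) f" "C_k (Suc k) g"
  shows "partial i (\<lambda>x. f x + g x) = (\<lambda>x. partial i f x + partial i g x)"
  by (intro ext partial_eqI has_vector_derivative_add
      C_k_partial_derivative0[OF assms(1)] C_k_partial_derivative0[OF assms(2)])

lemma C_k_add: "C_k k f \<Longrightarrow> C_k k g \<Longrightarrow> C_k k (\<lambda>x. f x + g x)"
proof (induction k arbitrary: f g)
  case 0
  then show ?case by (auto intro: continuous_intros)
next
  case (Suc k)
  show ?case
  proof (rule C_k_SucI)
    show "continuous_on UNIV (\<lambda>x. f x + g x)"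
      using Suc.prems by (auto intro: continuous_intros)
    show "((\<lambda>t. f (set_coord x i t) + g (set_coord x i t)) has_vector_derivative
        partial i f x + partial i g x) (at (x $ i))" for i x
      by (intro has_vector_derivative_add
          C_k_partial_derivative0[OF Suc.prems(1)] C_k_partial_derivative0[OF Suc.prems(2)])
    show "C_k k (\<lambda>x. partial i f x + partial i g x)" for i
      using Suc.prems by (intro Suc.IH) auto
  qed
qed

lemma C_k_scaleR: "C_k k f \<Longrightarrow> C_k k (\<lambda>x. c *\<^sub>R f x)"
proof (induction k arbitrary: f)
  case 0
  then show ?case by (auto intro: continuous_intros)
next
  case (Suc k)
  show ?case
  proof (rule C_k_SucI)
    show "continuous_on UNIV (\<lambda>x. c *\<^sub>R f x)"
      using Suc.prems by (auto intro: continuous_intros)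
    show "((\<lambda>t. c *\<^sub>R f (set_coord x i t)) has_vector_derivative
        c *\<^sub>R partial i f x) (at (x $ i))" for i x
      by (intro C_k_partial_derivative0[OF Suc.prems]
          bounded_linear.has_vector_derivative[OF bounded_linear_scaleR_right])
    show "C_k k (\<lambda>x. c *\<^sub>R partial i f x)" for i
      using Suc.prems by (intro Suc.IH) auto
  qed
qed

lemma C_k_zero: "C_k k (\<lambda>x::real^'n. 0)"
proof (induction k)
  case (Suc k)
  then show ?case by (intro C_k_SucI[where f' = "\<lambda>_ _. 0"]) auto
qed simp

lemma C_k_sum:
  assumes "\<And>i. i \<in> I \<Longrightarrow> C_k k (f i)"
  shows "C_k k (\<lambda>x. \<Sum>i\<in>I. f i x)"
  using assms
  by (induction I rule: infinite_finite_induct) (auto intro: C_k_zero C_k_add)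

text \<open>
  By induction over the coordinates in which the direction \<open>v\<close> is supported. To add one coordinate,
  the function is viewed on the plane spanned by the old direction and the new axis, where one
  partial derivative exists and the other is continuous; this suffices for differentiability.
\<close>

lemma C_k_line_derivative:
  fixes f :: "real ^ 'n \<Rightarrow> 'b::real_normed_vector"
  assumes f: "C_k (Suc k) f"
  shows "((\<lambda>t. f (x + t *\<^sub>R v)) has_vector_derivative
           (\<Sum>i\<in>UNIV. (v $ i) *\<^sub>R partial i f (x + t *\<^sub>R v))) (at t)"
proof -
  have cont: "continuous_on UNIV (partial i f)" for i
    using C_k_continuous[OF C_k_partial[OF f]] .
  have "((\<lambda>t. f (x + t *\<^sub>R (\<Sum>i\<in>K. (v $ i) *\<^sub>R axis i 1))) has_vector_derivative
           (\<Sum>i\<in>K. (v $ i) *\<^sub>R partial i f (x + t *\<^sub>R (\<Sum>i\<in>K. (v $ i) *\<^sub>R axis i 1)))) (at t)"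
    for K :: "'n set" and x t
  proof (induction K arbitrary: x t rule: infinite_finite_induct)
    case (insert i K)
    define e where "e = (v $ i) *\<^sub>R axis i (1::real)"
    define w where "w = (\<Sum>i\<in>K. (v $ i) *\<^sub>R axis i (1::real))"
    define \<phi> where "\<phi> = (\<lambda>t s. f (x + t *\<^sub>R w + s *\<^sub>R e))"
    define dw where "dw = (\<Sum>i\<in>K. (v $ i) *\<^sub>R partial i f (x + t *\<^sub>R w + t *\<^sub>R e))"
    define de where "de = (\<lambda>t s. (v $ i) *\<^sub>R partial i f (x + t *\<^sub>R w + s *\<^sub>R e))"
    have 1: "((\<lambda>r. \<phi> r t) has_derivative (\<lambda>h. h *\<^sub>R dw)) (at t)"
    proof -
      have "\<phi> r t = f ((x + t *\<^sub>R e) + r *\<^sub>R w)" for r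
        by (simp add: \<phi>_def algebra_simps)
      then show ?thesis
        using insert.IH[of "x + t *\<^sub>R e" t]
        unfolding w_def[symmetric] has_vector_derivative_def dw_def
        by (simp add: algebra_simps)
    qed
    have 2: "(\<phi> r has_derivative blinfun_apply (blinfun_scaleR_left (de r s))) (at s)" for r s
    proof -
      have "\<phi> r = (\<lambda>u. f (set_coord (x + r *\<^sub>R w) i (u * v $ i + (x + r *\<^sub>R w) $ i)))"
        by (simp add: \<phi>_def set_coord_eq e_def)
      moreover have "((\<lambda>u. f (set_coord (x + r *\<^sub>R w) i (u * v $ i + (x + r *\<^sub>R w) $ i)))
          has_vector_derivative v $ i *\<^sub>R partial i f (set_coord (x + r *\<^sub>R w) i (s * v $ i + (x + r *\<^sub>R w) $ i))) (at s)"
        by (rule vector_diff_chain_at[of "\<lambda>u. u * v $ i + (x + r *\<^sub>R w) $ i" _ _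
              "\<lambda>t. f (set_coord (x + r *\<^sub>R w) i t)", unfolded o_def])
           (auto intro!: derivative_eq_intros C_k_partial_derivative[OF f])
      moreover have "set_coord (x + r *\<^sub>R w) i (s * v $ i + (x + r *\<^sub>R w) $ i) = x + r *\<^sub>R w + s *\<^sub>R e"
        by (simp add: set_coord_eq e_def)
      ultimately show ?thesis
        by (simp add: has_vector_derivative_def de_def)
    qed
    have 3: "continuous_on UNIV (\<lambda>(r, s). blinfun_scaleR_left (de r s))"
      unfolding de_def split_def
      by (intro continuous_intros continuous_on_compose2[OF cont]
          bounded_linear.continuous_on[OF bounded_linear_blinfun_scaleR_left]) auto
    have "((\<lambda>(r, s). \<phi> r s) has_derivative (\<lambda>(h, k). h *\<^sub>R dw + blinfun_scaleR_left (de t t) k)) (at (t, t) within UNIV \<times> UNIV)"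
      using 3 by (intro has_derivative_partialsI 1 2)
        (auto simp: continuous_on_eq_continuous_within)
    then have 4: "((\<lambda>(r, s). \<phi> r s) has_derivative (\<lambda>(h, k). h *\<^sub>R dw + blinfun_scaleR_left (de t t) k)) (at (t, t))"
      by simp
    have "((\<lambda>t. (t, t)) has_derivative (\<lambda>h. (h, h))) (at t)"
      by (intro has_derivative_Pair has_derivative_ident)
    from has_derivative_compose[OF this 4]
    have "((\<lambda>r. \<phi> r r) has_vector_derivative dw + de t t) (at t)"
      by (simp add: has_vector_derivative_def algebra_simps has_derivative_Pair has_derivative_ident)
    then show ?case
      using insert.hyps
      by (simp add: \<phi>_def dw_def de_def algebra_simps w_def e_def)
  qed auto
  from this[of x UNIV t] show ?thesis
    by (simp add: basis_expansion scalar_mult_eq_scaleR[symmetric])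
qed

lemma C_k_affine_derivative:
  fixes f :: "real ^ 'n \<Rightarrow> 'b::real_normed_vector" and L :: "real ^ 'm \<Rightarrow> real ^ 'n"
  assumes f: "C_k (Suc k) f" and L: "linear L"
  shows "((\<lambda>t. f (p + L (set_coord x i t))) has_vector_derivative
           (\<Sum>j\<in>UNIV. (L (axis i 1) $ j) *\<^sub>R partial j f (p + L x))) (at (x $ i))"
proof -
  interpret linear L by fact
  have *: "p + L (set_coord x i t) = p + L (set_coord x i 0) + t *\<^sub>R L (axis i 1)" for t
    by (simp add: set_coord_eq add diff scale algebra_simps)
  show ?thesis
    using C_k_line_derivative[OF f, of "p + L (set_coord x i 0)" "L (axis i 1)" "x $ i"]
    by (simp add: *[symmetric])
qed

lemma C_k_affine:
  fixes f :: "real ^ 'n \<Rightarrow> 'b::real_normed_vector" and L :: "real ^ 'm \<Rightarrow> real ^ 'n"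
  assumes f: "C_k k f" and L: "linear L"
  shows "C_k k (\<lambda>x. f (p + L x))"
  using f
proof (induction k arbitrary: f)
  case 0
  have "continuous_on UNIV L" using L by (rule linear_continuous_on_compose[OF continuous_on_id])
  then show ?case
    using 0 by (auto intro!: continuous_intros continuous_on_compose2[of UNIV f])
next
  case (Suc k)
  show ?case
  proof (rule C_k_SucI)
    have "continuous_on UNIV L" using L by (rule linear_continuous_on_compose[OF continuous_on_id])
    then show "continuous_on UNIV (\<lambda>x. f (p + L x))"
      using Suc.prems by (auto intro!: continuous_intros continuous_on_compose2[of UNIV f])
    show "C_k k (\<lambda>x. \<Sum>j\<in>UNIV. (L (axis i 1) $ j) *\<^sub>R partial j f (p + L x))" for i
      using Suc.prems by (intro C_k_sum C_k_scaleR Suc.IH) auto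
  qed (rule C_k_affine_derivative[OF Suc.prems L])
qed

text \<open>
  The oriented antiderivative in one coordinate, vanishing where that coordinate does. Rescaling
  the interval of integration to \<open>[0, 1]\<close> makes the dependence on all coordinates visible under
  the integral sign, whatever the sign of the upper limit.
\<close>

definition coord_antideriv ::
    "'n \<Rightarrow> (real ^ 'n \<Rightarrow> 'b::euclidean_space) \<Rightarrow> real ^ 'n \<Rightarrow> 'b" where
  "coord_antideriv h g x = (x $ h) *\<^sub>R integral {0..1} (\<lambda>u. g (set_coord x h (x $ h * u)))"

lemma oriented_integral_rescale:
  fixes \<phi> :: "real \<Rightarrow> 'b::euclidean_space"
  assumes \<phi>: "continuous_on UNIV \<phi>"
  shows "t *\<^sub>R integral {0..1} (\<lambda>u. \<phi> (t * u)) = interval_lebesgue_integral lborel 0 (ereal t) \<phi>"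
    and "((\<lambda>t. interval_lebesgue_integral lborel 0 (ereal t) \<phi>) has_vector_derivative \<phi> t) (at t)"
proof -
  define F where "F = (\<lambda>t. interval_lebesgue_integral lborel 0 (ereal t) \<phi>)"
  have F: "(F has_vector_derivative \<phi> t) (at t)" for t
  proof -
    define b where "b = \<bar>t\<bar> + 1"
    have "((\<lambda>u. LBINT y=0..u. \<phi> y) has_vector_derivative (\<phi> t)) (at t within {-b..b})"
      using interval_integral_FTC2[of "-b" 0 b \<phi> t] continuous_on_subset[OF \<phi>]
      by (auto simp: b_def zero_ereal_def)
    moreover have "at t within {-b..b} = at t"
      by (rule at_within_Icc_at) (auto simp: b_def)
    ultimately show ?thesis by (simp add: F_def)
  qed
  then show "((\<lambda>t. interval_lebesgue_integral lborel 0 (ereal t) \<phi>) has_vector_derivative \<phi> t) (at t)"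
    by (simp add: F_def)
  have "((\<lambda>u. t *\<^sub>R \<phi> (t * u)) has_integral F (t * 1) - F (t * 0)) {0..1}"
  proof (rule fundamental_theorem_of_calculus)
    show "((\<lambda>u. F (t * u)) has_vector_derivative t *\<^sub>R \<phi> (t * u)) (at u within {0..1})" for u
      by (rule has_vector_derivative_at_within,
          rule vector_diff_chain_at[of "\<lambda>u. t * u" _ _ F, unfolded o_def])
         (auto intro!: derivative_eq_intros F)
  qed auto
  moreover have "F 0 = 0" by (simp add: F_def zero_ereal_def)
  ultimately have "((\<lambda>u. t *\<^sub>R \<phi> (t * u)) has_integral F t) {0..1}" by simp
  then have "integral {0..1} (\<lambda>u. t *\<^sub>R \<phi> (t * u)) = F t" by (rule integral_unique)
  then show "t *\<^sub>R integral {0..1} (\<lambda>u. \<phi> (t * u)) = interval_lebesgue_integral lborel 0 (ereal t) \<phi>"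
    by (simp add: F_def)
qed

lemma coord_antideriv_eq:
  fixes g :: "real ^ 'n \<Rightarrow> 'b::euclidean_space"
  assumes "continuous_on UNIV g"
  shows "coord_antideriv h g (set_coord x h t) =
           interval_lebesgue_integral lborel 0 (ereal t) (\<lambda>s. g (set_coord x h s))"
  using oriented_integral_rescale(1)[of "\<lambda>s. g (set_coord x h s)" t] assms
  by (simp add: coord_antideriv_def continuous_on_compose2[of UNIV g] continuous_intros)

lemma coord_antideriv_derivative_same:
  fixes g :: "real ^ 'n \<Rightarrow> 'b::euclidean_space"
  assumes "continuous_on UNIV g"
  shows "((\<lambda>t. coord_antideriv h g (set_coord x h t)) has_vector_derivative g x) (at (x $ h))"
  using oriented_integral_rescale(2)[of "\<lambda>s. g (set_coord x h s)" "x $ h"] assms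
  by (simp add: coord_antideriv_eq continuous_on_compose2[of UNIV g] continuous_intros)

lemma coord_antideriv_derivative_other:
  fixes g :: "real ^ 'n \<Rightarrow> 'b::euclidean_space"
  assumes g: "C_k (Suc k) g" and "i \<noteq> h"
  shows "((\<lambda>t. coord_antideriv h g (set_coord x i t)) has_vector_derivative
           coord_antideriv h (partial i g) x) (at (x $ i))"
proof -
  have cont: "continuous_on UNIV g" "continuous_on UNIV (partial i g)"
    using C_k_continuous[OF g] C_k_continuous[OF C_k_partial[OF g]] by auto
  define f where "f = (\<lambda>t u. g (set_coord (set_coord x h (x $ h * u)) i t))"
  define f' where "f' = (\<lambda>t u. partial i g (set_coord (set_coord x h (x $ h * u)) i t))"
  have "((\<lambda>t. integral (cbox 0 1) (f t)) has_vector_derivative integral (cbox 0 1) (f' (x $ i)))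
      (at (x $ i) within UNIV)"
  proof (rule leibniz_rule_vector_derivative)
    show "((\<lambda>t. f t u) has_vector_derivative f' t u) (at t within UNIV)" for t u
      unfolding f_def f'_def by (rule C_k_partial_derivative[OF g])
    show "f t integrable_on cbox 0 1" for t
      unfolding f_def
      by (intro integrable_continuous continuous_on_compose2[OF cont(1)] continuous_intros) auto
    show "continuous_on (UNIV \<times> cbox 0 1) (\<lambda>(t, u). f' t u)"
      unfolding f'_def split_def
      by (intro continuous_on_compose2[OF cont(2)] continuous_intros) auto
  qed auto
  moreover have "coord_antideriv h g (set_coord x i t) = x $ h *\<^sub>R integral (cbox 0 1) (f t)" for t
    using \<open>i \<noteq> h\<close> by (auto simp: coord_antideriv_def f_def set_coord_commute[of i h])
  moreover have "f' (x $ i) = (\<lambda>u. partial i g (set_coord x h (x $ h * u)))"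
  proof
    fix u
    have "set_coord (set_coord x h (x $ h * u)) i (x $ i) = set_coord x h (x $ h * u)"
      using \<open>i \<noteq> h\<close> by (simp add: vec_eq_iff)
    then show "f' (x $ i) u = partial i g (set_coord x h (x $ h * u))" by (simp add: f'_def)
  qed
  ultimately show ?thesis
    by (auto simp: coord_antideriv_def[of h "partial i g"]
        intro!: bounded_linear.has_vector_derivative[OF bounded_linear_scaleR_right])
qed

lemma C_k_coord_antideriv:
  fixes g :: "real ^ 'n \<Rightarrow> 'b::euclidean_space"
  shows "C_k k g \<Longrightarrow> C_k k (coord_antideriv h g)"
proof -
  have cont: "continuous_on UNIV (coord_antideriv h g)" if "continuous_on UNIV g"
    for g :: "real ^ 'n \<Rightarrow> 'b"
  proof -
    have "continuous_on UNIV (\<lambda>x. integral (cbox 0 1) (\<lambda>u. g (set_coord x h (x $ h * u))))"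
      by (rule integral_continuous_on_param, unfold split_def,
          intro continuous_on_compose2[OF that] continuous_intros) auto
    then show ?thesis
      by (auto simp: coord_antideriv_def[abs_def] intro!: continuous_intros)
  qed
  show "C_k k g \<Longrightarrow> C_k k (coord_antideriv h g)"
  proof (induction k arbitrary: g)
    case 0
    then show ?case by (simp add: cont)
  next
    case (Suc k)
    show ?case
    proof (rule C_k_SucI)
      show "continuous_on UNIV (coord_antideriv h g)"
        using Suc.prems by (intro cont C_k_continuous)
      show "((\<lambda>t. coord_antideriv h g (set_coord x i t)) has_vector_derivative
          (if i = h then g x else coord_antideriv h (partial i g) x)) (at (x $ i))" for i x
        using Suc.prems coord_antideriv_derivative_same[OF C_k_continuous[OF Suc.prems], of h x]
          coord_antideriv_derivative_other[OF Suc.prems, of i h x] by auto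
      show "C_k k (\<lambda>x. if i = h then g x else coord_antideriv h (partial i g) x)" for i
        using Suc.prems Suc.IH[of "partial i g"] C_k_mono_Suc[OF Suc.prems]
        by (cases "i = h") auto
    qed
  qed
qed

lemma partial_coord_antideriv:
  fixes g :: "real ^ 'n \<Rightarrow> 'b::euclidean_space"
  shows "continuous_on UNIV g \<Longrightarrow> partial h (coord_antideriv h g) = g"
    and "C_k (Suc k) g \<Longrightarrow> i \<noteq> h \<Longrightarrow> partial i (coord_antideriv h g) = coord_antideriv h (partial i g)"
  by (intro ext partial_eqI coord_antideriv_derivative_same, assumption)
     (intro ext partial_eqI coord_antideriv_derivative_other, assumption+)

text \<open>
  Clairaut's theorem. Writing a function as its restriction to a hyperplane plus the
  antiderivative of its derivative, the first part is annihilated by \<open>\<partial>\<^sub>h\<close> even after applying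
  \<open>\<partial>\<^sub>i\<close>, and on the second part \<open>\<partial>\<^sub>i\<close> can be taken under the integral sign.
\<close>

lemma partial_commute:
  fixes f :: "real ^ 'n \<Rightarrow> 'b::euclidean_space"
  assumes f: "C_k (Suc (Suc (Suc 0))) f"
  shows "partial h (partial i f) = partial i (partial h f)"
proof (cases "i = h")
  case False
  define f0 where "f0 = (\<lambda>x. f (set_coord x h 0))"
  have lin: "linear (\<lambda>x. set_coord x h (0::real))"
    by (rule linearI) (auto simp: vec_eq_iff)
  have ph: "C_k (Suc (Suc 0)) (partial h f)" using f by simp
  have f0: "C_k (Suc (Suc (Suc 0))) f0"
    using C_k_affine[OF f lin, of 0] by (simp add: f0_def)
  have decomp: "f = (\<lambda>x. f0 x + coord_antideriv h (partial h f) x)"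
  proof
    fix x
    have c: "continuous_on UNIV (\<lambda>s. partial h f (set_coord x h s))"
      by (intro continuous_on_compose2[OF C_k_continuous[OF ph]] continuous_intros) auto
    define d where "d = (\<lambda>t. f (set_coord x h t) - coord_antideriv h (partial h f) (set_coord x h t))"
    have "(d has_vector_derivative 0) (at t within UNIV)" for t
      unfolding d_def
      using has_vector_derivative_diff[OF C_k_partial_derivative[OF f, of x h t]
        coord_antideriv_derivative_same[OF C_k_continuous[OF ph], of h "set_coord x h t", simplified]]
      by simp
    then obtain c where "\<And>t. d t = c"
      using has_vector_derivative_zero_constant[of UNIV d] by auto
    then have "d (x $ h) = d 0" by simp
    then show "f x = f0 x + coord_antideriv h (partial h f) x"
      by (simp add: d_def f0_def coord_antideriv_def algebra_simps)
  qed
  have pif0: "partial i f0 (set_coord x h t) = partial i f0 (set_coord x h 0)" for x t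
    using False by (simp add: partial_def f0_def set_coord_commute[of h i])
  have "partial i f = (\<lambda>x. partial i f0 x + partial i (coord_antideriv h (partial h f)) x)"
    by (subst decomp) (rule partial_add[OF C_k_mono_Suc[OF f0] C_k_coord_antideriv[OF ph]])
  also have "\<dots> = (\<lambda>x. partial i f0 x + coord_antideriv h (partial i (partial h f)) x)"
    using partial_coord_antideriv(2)[OF ph False] by simp
  finally have "partial h (partial i f) =
      (\<lambda>x. partial h (partial i f0) x + partial h (coord_antideriv h (partial i (partial h f))) x)"
    using partial_add[of 0 "partial i f0" "coord_antideriv h (partial i (partial h f))" h]
      f0 C_k_coord_antideriv[of "Suc 0" "partial i (partial h f)"] ph by auto
  also have "partial h (partial i f0) = (\<lambda>x. 0)"
    by (intro ext partial_eqI, subst pif0) simp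
  also have "partial h (coord_antideriv h (partial i (partial h f))) = partial i (partial h f)"
    using ph by (intro partial_coord_antideriv(1) C_k_continuous[of "Suc 0"]) simp
  finally show ?thesis by simp
qed simp

lemma C_infinity_partial: "C_infinity f \<Longrightarrow> C_infinity (partial i f)"
  unfolding C_infinity_def using C_k_partial by blast

lemma C_infinity_partial_power: "C_infinity f \<Longrightarrow> C_infinity ((partial i ^^ n) f)"
  by (induction n) (auto intro: C_infinity_partial)

lemma C_infinity_affine:
  "C_infinity f \<Longrightarrow> linear L \<Longrightarrow> C_infinity (\<lambda>x. f (p + L x))"
  by (simp add: C_infinity_def C_k_affine)

lemma C_infinity_scaleR: "C_infinity f \<Longrightarrow> C_infinity (\<lambda>x. c *\<^sub>R f x)"
  by (simp add: C_infinity_def C_k_scaleR)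

lemma C_infinity_diff: "C_infinity f \<Longrightarrow> C_infinity g \<Longrightarrow> C_infinity (\<lambda>x. f x - g x)"
  using C_k_add[of _ f "\<lambda>x. (-1) *\<^sub>R g x"] C_k_scaleR[of _ g "-1"] by (simp add: C_infinity_def)

lemma C_infinity_continuous: "C_infinity f \<Longrightarrow> continuous_on UNIV f"
  unfolding C_infinity_def using C_k_continuous by blast

lemma C_infinity_coord_antideriv: "C_infinity g \<Longrightarrow> C_infinity (coord_antideriv h g)"
  by (simp add: C_infinity_def C_k_coord_antideriv)

lemma C_infinity_partial_commute:
  fixes f :: "real ^ 'n \<Rightarrow> 'b::euclidean_space"
  shows "C_infinity f \<Longrightarrow> partial h (partial i f) = partial i (partial h f)"
  unfolding C_infinity_def using partial_commute by blast

section \<open>Periodic Bernoulli polynomials\<close>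

text \<open>
  The Taylor coefficients of \<open>z / (exp z - 1)\<close>; multiplying this series by \<open>exp (x z)\<close> gives the
  generating function of the Bernoulli polynomials.
\<close>

definition bernoulli_coeff :: "nat \<Rightarrow> real" where
  "bernoulli_coeff n = Re (fps_nth (inverse (fps_shift 1 (fps_exp 1 - 1))) n)"

definition bernoulli_poly :: "nat \<Rightarrow> real \<Rightarrow> real" where
  "bernoulli_poly n x = (\<Sum>k\<le>n. bernoulli_coeff k * x ^ (n - k) / fact (n - k))"

lemma bernoulli_coeff_recurrence:
  "(\<Sum>k\<le>n. bernoulli_coeff k / fact (Suc (n - k))) = (if n = 0 then 1 else 0)"
proof -
  define E :: "complex fps" where "E = fps_shift 1 (fps_exp 1 - 1)"
  have nth: "fps_nth E k = of_real (1 / fact (Suc k))" for k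
    by (simp add: E_def distrib_right)
  have "inverse E * E = 1"
    by (rule inverse_mult_eq_1) (simp add: nth)
  then have "Re (fps_nth (inverse E * E) n) = (if n = 0 then 1 else 0)"
    by simp
  moreover have "Re (fps_nth (inverse E * E) n) = (\<Sum>k\<le>n. bernoulli_coeff k / fact (Suc (n - k)))"
    unfolding fps_mult_nth nth Re_sum E_def[symmetric] bernoulli_coeff_def
    by (intro sum.cong) (auto simp: Re_divide_of_real simp del: fact_Suc of_real_divide)
  ultimately show ?thesis by simp
qed

text \<open>
  The function \<open>z / (exp z - 1)\<close> has its nearest poles at \<open>\<plusminus> 2 \<pi> \<i>\<close>, so its Taylor coefficients
  decay faster than \<open>r\<^sup>-\<^sup>n\<close> for every \<open>r < 2 \<pi>\<close>.
\<close>

lemma bernoulli_coeff_bound: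
  assumes "0 < r" "r < 2 * pi"
  obtains K where "K > 0" "\<And>n. \<bar>bernoulli_coeff n\<bar> \<le> K / r ^ n"
proof -
  define E :: "complex fps" where "E = fps_shift 1 (fps_exp 1 - 1)"
  have radE: "fps_conv_radius E = \<infinity>"
  proof -
    have "fps_conv_radius (fps_exp 1 - 1 :: complex fps) \<ge> min \<infinity> \<infinity>"
      using fps_conv_radius_diff[of "fps_exp 1 :: complex fps" 1] by simp
    then show ?thesis by (simp add: E_def)
  qed
  have nz: "eval_fps E z \<noteq> 0" if "ereal (norm z) < min (2 * pi) (fps_conv_radius E)" for z
  proof (cases "z = 0")
    case True
    then show ?thesis by (simp add: eval_fps_at_0 E_def)
  next
    case False
    have sub: "subdegree (fps_exp 1 - 1 :: complex fps) \<ge> 1"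
      by (intro subdegree_geI) (auto simp: fps_eq_iff intro!: exI[of _ 1])
    have "eval_fps E z = eval_fps (fps_exp 1 - 1) z / z ^ 1"
      unfolding E_def using False sub radE
      by (subst eval_fps_shift) (auto simp: E_def)
    also have "eval_fps (fps_exp 1 - 1) z = exp z - 1"
      by (subst eval_fps_diff) auto
    finally have *: "eval_fps E z = (exp z - 1) / z" by simp
    have "exp z \<noteq> 1"
    proof
      assume "exp z = 1"
      then obtain n :: int where n: "Re z = 0" "Im z = of_int (2 * n) * pi"
        by (auto simp: exp_eq_1)
      with False have "n \<noteq> 0" by (auto simp: complex_eq_iff)
      then have "1 \<le> \<bar>of_int n :: real\<bar>" by linarith
      then have "2 * pi * 1 \<le> 2 * pi * \<bar>of_int n\<bar>" by (intro mult_left_mono) auto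
      also have "\<dots> = \<bar>Im z\<bar>" using n by (simp add: abs_mult)
      also have "\<dots> \<le> norm z" by (rule abs_Im_le_cmod)
      finally show False using that by simp
    qed
    then show ?thesis using * False by simp
  qed
  have "ereal (2 * pi) \<le> fps_conv_radius (inverse E)"
    using fps_conv_radius_inverse[where f = E and r = "2 * pi"] nz radE by simp
  then have "ereal (norm (of_real r :: complex)) < conv_radius (fps_nth (inverse E))"
    using assms by (auto simp: fps_conv_radius_def intro: less_le_trans[rotated])
  from abs_summable_in_conv_radius[OF this]
  have "summable (\<lambda>n. norm (fps_nth (inverse E) n * of_real r ^ n))" .
  then have "Bseq (\<lambda>n. norm (fps_nth (inverse E) n * of_real r ^ n))"
    by (intro convergent_imp_Bseq convergentI[of _ 0] summable_LIMSEQ_zero)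
  then obtain K where K: "K > 0" "\<And>n. norm (fps_nth (inverse E) n) * r ^ n \<le> K"
    using assms(1) by (auto simp: Bseq_def norm_mult norm_power)
  show ?thesis
  proof (rule that[OF K(1)])
    fix n
    have "\<bar>bernoulli_coeff n\<bar> \<le> norm (fps_nth (inverse E) n)"
      unfolding bernoulli_coeff_def E_def by (rule abs_Re_le_cmod)
    also have "\<dots> \<le> K / r ^ n" using K(2)[of n] assms(1) by (simp add: field_simps)
    finally show "\<bar>bernoulli_coeff n\<bar> \<le> K / r ^ n" .
  qed
qed

lemma bernoulli_poly_bound:
  assumes "0 < r" "r < 2 * pi"
  obtains K where "K > 0" "\<And>n x. 0 \<le> x \<Longrightarrow> x \<le> 1 \<Longrightarrow> \<bar>bernoulli_poly n x\<bar> \<le> K / r ^ n"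
proof -
  obtain K where K: "K > 0" "\<And>n. \<bar>bernoulli_coeff n\<bar> \<le> K / r ^ n"
    using bernoulli_coeff_bound[OF assms] by blast
  show ?thesis
  proof (rule that)
    show "K * exp r > 0" using K by simp
    fix n and x :: real assume x: "0 \<le> x" "x \<le> 1"
    have "\<bar>bernoulli_poly n x\<bar> \<le> (\<Sum>k\<le>n. \<bar>bernoulli_coeff k * x ^ (n - k) / fact (n - k)\<bar>)"
      unfolding bernoulli_poly_def by (rule sum_abs)
    also have "\<dots> \<le> (\<Sum>k\<le>n. K / r ^ n * (r ^ (n - k) / fact (n - k)))"
    proof (rule sum_mono)
      fix k assume "k \<in> {..n}"
      then have rn: "r ^ n = r ^ k * r ^ (n - k)" by (simp add: power_add[symmetric])
      have *: "\<bar>bernoulli_coeff k\<bar> * x ^ (n - k) \<le> K / r ^ k * 1"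
        using K x assms(1) by (intro mult_mono) (auto simp: power_le_one)
      have "\<bar>bernoulli_coeff k * x ^ (n - k) / fact (n - k)\<bar> \<le> K / r ^ k * 1 / fact (n - k)"
        using divide_right_mono[of _ _ "fact (n - k) :: real", OF *] x by (simp add: abs_mult)
      also have "\<dots> = K / r ^ n * (r ^ (n - k) / fact (n - k))"
        using assms(1) by (simp add: rn)
      finally show "\<bar>bernoulli_coeff k * x ^ (n - k) / fact (n - k)\<bar> \<le> \<dots>" .
    qed
    also have "\<dots> = K / r ^ n * (\<Sum>k\<le>n. r ^ k / fact k)"
      unfolding sum_distrib_left
      by (rule sum.reindex_bij_witness[of _ "\<lambda>k. n - k" "\<lambda>k. n - k"]) auto
    also have "(\<Sum>k\<le>n. r ^ k / fact k) \<le> exp r"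
    proof -
      have "(\<lambda>k. r ^ k / fact k) sums exp r"
        using exp_converges[of r] by (simp add: divide_inverse_commute)
      then show ?thesis
        using assms(1) sum_le_suminf[of "\<lambda>k. r ^ k / fact k" "{..n}"] by (simp add: sums_iff)
    qed
    finally show "\<bar>bernoulli_poly n x\<bar> \<le> K * exp r / r ^ n"
      using K(1) assms(1) by (simp add: mult_left_mono divide_right_mono)
  qed
qed

lemma bernoulli_poly_0 [simp]: "bernoulli_poly 0 x = 1"
  using bernoulli_coeff_recurrence[of 0] by (simp add: bernoulli_poly_def)

lemma bernoulli_poly_deriv [derivative_intros]:
  "(bernoulli_poly (Suc n) has_real_derivative bernoulli_poly n x) (at x within S)"
proof -
  have "(bernoulli_poly (Suc n) has_real_derivative
      (\<Sum>k\<le>Suc n. bernoulli_coeff k * (real (Suc n - k) * x ^ (Suc n - k - 1)) / fact (Suc n - k))) (at x within S)"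
    unfolding bernoulli_poly_def[abs_def]
    by (auto intro!: derivative_eq_intros sum.cong)
  also have "(\<Sum>k\<le>Suc n. bernoulli_coeff k * (real (Suc n - k) * x ^ (Suc n - k - 1)) / fact (Suc n - k))
      = bernoulli_poly n x"
  proof -
    have "bernoulli_coeff k * (real (Suc n - k) * x ^ (Suc n - k - 1)) / fact (Suc n - k) =
        bernoulli_coeff k * x ^ (n - k) / fact (n - k)" if "k \<le> n" for k
    proof -
      have "Suc n - k = Suc (n - k)" using that by simp
      then show ?thesis by (simp del: of_nat_Suc)
    qed
    then show ?thesis by (auto simp: bernoulli_poly_def intro!: sum.cong)
  qed
  finally show ?thesis .
qed

lemma bernoulli_poly_continuous [continuous_intros]:
  "continuous_on S f \<Longrightarrow> continuous_on S (\<lambda>x. bernoulli_poly n (f x))"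
  unfolding bernoulli_poly_def by (intro continuous_intros) auto

text \<open>
  The difference of the two values is a coefficient of the product of \<open>z / (exp z - 1)\<close> and
  \<open>(exp z - 1) / z\<close>, which is the constant 1.
\<close>

lemma bernoulli_poly_endpoints:
  "bernoulli_poly (Suc n) 1 = bernoulli_poly (Suc n) 0 + (if n = 0 then 1 else 0)"
proof -
  have "bernoulli_poly (Suc n) 1 = bernoulli_coeff (Suc n) + (\<Sum>k\<le>n. bernoulli_coeff k / fact (Suc (n - k)))"
    by (simp add: bernoulli_poly_def Suc_diff_le del: fact_Suc)
  moreover have "bernoulli_poly (Suc n) 0 = bernoulli_coeff (Suc n)"
    by (simp add: bernoulli_poly_def power_0_left sum.delta if_distrib Suc_diff_le cong: if_cong)
  ultimately show ?thesis using bernoulli_coeff_recurrence[of n] by simp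
qed

lemma bernoulli_poly_mean: "(bernoulli_poly (Suc n) has_integral 0) {0..1}"
  using fundamental_theorem_of_calculus[of 0 1 "bernoulli_poly (Suc (Suc n))" "bernoulli_poly (Suc n)"]
    bernoulli_poly_deriv[of "Suc n"] bernoulli_poly_endpoints[of "Suc n"]
  by (simp add: has_real_derivative_iff_has_vector_derivative[symmetric])

lemma bernoulli_add_int: "bernoulli n (x + of_int k) = bernoulli n x"
proof (induction k rule: int_induct[where k = 0])
  case (step1 i)
  have "bernoulli n ((x + of_int i) + 1) = bernoulli n (x + of_int i)"
    using is_bernoulli_bernoulli unfolding is_bernoulli_def by blast
  then show ?case using step1 by (simp add: algebra_simps)
next
  case (step2 i)
  have "bernoulli n ((x + of_int (i - 1)) + 1) = bernoulli n (x + of_int (i - 1))"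
    using is_bernoulli_bernoulli unfolding is_bernoulli_def by blast
  then show ?case using step2 by (simp add: algebra_simps)
qed simp

lemma bernoulli_add_Ints: "k \<in> \<int> \<Longrightarrow> bernoulli n (x + k) = bernoulli n x"
  by (auto elim!: Ints_cases simp: bernoulli_add_int)

lemma bernoulli_eq_poly:
  assumes "0 < x" "x < 1"
  shows "bernoulli n x = bernoulli_poly n x"
  using assms
proof (induction n arbitrary: x)
  case 0
  then show ?case using is_bernoulli_bernoulli by (simp add: is_bernoulli_def)
next
  case (Suc n)
  have "((\<lambda>x. bernoulli (Suc n) x - bernoulli_poly (Suc n) x) has_real_derivative 0) (at x within {0<..<1})"
    if "x \<in> {0<..<1}" for x
  proof -
    have "(bernoulli (Suc n) has_real_derivative bernoulli n x) (at x within {0<..<1})"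
      using is_bernoulli_bernoulli that
      by (intro has_field_derivative_at_within[of _ _ _ "{0<..<1}"]) (auto simp: is_bernoulli_def)
    from DERIV_diff[OF this bernoulli_poly_deriv[of n x]] show ?thesis
      using Suc.IH[of x] that by simp
  qed
  then obtain c where c: "\<And>x. x \<in> {0<..<1} \<Longrightarrow> bernoulli (Suc n) x - bernoulli_poly (Suc n) x = c"
    using has_field_derivative_zero_constant[of "{0<..<1::real}"] by (metis convex_real_interval(8))
  have diff: "((\<lambda>x. bernoulli (Suc n) x - bernoulli_poly (Suc n) x) has_integral 0 - 0) {0..1}"
    using is_bernoulli_bernoulli by (intro has_integral_diff bernoulli_poly_mean) (auto simp: is_bernoulli_def)
  have "((\<lambda>x. c) has_integral 0 - 0) {0..1::real}"
    by (rule has_integral_spike_finite[OF _ _ diff, of "{0,1}"]) (auto simp: c)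
  moreover have "((\<lambda>x. c) has_integral c) {0..1::real}"
    using has_integral_const_real[of c 0 1] by simp
  ultimately have "c = 0 - 0" by (rule has_integral_unique[symmetric])
  then show ?case using c[of x] Suc.prems by simp
qed

lemma bernoulli_eq_poly_shift:
  assumes "of_int m < x" "x < of_int m + 1"
  shows "bernoulli n x = bernoulli_poly n (x - of_int m)"
  using assms bernoulli_eq_poly[of "x - of_int m" n] bernoulli_add_int[of n "x - of_int m" m] by simp

text \<open>
  The number \<open>1 - frac (- x)\<close> is the fractional part of \<open>x\<close>, but with the value 1 instead of 0 at
  the integers.
\<close>

lemma bernoulli_one_sided_limits:
  shows "((\<lambda>\<epsilon>. bernoulli n (x + \<epsilon>)) \<longlongrightarrow> bernoulli_poly n (frac x)) (at_right 0)"
    and "((\<lambda>\<epsilon>. bernoulli n (x - \<epsilon>)) \<longlongrightarrow> bernoulli_poly n (1 - frac (- x))) (at_right 0)"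
proof -
  have cont: "((\<lambda>\<epsilon>. bernoulli_poly n (f \<epsilon>)) \<longlongrightarrow> bernoulli_poly n (f 0)) (at_right 0)"
    if "continuous_on UNIV f" for f :: "real \<Rightarrow> real"
    using bernoulli_poly_continuous[OF that, of n]
    by (auto simp: continuous_on_def intro: tendsto_within_subset)
  have "\<forall>\<^sub>F \<epsilon> in at_right 0. bernoulli_poly n (x + \<epsilon> - of_int \<lfloor>x\<rfloor>) = bernoulli n (x + \<epsilon>)"
  proof -
    have "\<forall>\<^sub>F \<epsilon> in at_right 0. \<epsilon> \<in> {0<..<1 - frac x}"
      by (rule eventually_at_right_real) (simp add: frac_lt_1)
    then show ?thesis
    proof eventually_elim
      case (elim \<epsilon>)
      have "of_int \<lfloor>x\<rfloor> < x + \<epsilon>" using elim of_int_floor_le[of x] unfolding greaterThanLessThan_iff by linarith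
      then show ?case using elim
        by (intro bernoulli_eq_poly_shift[symmetric]) (auto simp: frac_def)
    qed
  qed
  moreover have "((\<lambda>\<epsilon>. bernoulli_poly n (x + \<epsilon> - of_int \<lfloor>x\<rfloor>)) \<longlongrightarrow> bernoulli_poly n (frac x)) (at_right 0)"
    using cont[of "\<lambda>\<epsilon>. x + \<epsilon> - of_int \<lfloor>x\<rfloor>"] by (simp add: continuous_intros frac_def)
  ultimately show "((\<lambda>\<epsilon>. bernoulli n (x + \<epsilon>)) \<longlongrightarrow> bernoulli_poly n (frac x)) (at_right 0)"
    by (rule Lim_transform_eventually[rotated])
  have "\<forall>\<^sub>F \<epsilon> in at_right 0. bernoulli_poly n (x - \<epsilon> - of_int (- \<lfloor>- x\<rfloor> - 1)) = bernoulli n (x - \<epsilon>)"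
  proof -
    have "\<forall>\<^sub>F \<epsilon> in at_right 0. \<epsilon> \<in> {0<..<1 - frac (- x)}"
      by (rule eventually_at_right_real) (simp add: frac_lt_1)
    then show ?thesis
    proof eventually_elim
      case (elim \<epsilon>)
      have "x - \<epsilon> < - of_int \<lfloor>- x\<rfloor>"
        using elim of_int_floor_le[of "- x"] unfolding greaterThanLessThan_iff by linarith
      then show ?case using elim
        by (intro bernoulli_eq_poly_shift[symmetric]) (auto simp: frac_def)
    qed
  qed
  moreover have "((\<lambda>\<epsilon>. bernoulli_poly n (x - \<epsilon> - of_int (- \<lfloor>- x\<rfloor> - 1))) \<longlongrightarrow> bernoulli_poly n (1 - frac (- x))) (at_right 0)"
    using cont[of "\<lambda>\<epsilon>. x - \<epsilon> - of_int (- \<lfloor>- x\<rfloor> - 1)"] by (simp add: continuous_intros frac_def algebra_simps)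
  ultimately show "((\<lambda>\<epsilon>. bernoulli n (x - \<epsilon>)) \<longlongrightarrow> bernoulli_poly n (1 - frac (- x))) (at_right 0)"
    by (rule Lim_transform_eventually[rotated])
qed

lemma bernoulli_ray_limit:
  assumes "b \<noteq> 0"
  shows "\<exists>l. ((\<lambda>\<epsilon>. bernoulli n (a - \<epsilon> * b)) \<longlongrightarrow> l) (at_right 0)"
proof (cases "b > 0")
  case True
  have "filterlim (\<lambda>\<epsilon>. \<epsilon> * b) (at_right 0) (at_right 0)"
    using True unfolding filterlim_at
    by (auto intro!: tendsto_eq_intros eventually_at_rightI[of 0 1])
  from filterlim_compose[OF bernoulli_one_sided_limits(2)[of n a] this] show ?thesis by blast
next
  case False
  then have "b < 0" using assms by simp
  then have "filterlim (\<lambda>\<epsilon>. - (\<epsilon> * b)) (at_right 0) (at_right 0)"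
    unfolding filterlim_at
    by (auto intro!: tendsto_eq_intros eventually_at_rightI[of 0 1] simp: mult_pos_neg)
  from filterlim_compose[OF bernoulli_one_sided_limits(1)[of n a] this] show ?thesis by auto
qed

lemma bernoulli_Ints:
  assumes "x \<in> \<int>"
  shows "bernoulli n x = (bernoulli_poly n 0 + bernoulli_poly n 1) / 2"
proof -
  have "((\<lambda>\<epsilon>. (bernoulli n (x + \<epsilon>) + bernoulli n (x - \<epsilon>)) / 2) \<longlongrightarrow> bernoulli n x) (at_right 0)"
    using is_bernoulli_bernoulli assms by (auto simp: is_bernoulli_def)
  moreover have "((\<lambda>\<epsilon>. (bernoulli n (x + \<epsilon>) + bernoulli n (x - \<epsilon>)) / 2)
      \<longlongrightarrow> (bernoulli_poly n (frac x) + bernoulli_poly n (1 - frac (- x))) / 2) (at_right 0)"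
    by (intro tendsto_intros bernoulli_one_sided_limits) auto
  ultimately have "bernoulli n x = (bernoulli_poly n (frac x) + bernoulli_poly n (1 - frac (- x))) / 2"
    by (rule tendsto_unique[OF trivial_limit_at_right_real])
  moreover have "frac x = 0" "frac (- x) = 0" using assms by auto
  ultimately show ?thesis by simp
qed

lemma bernoulli_frac:
  assumes "x \<notin> \<int>"
  shows "bernoulli n x = bernoulli_poly n (frac x)"
proof -
  have "0 < frac x" "frac x < 1" using assms by (simp_all add: frac_lt_1)
  then show ?thesis
    using bernoulli_eq_poly_shift[of "\<lfloor>x\<rfloor>" x n] by (simp add: frac_def)
qed

lemma bernoulli_0 [simp]: "bernoulli 0 x = 1"
  by (cases "x \<in> \<int>") (auto simp: bernoulli_Ints bernoulli_frac)

lemma bernoulli_bound: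
  assumes "0 < r" "r < 2 * pi"
  obtains K where "K > 0" "\<And>n x. \<bar>bernoulli n x\<bar> \<le> K / r ^ n"
proof -
  obtain K where K: "K > 0" "\<And>n x. 0 \<le> x \<Longrightarrow> x \<le> 1 \<Longrightarrow> \<bar>bernoulli_poly n x\<bar> \<le> K / r ^ n"
    using bernoulli_poly_bound[OF assms] by blast
  show ?thesis
  proof (rule that[OF K(1)])
    fix n x
    show "\<bar>bernoulli n x\<bar> \<le> K / r ^ n"
    proof (cases "x \<in> \<int>")
      case True
      then have "2 * \<bar>bernoulli n x\<bar> \<le> \<bar>bernoulli_poly n 0\<bar> + \<bar>bernoulli_poly n 1\<bar>"
        by (simp add: bernoulli_Ints)
      then show ?thesis using K(2)[of 0 n] K(2)[of 1 n] by linarith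
    next
      case False
      then show ?thesis using K(2)[of "frac x" n] by (simp add: bernoulli_frac frac_lt_1 less_imp_le)
    qed
  qed
qed

lemma bernoulli_measurable [measurable]: "bernoulli n \<in> borel_measurable borel"
proof -
  have *: "bernoulli n = (\<lambda>x. if x - of_int \<lfloor>x\<rfloor> = 0 then (bernoulli_poly n 0 + bernoulli_poly n 1) / 2
      else bernoulli_poly n (x - of_int \<lfloor>x\<rfloor>))"
    by (rule ext) (simp add: bernoulli_Ints bernoulli_frac frac_def[symmetric])
  have [measurable]: "bernoulli_poly n \<in> borel_measurable borel"
    by (intro borel_measurable_continuous_onI continuous_intros)
  show ?thesis by (subst *) measurable
qed

lemma bernoulli_1: "x \<notin> \<int> \<Longrightarrow> bernoulli 1 x = x - of_int \<lfloor>x\<rfloor> - 1 / 2"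
proof -
  have "bernoulli_coeff 0 = 1" using bernoulli_coeff_recurrence[of 0] by simp
  moreover have "bernoulli_coeff 1 = - 1 / 2"
    using bernoulli_coeff_recurrence[of 1] \<open>bernoulli_coeff 0 = 1\<close> by simp
  ultimately show "x \<notin> \<int> \<Longrightarrow> bernoulli 1 x = x - of_int \<lfloor>x\<rfloor> - 1 / 2"
    by (simp add: bernoulli_frac bernoulli_poly_def frac_def)
qed

lemma bernoulli_deriv:
  assumes "x \<notin> \<int>"
  shows "(bernoulli (Suc n) has_real_derivative bernoulli n x) (at x)"
proof -
  define m where "m = \<lfloor>x\<rfloor>"
  have m: "x \<in> {of_int m<..<of_int m + 1}"
    using assms frac_gt_0_iff[of x] frac_lt_1[of x] by (simp add: m_def frac_def)
  have "((\<lambda>x. bernoulli_poly (Suc n) (x - of_int m)) has_real_derivative bernoulli n x) (at x)"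
    using m
      DERIV_chain2[of "bernoulli_poly (Suc n)" "bernoulli_poly n (x - of_int m)" "\<lambda>x. x - of_int m" x 1 UNIV]
    by (simp add: bernoulli_poly_deriv bernoulli_eq_poly_shift[of m x n] DERIV_ident DERIV_diff[OF DERIV_ident DERIV_const, simplified])
  then show ?thesis
    by (rule has_field_derivative_transform_within_open[OF _ open_greaterThanLessThan m])
       (simp add: bernoulli_eq_poly_shift[of m])
qed

text \<open>From index 2 on the polynomials agree at both ends of the period, so there is no jump.\<close>

lemma bernoulli_continuous: "continuous_on UNIV (bernoulli (Suc (Suc n)))"
proof -
  have "isCont (bernoulli (Suc (Suc n))) x" for x
  proof (cases "x \<in> \<int>")
    case False
    then show ?thesis using bernoulli_deriv DERIV_isCont by blast
  next
    case True
    then have fr: "frac x = 0" "frac (- x) = 0" by auto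
    have v: "bernoulli (Suc (Suc n)) x = bernoulli_poly (Suc (Suc n)) 0"
      "bernoulli_poly (Suc (Suc n)) 1 = bernoulli_poly (Suc (Suc n)) 0"
      using True bernoulli_poly_endpoints[of "Suc n"] by (auto simp: bernoulli_Ints)
    have "((\<lambda>h. bernoulli (Suc (Suc n)) (x + h)) \<longlongrightarrow> bernoulli (Suc (Suc n)) x) (at_right 0)"
      using bernoulli_one_sided_limits(1)[of "Suc (Suc n)" x] by (simp add: fr v)
    moreover have "((\<lambda>h. bernoulli (Suc (Suc n)) (x + h)) \<longlongrightarrow> bernoulli (Suc (Suc n)) x) (at_left 0)"
      using bernoulli_one_sided_limits(2)[of "Suc (Suc n)" x] filterlim_at_left_to_right[of "\<lambda>h. bernoulli (Suc (Suc n)) (x + h)" _ 0]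
      by (simp add: fr v)
    ultimately show ?thesis
      unfolding isCont_iff using filterlim_split_at by blast
  qed
  then show ?thesis by (simp add: continuous_at_imp_continuous_on)
qed

section \<open>Euler-Maclaurin expansion on an interval\<close>

definition lattice_points :: "real \<Rightarrow> real \<Rightarrow> real \<Rightarrow> real set" where
  "lattice_points \<tau> y s = {t. 0 \<le> t \<and> t \<le> s \<and> \<tau> * t - y \<in> \<int>}"

lemma lattice_points_eq:
  assumes "\<tau> > 0"
  shows "lattice_points \<tau> y s = (\<lambda>m. (y - of_int m) / \<tau>) ` {m. y - \<tau> * s \<le> of_int m \<and> of_int m \<le> y}"
proof (intro equalityI subsetI)
  fix t assume "t \<in> lattice_points \<tau> y s"
  then have t: "0 \<le> t" "t \<le> s" and "\<tau> * t - y \<in> \<int>" by (auto simp: lattice_points_def)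
  then obtain k where k: "\<tau> * t - y = of_int k" by (auto elim: Ints_cases)
  have "t = (y - of_int (- k)) / \<tau>" using assms k by (simp add: field_simps)
  moreover have "- k \<in> {m. y - \<tau> * s \<le> of_int m \<and> of_int m \<le> y}"
  proof -
    have "0 \<le> \<tau> * t" "\<tau> * t \<le> \<tau> * s" using t assms by (auto intro: mult_left_mono)
    then show ?thesis using k by auto
  qed
  ultimately show "t \<in> (\<lambda>m. (y - of_int m) / \<tau>) ` {m. y - \<tau> * s \<le> of_int m \<and> of_int m \<le> y}"
    by blast
qed (use assms in \<open>auto simp: lattice_points_def field_simps\<close>)

lemma finite_lattice_points:
  assumes "\<tau> > 0"
  shows "finite (lattice_points \<tau> y s)"
proof -
  have "{m. y - \<tau> * s \<le> of_int m \<and> of_int m \<le> y} \<subseteq> {\<lfloor>y - \<tau> * s\<rfloor>..\<lceil>y\<rceil>}"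
  proof (intro subsetI)
    fix m :: int assume "m \<in> {m. y - \<tau> * s \<le> of_int m \<and> of_int m \<le> y}"
    then have "y - \<tau> * s \<le> of_int m" "of_int m \<le> y" by auto
    then show "m \<in> {\<lfloor>y - \<tau> * s\<rfloor>..\<lceil>y\<rceil>}" by (simp add: floor_le_iff le_ceiling_iff)
  qed
  then show ?thesis
    unfolding lattice_points_eq[OF assms] by (intro finite_imageI finite_subset[OF _ finite_atLeastAtMost_int])
qed

lemma card_lattice_points:
  assumes "\<tau> > 0" "t \<ge> 0" "y \<notin> \<int>" "y - \<tau> * t \<notin> \<int>"
  shows "real (card (lattice_points \<tau> y t)) = \<tau> * t + bernoulli 1 (y - \<tau> * t) - bernoulli 1 y"
proof -
  have "{m. y - \<tau> * t \<le> of_int m \<and> of_int m \<le> y} = {\<lfloor>y - \<tau> * t\<rfloor> <.. \<lfloor>y\<rfloor>}"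
  proof -
    have ne: "y - \<tau> * t \<noteq> of_int m" for m using assms(4) Ints_of_int[of m] by metis
    have "y - \<tau> * t \<le> of_int m \<longleftrightarrow> \<lfloor>y - \<tau> * t\<rfloor> < m" for m
      using ne[of m] by (subst floor_less_iff) auto
    then show ?thesis by (intro set_eqI) (simp add: le_floor_iff)
  qed
  moreover have "inj_on (\<lambda>m. (y - of_int m) / \<tau>) S" for S
    using assms(1) by (auto simp: inj_on_def)
  ultimately have "card (lattice_points \<tau> y t) = nat (\<lfloor>y\<rfloor> - \<lfloor>y - \<tau> * t\<rfloor>)"
    unfolding lattice_points_eq[OF assms(1)] by (simp add: card_image)
  moreover have "\<lfloor>y - \<tau> * t\<rfloor> \<le> \<lfloor>y\<rfloor>" using assms by (intro floor_mono) simp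
  ultimately show ?thesis
    using bernoulli_1[OF assms(3)] bernoulli_1[OF assms(4)] by simp
qed

text \<open>
  Abel summation: each lattice point \<open>u\<close> contributes \<open>g u = g s - (\<integral> g' over [u, s])\<close>, and the
  number of lattice points up to \<open>t\<close> is linear in \<open>t\<close> up to the sawtooth function \<open>B\<^sub>1\<close>.
\<close>

lemma euler_maclaurin_base:
  fixes g g' :: "real \<Rightarrow> 'b::euclidean_space"
  assumes \<tau>: "\<tau> > 0" and s: "s \<ge> 0" and y: "y \<notin> \<int>" "y - \<tau> * s \<notin> \<int>"
    and g: "\<And>t. (g has_vector_derivative g' t) (at t)" and g': "continuous_on UNIV g'"
  shows "((\<lambda>t. bernoulli 1 (y - \<tau> * t) *\<^sub>R g' t) has_integral
           (\<tau> *\<^sub>R integral {0..s} g + bernoulli 1 (y - \<tau> * s) *\<^sub>R g s - bernoulli 1 y *\<^sub>R g 0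
             - (\<Sum>t\<in>lattice_points \<tau> y s. g t))) {0..s}"
proof -
  define N where "N = lattice_points \<tau> y s"
  have N: "finite N" using finite_lattice_points[OF \<tau>] by (simp add: N_def)
  have FTC: "(g' has_integral g b - g a) {a..b}" if "a \<le> b" for a b
    using that by (intro fundamental_theorem_of_calculus has_vector_derivative_at_within[OF g])
  have cont: "continuous_on UNIV g"
    using has_vector_derivative_continuous[OF g] continuous_at_imp_continuous_on by blast
  have 1: "((\<lambda>t. \<Sum>u\<in>N. if t \<in> {u..s} then g' t else 0) has_integral (\<Sum>u\<in>N. g s - g u)) {0..s}"
  proof (intro has_integral_sum N)
    fix u assume "u \<in> N"
    then have "0 \<le> u" "u \<le> s" by (auto simp: N_def lattice_points_def)
    then show "((\<lambda>t. if t \<in> {u..s} then g' t else 0) has_integral g s - g u) {0..s}"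
      by (subst has_integral_restrict) (auto intro: FTC)
  qed
  have 2: "((\<lambda>t. (\<tau> * t) *\<^sub>R g' t) has_integral (\<tau> * s) *\<^sub>R g s - \<tau> *\<^sub>R integral {0..s} g) {0..s}"
  proof -
    have "((\<lambda>t. (\<tau> * t) *\<^sub>R g' t + \<tau> *\<^sub>R g t) has_integral (\<tau> * s) *\<^sub>R g s - (\<tau> * 0) *\<^sub>R g 0) {0..s}"
    proof (rule fundamental_theorem_of_calculus[OF s])
      fix t
      have "((\<lambda>t. \<tau> * t) has_real_derivative \<tau>) (at t)"
        by (auto intro!: derivative_eq_intros)
      from has_vector_derivative_scaleR[OF this g]
      show "((\<lambda>t. (\<tau> * t) *\<^sub>R g t) has_vector_derivative (\<tau> * t) *\<^sub>R g' t + \<tau> *\<^sub>R g t) (at t within {0..s})"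
        by (rule has_vector_derivative_at_within)
    qed
    moreover have "((\<lambda>t. \<tau> *\<^sub>R g t) has_integral \<tau> *\<^sub>R integral {0..s} g) {0..s}"
      by (intro has_integral_cmul integrable_integral integrable_continuous_real
          continuous_on_subset[OF cont]) auto
    ultimately have "((\<lambda>t. ((\<tau> * t) *\<^sub>R g' t + \<tau> *\<^sub>R g t) - \<tau> *\<^sub>R g t) has_integral
        ((\<tau> * s) *\<^sub>R g s - (\<tau> * 0) *\<^sub>R g 0) - \<tau> *\<^sub>R integral {0..s} g) {0..s}"
      by (rule has_integral_diff)
    then show ?thesis by simp
  qed
  have 3: "((\<lambda>t. bernoulli 1 y *\<^sub>R g' t) has_integral bernoulli 1 y *\<^sub>R (g s - g 0)) {0..s}"
    using s by (intro has_integral_cmul FTC)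
  have I: "((\<lambda>t. (\<Sum>u\<in>N. if t \<in> {u..s} then g' t else 0) - (\<tau> * t) *\<^sub>R g' t + bernoulli 1 y *\<^sub>R g' t)
     has_integral (\<Sum>u\<in>N. g s - g u) - ((\<tau> * s) *\<^sub>R g s - \<tau> *\<^sub>R integral {0..s} g)
       + bernoulli 1 y *\<^sub>R (g s - g 0)) {0..s}"
    by (intro has_integral_add has_integral_diff 1 2 3)
  have "((\<lambda>t. bernoulli 1 (y - \<tau> * t) *\<^sub>R g' t)
     has_integral (\<Sum>u\<in>N. g s - g u) - ((\<tau> * s) *\<^sub>R g s - \<tau> *\<^sub>R integral {0..s} g)
       + bernoulli 1 y *\<^sub>R (g s - g 0)) {0..s}"
  proof (rule has_integral_spike_finite[OF N _ I])
    fix t assume t: "t \<in> {0..s} - N"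
    have "y - \<tau> * t \<notin> \<int>"
    proof
      assume "y - \<tau> * t \<in> \<int>"
      then have "\<tau> * t - y \<in> \<int>" using Ints_minus[of "y - \<tau> * t"] by simp
      then show False using t by (auto simp: N_def lattice_points_def)
    qed
    have sub: "lattice_points \<tau> y t = {u\<in>N. t \<in> {u..s}}"
      using t by (auto simp: N_def lattice_points_def)
    have "(\<Sum>u\<in>N. if t \<in> {u..s} then g' t else 0) = (\<Sum>u\<in>{u\<in>N. t \<in> {u..s}}. g' t)"
      using N by (simp add: sum.inter_filter)
    also have "\<dots> = real (card (lattice_points \<tau> y t)) *\<^sub>R g' t"
      by (simp only: sum_constant_scaleR sub)
    also have "\<dots> = (\<tau> * t + bernoulli 1 (y - \<tau> * t) - bernoulli 1 y) *\<^sub>R g' t"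
      using t y(1) \<open>y - \<tau> * t \<notin> \<int>\<close> by (subst card_lattice_points[OF \<tau>]) auto
    finally show "bernoulli 1 (y - \<tau> * t) *\<^sub>R g' t =
        (\<Sum>u\<in>N. if t \<in> {u..s} then g' t else 0) - (\<tau> * t) *\<^sub>R g' t + bernoulli 1 y *\<^sub>R g' t"
      by (simp add: algebra_simps)
  qed
  moreover have "(\<Sum>u\<in>N. g s - g u) = (\<tau> * s + bernoulli 1 (y - \<tau> * s) - bernoulli 1 y) *\<^sub>R g s - (\<Sum>u\<in>N. g u)"
    using card_lattice_points[OF \<tau> s y] by (simp add: sum_subtractf sum_constant_scaleR N_def)
  ultimately have "((\<lambda>t. bernoulli 1 (y - \<tau> * t) *\<^sub>R g' t) has_integral
      (\<tau> * s + bernoulli 1 (y - \<tau> * s) - bernoulli 1 y) *\<^sub>R g s - (\<Sum>u\<in>N. g u)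
       - ((\<tau> * s) *\<^sub>R g s - \<tau> *\<^sub>R integral {0..s} g)
       + bernoulli 1 y *\<^sub>R (g s - g 0)) {0..s}"
    by (simp only:)
  then show ?thesis by (simp add: algebra_simps N_def)
qed

lemma bernoulli_by_parts:
  fixes g g' :: "real \<Rightarrow> 'b::euclidean_space"
  assumes \<tau>: "\<tau> > 0" and s: "s \<ge> 0"
    and g: "\<And>t. (g has_vector_derivative g' t) (at t)" and g': "continuous_on UNIV g'"
  shows "((\<lambda>t. bernoulli (Suc (Suc n)) (y - \<tau> * t) *\<^sub>R g' t - (\<tau> * bernoulli (Suc n) (y - \<tau> * t)) *\<^sub>R g t)
           has_integral (bernoulli (Suc (Suc n)) (y - \<tau> * s) *\<^sub>R g s - bernoulli (Suc (Suc n)) y *\<^sub>R g 0)) {0..s}"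
proof -
  have cont: "continuous_on UNIV g"
    using has_vector_derivative_continuous[OF g] continuous_at_imp_continuous_on by blast
  have "((\<lambda>t. bernoulli (Suc (Suc n)) (y - \<tau> * t) *\<^sub>R g' t - (\<tau> * bernoulli (Suc n) (y - \<tau> * t)) *\<^sub>R g t)
      has_integral bernoulli (Suc (Suc n)) (y - \<tau> * s) *\<^sub>R g s - bernoulli (Suc (Suc n)) (y - \<tau> * 0) *\<^sub>R g 0) {0..s}"
  proof (rule fundamental_theorem_of_calculus_interior_strong[OF finite_lattice_points[OF \<tau>] s])
    show "continuous_on {0..s} (\<lambda>t. bernoulli (Suc (Suc n)) (y - \<tau> * t) *\<^sub>R g t)"
      by (intro continuous_intros continuous_on_compose2[OF bernoulli_continuous]
          continuous_on_subset[OF cont]) auto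
    fix t assume t: "t \<in> {0<..<s} - lattice_points \<tau> y s"
    have "y - \<tau> * t \<notin> \<int>"
    proof
      assume "y - \<tau> * t \<in> \<int>"
      then have "\<tau> * t - y \<in> \<int>" using Ints_minus[of "y - \<tau> * t"] by simp
      then show False using t by (auto simp: lattice_points_def)
    qed
    then have "((\<lambda>t. bernoulli (Suc (Suc n)) (y - \<tau> * t)) has_real_derivative bernoulli (Suc n) (y - \<tau> * t) * (- \<tau>)) (at t)"
      by (intro DERIV_chain2[OF bernoulli_deriv]) (auto intro!: derivative_eq_intros)
    from has_vector_derivative_scaleR[OF this g]
    show "((\<lambda>t. bernoulli (Suc (Suc n)) (y - \<tau> * t) *\<^sub>R g t) has_vector_derivative
        bernoulli (Suc (Suc n)) (y - \<tau> * t) *\<^sub>R g' t - (\<tau> * bernoulli (Suc n) (y - \<tau> * t)) *\<^sub>R g t) (at t)"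
      by (simp add: mult.commute)
  qed
  then show ?thesis by simp
qed

lemma euler_maclaurin_finite:
  fixes g :: "nat \<Rightarrow> real \<Rightarrow> 'b::euclidean_space"
  assumes \<tau>: "\<tau> > 0" and s: "s \<ge> 0" and y: "y \<notin> \<int>" "y - \<tau> * s \<notin> \<int>"
    and g: "\<And>j t. (g j has_vector_derivative g (Suc j) t) (at t)"
  shows "((\<lambda>t. bernoulli (Suc n) (y - \<tau> * t) *\<^sub>R g (Suc n) t) has_integral
           \<tau> ^ n *\<^sub>R (\<tau> *\<^sub>R integral {0..s} (g 0)
             + (\<Sum>j\<le>n. (1 / \<tau> ^ j) *\<^sub>R (bernoulli (Suc j) (y - \<tau> * s) *\<^sub>R g j s - bernoulli (Suc j) y *\<^sub>R g j 0))
             - (\<Sum>t\<in>lattice_points \<tau> y s. g 0 t))) {0..s}"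
proof (induction n)
  have cont: "continuous_on UNIV (g j)" for j
    using has_vector_derivative_continuous[OF g] continuous_at_imp_continuous_on by blast
  case 0
  then show ?case
    using euler_maclaurin_base[OF \<tau> s y g cont] by (simp add: algebra_simps)
next
  case (Suc n)
  have cont: "continuous_on UNIV (g j)" for j
    using has_vector_derivative_continuous[OF g] continuous_at_imp_continuous_on by blast
  from has_integral_add[OF has_integral_cmul[OF Suc, of \<tau>] bernoulli_by_parts[OF \<tau> s g[of "Suc n"] cont, of n y]]
  show ?case
    using \<tau> by (simp add: algebra_simps)
qed

text \<open>
  The remainder after \<open>n\<close> terms is of order \<open>(A / (\<tau> r))\<^sup>n\<close>, because the Bernoulli polynomials
  gain a factor \<open>1 / r\<close> at each step, the derivatives a factor \<open>A\<close> and the dilation a factor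
  \<open>1 / \<tau>\<close>.
\<close>

lemma euler_maclaurin_series:
  fixes g :: "nat \<Rightarrow> real \<Rightarrow> 'b::euclidean_space"
  assumes \<tau>: "\<tau> > 0" and s: "s \<ge> 0" and y: "y \<notin> \<int>" "y - \<tau> * s \<notin> \<int>"
    and g: "\<And>j t. (g j has_vector_derivative g (Suc j) t) (at t)"
    and bound: "\<And>j t. 0 \<le> t \<Longrightarrow> t \<le> s \<Longrightarrow> norm (g j t) \<le> C * A ^ j"
    and A: "0 \<le> A" "A < 2 * pi * \<tau>"
  obtains S0 S1 where
    "((\<lambda>j. (bernoulli (Suc j) y / \<tau> ^ j) *\<^sub>R g j 0) has_sum S0) UNIV"
    "((\<lambda>j. (bernoulli (Suc j) (y - \<tau> * s) / \<tau> ^ j) *\<^sub>R g j s) has_sum S1) UNIV"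
    "(\<Sum>t\<in>lattice_points \<tau> y s. g 0 t) = \<tau> *\<^sub>R integral {0..s} (g 0) + S1 - S0"
proof -
  define R where "R = (\<Sum>t\<in>lattice_points \<tau> y s. g 0 t) - \<tau> *\<^sub>R integral {0..s} (g 0)"
  define f where "f = (\<lambda>j. (1 / \<tau> ^ j) *\<^sub>R (bernoulli (Suc j) (y - \<tau> * s) *\<^sub>R g j s - bernoulli (Suc j) y *\<^sub>R g j 0))"
  obtain r where r: "A / \<tau> < r" "r < 2 * pi"
    using A \<tau> dense[of "A / \<tau>" "2 * pi"] by (auto simp: field_simps)
  then have r0: "r > 0" using A \<tau> by (auto intro: le_less_trans[rotated])
  obtain K where K: "K > 0" "\<And>n x. \<bar>bernoulli n x\<bar> \<le> K / r ^ n"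
    using bernoulli_bound[OF r0 r(2)] by blast
  define \<rho> where "\<rho> = A / (\<tau> * r)"
  have \<rho>: "0 \<le> \<rho>" "\<rho> < 1" using r r0 \<tau> A by (auto simp: \<rho>_def field_simps)
  have C: "0 \<le> C" using order_trans[OF norm_ge_zero bound[of 0 0]] s by simp
  have sum: "((\<lambda>j. (bernoulli (Suc j) x / \<tau> ^ j) *\<^sub>R g j t) has_sum
      (\<Sum>\<^sub>\<infinity>j. (bernoulli (Suc j) x / \<tau> ^ j) *\<^sub>R g j t)) UNIV" if t: "0 \<le> t" "t \<le> s" for x t
  proof -
    have "norm ((bernoulli (Suc j) x / \<tau> ^ j) *\<^sub>R g j t) \<le> (K * C / r) * \<rho> ^ j" for j
    proof -
      have *: "\<bar>bernoulli (Suc j) x\<bar> * norm (g j t) \<le> (K / r ^ Suc j) * (C * A ^ j)"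
        using K(2)[of "Suc j" x] bound[OF t, of j]
        by (intro mult_mono) (auto intro: order_trans[OF abs_ge_zero])
      have "norm ((bernoulli (Suc j) x / \<tau> ^ j) *\<^sub>R g j t) \<le> (K / r ^ Suc j) * (C * A ^ j) / \<tau> ^ j"
        using \<tau> divide_right_mono[OF *, of "\<tau> ^ j"] by simp
      also have "\<dots> = (K * C / r) * \<rho> ^ j"
        by (simp add: \<rho>_def power_divide power_mult_distrib field_simps)
      finally show ?thesis .
    qed
    then have "summable (\<lambda>j. norm ((bernoulli (Suc j) x / \<tau> ^ j) *\<^sub>R g j t))"
      using \<rho> by (intro summable_comparison_test'[where N = 0, OF summable_mult[where c = "K * C / r", OF summable_geometric[of \<rho>]]])
        (simp_all del: norm_scaleR)
    then show ?thesis by (intro has_sum_infsum norm_summable_imp_summable_on)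
  qed
  have rem: "norm (R - (\<Sum>j\<le>n. f j)) \<le> (K * C * A * s / r) * \<rho> ^ n" for n
  proof -
    have I: "((\<lambda>t. bernoulli (Suc n) (y - \<tau> * t) *\<^sub>R g (Suc n) t) has_integral
        \<tau> ^ n *\<^sub>R ((\<Sum>j\<le>n. f j) - R)) (cbox 0 s)"
      using euler_maclaurin_finite[where g = g, OF \<tau> s y g, of n] by (simp add: f_def R_def algebra_simps)
    have "norm (\<tau> ^ n *\<^sub>R ((\<Sum>j\<le>n. f j) - R)) \<le> (K / r ^ Suc n * (C * A ^ Suc n)) * measure lborel (cbox 0 s)"
    proof (rule has_integral_bound[OF _ I])
      show "norm (bernoulli (Suc n) (y - \<tau> * t) *\<^sub>R g (Suc n) t) \<le> K / r ^ Suc n * (C * A ^ Suc n)"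
        if "t \<in> cbox 0 s" for t
        using K(2)[of "Suc n" "y - \<tau> * t"] bound[of t "Suc n"] that unfolding norm_scaleR
        by (intro mult_mono) (auto intro: order_trans[OF abs_ge_zero])
    qed (use K r0 C A in auto)
    then have "\<tau> ^ n * norm (R - (\<Sum>j\<le>n. f j)) \<le> (K / r ^ Suc n * (C * A ^ Suc n)) * s"
      using s \<tau> by (simp add: norm_minus_commute)
    then have "norm (R - (\<Sum>j\<le>n. f j)) \<le> (K / r ^ Suc n * (C * A ^ Suc n)) * s / \<tau> ^ n"
      using \<tau> by (simp only: pos_le_divide_eq zero_less_power mult.commute)
    also have "\<dots> = (K * C * A * s / r) * \<rho> ^ n"
      by (simp add: \<rho>_def power_divide power_mult_distrib field_simps)
    finally show ?thesis .
  qed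
  have pow: "(\<lambda>n. c * \<rho> ^ n) \<longlonglongrightarrow> 0" for c :: real
    using LIMSEQ_power_zero[of \<rho>] \<rho> by (auto intro: tendsto_mult_right_zero)
  have "(\<lambda>n. R - (\<Sum>j\<le>n. f j)) \<longlonglongrightarrow> 0"
    by (rule Lim_null_comparison[OF always_eventually[OF allI[OF rem]] pow])
  then have "(\<lambda>n. R - (R - (\<Sum>j\<le>n. f j))) \<longlonglongrightarrow> R - 0"
    by (intro tendsto_intros)
  then have "f sums R" by (simp add: sums_def_le)
  note s0 = sum[of 0 y] and s1 = sum[of s "y - \<tau> * s"]
  have "(f has_sum (\<Sum>\<^sub>\<infinity>j. (bernoulli (Suc j) (y - \<tau> * s) / \<tau> ^ j) *\<^sub>R g j s)
      - (\<Sum>\<^sub>\<infinity>j. (bernoulli (Suc j) y / \<tau> ^ j) *\<^sub>R g j 0)) UNIV"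
    using has_sum_add[OF s1 has_sum_scaleR[OF s0, of "-1"]] s by (simp add: f_def scaleR_diff_right)
  with \<open>f sums R\<close> have "R = (\<Sum>\<^sub>\<infinity>j. (bernoulli (Suc j) (y - \<tau> * s) / \<tau> ^ j) *\<^sub>R g j s)
      - (\<Sum>\<^sub>\<infinity>j. (bernoulli (Suc j) y / \<tau> ^ j) *\<^sub>R g j 0)"
    using has_sum_imp_sums sums_unique2 by blast
  then show ?thesis
    using s by (intro that[OF s0 s1]) (auto simp: R_def algebra_simps)
qed

section \<open>Derivative bounds on the faces of the simplex\<close>

text \<open>
  The face spanned by the origin and the unit vectors with indices in \<open>H\<close>. For an initial segment
  \<open>H\<close> of length \<open>h\<close> it is the \<open>h\<close>-dimensional standard simplex.
\<close>

definition simplex_face :: "'n set \<Rightarrow> (real ^ 'n) set" where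
  "simplex_face H = {x \<in> std_simplex. \<forall>k. k \<notin> H \<longrightarrow> x $ k = 0}"

text \<open>
  Derivatives are indexed by words in the coordinates instead of multi-indices, because the
  operators of the expansion produce them in mixed order, and because estimates along a word can
  be proved by peeling off the innermost derivative, without commuting any.
\<close>

definition deriv_bound :: "'n set \<Rightarrow> real \<Rightarrow> real \<Rightarrow> (real ^ 'n \<Rightarrow> 'b::real_normed_vector) \<Rightarrow> bool" where
  "deriv_bound H C A G \<longleftrightarrow>
     (\<forall>ws x. set ws \<subseteq> H \<longrightarrow> x \<in> simplex_face H \<longrightarrow> norm (foldr partial ws G x) \<le> C * A ^ length ws)"

abbreviation last_coord_max :: "'n::{finite,linorder} \<Rightarrow> real ^ 'n::_ \<Rightarrow> real" where
  "last_coord_max h x \<equiv> 1 - (\<Sum>l | l < h. x $ l)"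

abbreviation facet_point :: "'n::{finite,linorder} \<Rightarrow> real ^ 'n::_ \<Rightarrow> real ^ 'n::_" where
  "facet_point h x \<equiv> set_coord x h (last_coord_max h x)"

lemma last_coord_max_nonneg:
  fixes h :: "'n::{finite,linorder}"
  assumes "x \<in> simplex_face {..<h}"
  shows "0 \<le> last_coord_max h x" "last_coord_max h x \<le> 1"
proof -
  have nn: "\<And>j. 0 \<le> x $ j" and le: "(\<Sum>j\<in>UNIV. x $ j) \<le> 1"
    using assms by (auto simp: simplex_face_def std_simplex_def)
  have "(\<Sum>l | l < h. x $ l) \<le> (\<Sum>j\<in>UNIV. x $ j)"
    using nn by (intro sum_mono2) auto
  then show "0 \<le> last_coord_max h x" using le by simp
  show "last_coord_max h x \<le> 1" using nn by (simp add: sum_nonneg)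
qed

lemma set_coord_in_face_iff:
  fixes h :: "'n::{finite,linorder}"
  assumes "\<forall>k. k \<notin> {..<h} \<longrightarrow> x $ k = 0"
  shows "set_coord x h t \<in> simplex_face {..h} \<longleftrightarrow>
           x \<in> simplex_face {..<h} \<and> 0 \<le> t \<and> t \<le> last_coord_max h x"
proof -
  have 1: "(\<Sum>j\<in>UNIV. x $ j) = (\<Sum>l | l < h. x $ l)"
    using assms by (intro sum.mono_neutral_right) auto
  have "(\<Sum>j\<in>UNIV. set_coord x h t $ j) = (\<Sum>j\<in>insert h {l. l < h}. set_coord x h t $ j)"
    using assms by (intro sum.mono_neutral_right) auto
  also have "\<dots> = t + (\<Sum>l | l < h. x $ l)"
    by (subst sum.insert) (auto intro!: sum.cong)
  finally have 2: "(\<Sum>j\<in>UNIV. set_coord x h t $ j) = t + (\<Sum>l | l < h. x $ l)" .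
  have 3: "(\<forall>j. 0 \<le> set_coord x h t $ j) \<longleftrightarrow> 0 \<le> t \<and> (\<forall>j. 0 \<le> x $ j)"
    using assms by (auto split: if_splits)
  show ?thesis
    using assms unfolding simplex_face_def std_simplex_def mem_Collect_eq 1 2 3
    by (auto simp: le_less)
qed

lemma deriv_bound_mono: "deriv_bound H C A G \<Longrightarrow> C \<le> C' \<Longrightarrow> 0 \<le> A \<Longrightarrow> deriv_bound H C' A G"
  unfolding deriv_bound_def by (meson mult_right_mono order_trans zero_le_power)

lemma deriv_bound_mono2: "deriv_bound H C A G \<Longrightarrow> 0 \<le> C \<Longrightarrow> 0 \<le> A \<Longrightarrow> A \<le> A' \<Longrightarrow> deriv_bound H C A' G"
  unfolding deriv_bound_def by (meson mult_left_mono power_mono order_trans)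

lemma deriv_bound_partial:
  assumes "deriv_bound H C A G" "i \<in> H"
  shows "deriv_bound H (C * A) A (partial i G)"
  unfolding deriv_bound_def
proof (intro allI impI)
  fix ws x assume "set ws \<subseteq> H" "x \<in> simplex_face H"
  then have "norm (foldr partial (ws @ [i]) G x) \<le> C * A ^ length (ws @ [i])"
    using assms unfolding deriv_bound_def by (metis Un_subset_iff empty_subsetI insert_subset list.simps(15) set_append list.set(1))
  then show "norm (foldr partial ws (partial i G) x) \<le> C * A * A ^ length ws" by (simp add: algebra_simps)
qed

lemma deriv_bound_partial_power:
  assumes "deriv_bound H C A G" "i \<in> H"
  shows "deriv_bound H (C * A ^ j) A ((partial i ^^ j) G)"
  using assms by (induction j) (auto dest: deriv_bound_partial simp: algebra_simps)

lemma C_infinity_foldr_partial: "C_infinity G \<Longrightarrow> C_infinity (foldr partial ws G)"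
  by (induction ws) (auto intro: C_infinity_partial)

lemma foldr_partial_diff:
  "C_infinity F \<Longrightarrow> C_infinity G \<Longrightarrow>
    foldr partial ws (\<lambda>x. F x - G x) = (\<lambda>x. foldr partial ws F x - foldr partial ws G x)"
proof (induction ws)
  case (Cons i ws)
  have C: "C_infinity (foldr partial ws F)" "C_infinity (foldr partial ws G)"
    using Cons.prems by (auto intro: C_infinity_foldr_partial)
  have "partial i (\<lambda>x. foldr partial ws F x - foldr partial ws G x) =
      (\<lambda>x. partial i (foldr partial ws F) x - partial i (foldr partial ws G) x)"
    using C unfolding C_infinity_def
    by (intro ext partial_eqI has_vector_derivative_diff C_k_partial_derivative0[where k = 0]) blast+
  then show ?case using Cons by simp
qed simp

lemma deriv_bound_diff:
  assumes "C_infinity F" "C_infinity G" "deriv_bound H C A F" "deriv_bound H C' A G"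
  shows "deriv_bound H (C + C') A (\<lambda>x. F x - G x)"
  unfolding deriv_bound_def foldr_partial_diff[OF assms(1,2)]
proof (intro allI impI)
  fix ws x assume "set ws \<subseteq> H" "x \<in> simplex_face H"
  then have "norm (foldr partial ws F x) \<le> C * A ^ length ws" "norm (foldr partial ws G x) \<le> C' * A ^ length ws"
    using assms(3,4) by (auto simp: deriv_bound_def)
  then show "norm (foldr partial ws F x - foldr partial ws G x) \<le> (C + C') * A ^ length ws"
    using norm_triangle_ineq4[of "foldr partial ws F x" "foldr partial ws G x"]
    by (simp add: distrib_right)
qed

subsection \<open>Restriction to the two facets over a face\<close>

lemma linear_set_coord_0: "linear (\<lambda>x. set_coord x h (0::real))"
  by (rule linearI) (auto simp: vec_eq_iff)

lemma linear_top: "linear (\<lambda>x. set_coord x h (- (\<Sum>l | l < h. x $ l)))"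
  by (rule linearI) (auto simp: vec_eq_iff sum.distrib sum_distrib_left)

lemma top_affine:
  "facet_point h x = axis h 1 + set_coord x h (- (\<Sum>l | l < h. x $ l))"
  by (simp add: vec_eq_iff axis_def)

lemma C_infinity_bottom: "C_infinity F \<Longrightarrow> C_infinity (\<lambda>x. F (set_coord x h 0))"
  using C_infinity_affine[OF _ linear_set_coord_0, of F 0 h] by simp

lemma C_infinity_top: "C_infinity F \<Longrightarrow> C_infinity (\<lambda>x. F (facet_point h x))"
  unfolding top_affine by (rule C_infinity_affine[OF _ linear_top])

lemma partial_top:
  fixes F :: "real ^ 'n::{finite,linorder} \<Rightarrow> 'b::real_normed_vector"
  assumes F: "C_infinity F" and i: "i < h"
  shows "partial i (\<lambda>x. F (facet_point h x)) =
    (\<lambda>x. partial i F (facet_point h x) - partial h F (facet_point h x))"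
proof (intro ext partial_eqI)
  fix x
  define z where "z = facet_point h x"
  define L where "L = (\<lambda>x. set_coord x h (- (\<Sum>l | l < h. x $ l)))"
  have z: "z = axis h 1 + L x" by (simp add: z_def L_def top_affine)
  have "(\<Sum>l | l < h. (axis i 1 :: real ^ 'n::_) $ l) = (\<Sum>l | l < h. if l = i then 1 else 0)"
    by (intro sum.cong) (auto simp: axis_def)
  then have L1: "L (axis i 1) = axis i 1 - axis h 1"
    using i by (simp add: L_def vec_eq_iff axis_def)
  have "(\<Sum>j\<in>UNIV. (L (axis i 1) $ j) *\<^sub>R partial j F z) =
      (\<Sum>j\<in>UNIV. (axis i 1 $ j) *\<^sub>R partial j F z) - (\<Sum>j\<in>UNIV. (axis h 1 $ j) *\<^sub>R partial j F z)"
    unfolding L1 by (simp add: sum_subtractf scaleR_diff_left)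
  moreover have "(\<Sum>j\<in>UNIV. (axis k 1 $ j) *\<^sub>R partial j F z) = partial k F z" for k
  proof -
    have "(\<Sum>j\<in>UNIV. (axis k 1 $ j) *\<^sub>R partial j F z) = (\<Sum>j\<in>UNIV. if j = k then partial j F z else 0)"
      by (intro sum.cong) (auto simp: axis_def)
    then show ?thesis by simp
  qed
  ultimately have "(\<Sum>j\<in>UNIV. (L (axis i 1) $ j) *\<^sub>R partial j F z) = partial i F z - partial h F z"
    by (simp only:)
  moreover have "C_k (Suc 0) F" using F unfolding C_infinity_def by blast
  moreover have "linear L" unfolding L_def by (rule linear_top)
  ultimately have "((\<lambda>t. F (axis h 1 + L (set_coord x i t))) has_vector_derivative
      partial i F z - partial h F z) (at (x $ i))"
    using C_k_affine_derivative[of 0 F L "axis h 1" x i] by (simp only: z)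
  moreover have "axis h 1 + L y = set_coord y h (last_coord_max h y)" for y
    unfolding L_def by (rule top_affine[symmetric])
  ultimately show "((\<lambda>t. F (set_coord (set_coord x i t) h (last_coord_max h (set_coord x i t)))) has_vector_derivative
      partial i F (facet_point h x) - partial h F (facet_point h x)) (at (x $ i))"
    by (simp only: z_def)
qed

lemma partial_bottom:
  assumes "i \<noteq> h"
  shows "partial i (\<lambda>x. F (set_coord x h 0)) = (\<lambda>x. partial i F (set_coord x h 0))"
  using assms by (simp add: partial_def set_coord_commute[of i h] fun_eq_iff)

lemma deriv_bound_bottom:
  fixes h :: "'n::{finite,linorder}"
  assumes "deriv_bound {..h} C A F"
  shows "deriv_bound {..<h} C A (\<lambda>x. F (set_coord x h 0))"
  unfolding deriv_bound_def
proof (intro allI impI)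
  fix ws and x :: "real ^ 'n::_"
  assume ws: "set ws \<subseteq> {..<h}" and x: "x \<in> simplex_face {..<h}"
  have "foldr partial ws (\<lambda>x. F (set_coord x h 0)) = (\<lambda>x. foldr partial ws F (set_coord x h 0))"
    using ws by (induction ws) (auto simp: partial_bottom)
  moreover have "set_coord x h 0 \<in> simplex_face {..h}"
    using x last_coord_max_nonneg[OF x] by (subst set_coord_in_face_iff) (auto simp: simplex_face_def)
  moreover have "set ws \<subseteq> {..h}" using ws by auto
  ultimately show "norm (foldr partial ws (\<lambda>x. F (set_coord x h 0)) x) \<le> C * A ^ length ws"
    using assms by (simp add: deriv_bound_def)
qed

text \<open>
  Along the slanted facet the chain rule turns \<open>\<partial>\<^sub>i\<close> into \<open>\<partial>\<^sub>i - \<partial>\<^sub>h\<close>, which costs a factor 2 per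
  derivative.
\<close>

lemma deriv_bound_top:
  fixes h :: "'n::{finite,linorder}"
  assumes F: "C_infinity F" "deriv_bound {..h} C A F"
  shows "deriv_bound {..<h} C (2 * A) (\<lambda>x. F (facet_point h x))"
  unfolding deriv_bound_def
proof (intro allI impI)
  fix ws and x :: "real ^ 'n::_"
  assume ws: "set ws \<subseteq> {..<h}" and x: "x \<in> simplex_face {..<h}"
  show "norm (foldr partial ws (\<lambda>x. F (facet_point h x)) x) \<le> C * (2 * A) ^ length ws"
    using ws F
  proof (induction ws arbitrary: F C rule: rev_induct)
    case Nil
    have "facet_point h x \<in> simplex_face {..h}"
      using x last_coord_max_nonneg[OF x] by (subst set_coord_in_face_iff) (auto simp: simplex_face_def)
    then have "norm (foldr partial [] F (facet_point h x)) \<le> C * A ^ length ([] :: 'n list)"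
      using Nil unfolding deriv_bound_def by (metis empty_subsetI list.set(1))
    then show ?case by simp
  next
    case (snoc i ws)
    then have i: "i < h" by auto
    define F' where "F' = (\<lambda>x. partial i F x - partial h F x)"
    have "deriv_bound {..h} (C * A + C * A) A F'"
      unfolding F'_def using snoc.prems i
      by (intro deriv_bound_diff deriv_bound_partial C_infinity_partial) auto
    moreover have "C_infinity F'"
      unfolding F'_def using snoc.prems by (intro C_infinity_diff C_infinity_partial)
    ultimately have "norm (foldr partial ws (\<lambda>x. F' (facet_point h x)) x) \<le> (C * A + C * A) * (2 * A) ^ length ws"
      using snoc.prems by (intro snoc.IH) auto
    then show ?case
      by (simp add: partial_top[OF snoc.prems(2) i] F'_def algebra_simps)
  qed
qed

text \<open>
  Differentiating the integral over the segment yields the integral of the derivative minus the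
  integrand at the end of the segment. After \<open>n\<close> derivatives these boundary terms form a geometric
  sum of ratio 2, which is why they only cost the constant factor \<open>1 + 1 / A\<close> in addition to the
  doubled growth rate.
\<close>

lemma deriv_bound_antideriv_top:
  fixes h :: "'n::{finite,linorder}" and G :: "real ^ 'n::_ \<Rightarrow> 'b::euclidean_space"
  assumes G: "C_infinity G" "deriv_bound {..h} C A G" "0 \<le> C" and A: "0 < A"
  shows "deriv_bound {..<h} (C * (1 + 1 / A)) (2 * A)
           (\<lambda>x. coord_antideriv h G (facet_point h x))"
  unfolding deriv_bound_def
proof (intro allI impI)
  fix ws and x :: "real ^ 'n::_"
  assume ws: "set ws \<subseteq> {..<h}" and x: "x \<in> simplex_face {..<h}"
  show "norm (foldr partial ws (\<lambda>x. coord_antideriv h G (facet_point h x)) x)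
      \<le> C * (1 + 1 / A) * (2 * A) ^ length ws"
    using ws G
  proof (induction ws arbitrary: G C rule: rev_induct)
    case Nil
    define s where "s = last_coord_max h x"
    have s: "0 \<le> s" "s \<le> 1" using last_coord_max_nonneg[OF x] by (auto simp: s_def)
    have *: "norm (G (set_coord x h (s * u))) \<le> C" if "u \<in> cbox 0 1" for u
    proof -
      have "s * u \<le> s" "0 \<le> s * u" using s that by (auto simp: mult_left_le)
      then have "set_coord x h (s * u) \<in> simplex_face {..h}"
        using x by (subst set_coord_in_face_iff) (auto simp: simplex_face_def s_def)
      then have "norm (foldr partial [] G (set_coord x h (s * u))) \<le> C * A ^ length ([] :: 'n list)"
        using Nil unfolding deriv_bound_def by (metis empty_subsetI list.set(1))
      then show ?thesis by simp
    qed
    have "norm (integral (cbox 0 1) (\<lambda>u. G (set_coord x h (s * u)))) \<le> C * measure lborel (cbox 0 (1::real))"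
    proof (rule integrable_bound[OF Nil(4) _ *])
      show "(\<lambda>u. G (set_coord x h (s * u))) integrable_on cbox 0 1"
        by (intro integrable_continuous continuous_on_compose2[OF C_infinity_continuous[OF Nil(2)]] continuous_intros) auto
    qed
    then have I: "norm (integral {0..1} (\<lambda>u. G (set_coord x h (s * u)))) \<le> C" by simp
    have "norm (coord_antideriv h G (set_coord x h s)) \<le> 1 * C"
      unfolding coord_antideriv_def norm_scaleR using s I by (intro mult_mono) auto
    also have "\<dots> \<le> C * (1 + 1 / A)" using Nil(4) A by (simp add: algebra_simps)
    finally show ?case by (simp add: s_def)
  next
    case (snoc i ws)
    then have i: "i < h" by auto
    have C: "C_infinity (\<lambda>x. coord_antideriv h (partial i G) (facet_point h x))" "C_infinity (\<lambda>x. G (facet_point h x))"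
      using snoc.prems by (auto intro: C_infinity_top C_infinity_coord_antideriv C_infinity_partial)
    have p: "partial i (coord_antideriv h G) = coord_antideriv h (partial i G)"
      using partial_coord_antideriv(2)[of 0 G i h] snoc.prems(2) i
      unfolding C_infinity_def by blast
    have "foldr partial (ws @ [i]) (\<lambda>x. coord_antideriv h G (facet_point h x)) =
      foldr partial ws (\<lambda>x. coord_antideriv h (partial i G) (facet_point h x) - G (facet_point h x))"
      using partial_top[OF C_infinity_coord_antideriv[OF snoc.prems(2)] i] p
        partial_coord_antideriv(1)[OF C_infinity_continuous[OF snoc.prems(2)]] by simp
    then have eq: "foldr partial (ws @ [i]) (\<lambda>x. coord_antideriv h G (facet_point h x)) x =
      foldr partial ws (\<lambda>x. coord_antideriv h (partial i G) (facet_point h x)) x - foldr partial ws (\<lambda>x. G (facet_point h x)) x"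
      by (simp add: foldr_partial_diff[OF C])
    have 1: "norm (foldr partial ws (\<lambda>x. coord_antideriv h (partial i G) (facet_point h x)) x) \<le> (C * A) * (1 + 1 / A) * (2 * A) ^ length ws"
      using snoc.prems A i by (intro snoc.IH C_infinity_partial deriv_bound_partial) auto
    have 2: "norm (foldr partial ws (\<lambda>x. G (facet_point h x)) x) \<le> C * (2 * A) ^ length ws"
      using deriv_bound_top[OF snoc.prems(2,3)] snoc.prems(1) x unfolding deriv_bound_def by auto
    have "norm (foldr partial (ws @ [i]) (\<lambda>x. coord_antideriv h G (facet_point h x)) x) \<le>
      (C * A) * (1 + 1 / A) * (2 * A) ^ length ws + C * (2 * A) ^ length ws"
      unfolding eq using norm_triangle_ineq4 1 2 by (meson add_mono order_trans)
    also have "\<dots> = C * (A + 2) * (2 * A) ^ length ws"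
      using A by (simp add: field_simps)
    also have "\<dots> \<le> C * (2 * A + 2) * (2 * A) ^ length ws"
      using A snoc.prems(4) by (intro mult_right_mono mult_left_mono) auto
    also have "\<dots> = C * (1 + 1 / A) * (2 * A) ^ length (ws @ [i])"
      using A by (simp add: field_simps)
    finally show ?case .
  qed
qed

subsection \<open>The operators \<open>T_op\<close>\<close>

lemma T_op_simps:
  fixes g :: "real ^ 'n::{finite,linorder} \<Rightarrow> 'b::euclidean_space"
  shows "continuous_on UNIV g \<Longrightarrow>
      T_op h 1 0 j g = (\<lambda>x. coord_antideriv h g (facet_point h x))"
    "T_op h 2 0 j g = (\<lambda>x. 0)"
    "T_op h 1 1 j g = (\<lambda>x. (-1) *\<^sub>R (partial h ^^ j) g (set_coord x h 0))"
    "T_op h 2 1 j g = (\<lambda>x. (partial h ^^ j) g (facet_point h x))"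
  by (simp_all add: T_op_def Let_def fun_eq_iff coord_antideriv_eq)

text \<open>
  A letter \<open>(v, e, j)\<close> records what happens to one coordinate: whether it is integrated (\<open>e = 0\<close>) or
  evaluated at an end of its range (\<open>e = 1\<close>), which end (\<open>v\<close>), and after how many derivatives (\<open>j\<close>).
  With \<open>e = 0\<close> only \<open>v = 1\<close> stands for an integral; the operator of \<open>(2, 0, 0)\<close> is 0.
  A triple \<open>(V, I, J)\<close> with \<open>J \<sqsubseteq> I\<close> is then a word with one letter for each coordinate.
\<close>

type_synonym letter = "nat \<times> nat \<times> nat"

definition letters :: "letter set" where
  "letters = {(v, e, j). v \<in> {1, 2} \<and> e \<in> {0, 1} \<and> (e = 0 \<longrightarrow> j = 0)}"

lemma letters_cases:
  assumes "(v, e, j) \<in> letters"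
  obtains "v = 1" "e = 0" "j = 0" | "v = 2" "e = 0" "j = 0" | "v = 1" "e = 1" | "v = 2" "e = 1"
  using assms by (auto simp: letters_def)

lemma T_op_smooth_bound:
  fixes g :: "real ^ 'n::{finite,linorder} \<Rightarrow> 'b::euclidean_space"
  assumes l: "(v, e, j) \<in> letters" and g: "C_infinity g" "deriv_bound {..h} C A g" and A: "0 < A" and C: "0 \<le> C"
  shows "C_infinity (T_op h v e j g)"
    and "deriv_bound {..<h} (C * (1 + 1 / A) * A ^ j) (2 * A) (T_op h v e j g)"
proof -
  have zero: "C_infinity (\<lambda>x::real^'n::_. 0::'b)" by (simp add: C_infinity_def C_k_zero)
  have foldr0: "foldr partial ws (\<lambda>x. 0) = (\<lambda>x::real^'n::_. 0::'b)" for ws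
    by (induction ws) (auto intro!: partial_eqI)
  have foldrm: "foldr partial ws (\<lambda>x. (-1) *\<^sub>R F x) = (\<lambda>x. (-1) *\<^sub>R foldr partial ws F x)"
    if "C_infinity F" for F :: "real^'n::_ \<Rightarrow> 'b" and ws
    using foldr_partial_diff[OF zero that, of ws] by (simp add: foldr0)
  have gj: "C_infinity ((partial h ^^ j) g)" by (intro C_infinity_partial_power g)
  have bj: "deriv_bound {..h} (C * A ^ j) A ((partial h ^^ j) g)"
    by (intro deriv_bound_partial_power g) simp
  have CA: "0 \<le> C * A ^ j" using A C by simp
  have le: "C * A ^ j \<le> C * (1 + 1 / A) * A ^ j"
    using A C by (intro mult_right_mono) (auto simp: field_simps)
  from l show "C_infinity (T_op h v e j g)"
    by (cases rule: letters_cases)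
       (auto simp: T_op_simps C_infinity_continuous g zero
         intro!: C_infinity_top C_infinity_coord_antideriv C_infinity_scaleR C_infinity_bottom gj g
         simp del: One_nat_def scaleR_minus_left scaleR_minus1_left)
  from l show "deriv_bound {..<h} (C * (1 + 1 / A) * A ^ j) (2 * A) (T_op h v e j g)"
  proof (cases rule: letters_cases)
    case 1
    then show ?thesis
      using deriv_bound_antideriv_top[OF g C A] by (simp add: T_op_simps(1) C_infinity_continuous g del: One_nat_def)
  next
    case 2
    then show ?thesis
      using A C by (simp add: T_op_simps(2) deriv_bound_def foldr0)
  next
    case 3
    have "deriv_bound {..<h} (C * (1 + 1 / A) * A ^ j) (2 * A) (\<lambda>x. (partial h ^^ j) g (set_coord x h 0))"
      using deriv_bound_mono[OF deriv_bound_mono2[OF deriv_bound_bottom[OF bj] CA, of "2 * A"] le] A by simp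
    then show ?thesis
      unfolding 3 T_op_simps(3) deriv_bound_def foldrm[OF C_infinity_bottom[OF gj]] by simp
  next
    case 4
    then show ?thesis
      unfolding 4 T_op_simps(4) using deriv_bound_mono[OF deriv_bound_top[OF gj bj] le] A by simp
  qed
qed

section \<open>The expansion for the standard simplex\<close>

text \<open>
  The coordinates of the point \<open>y - \<tau> \<lambda>\<^sub>V\<close> with respect to the basis of index \<open>V\<close>. That they have
  this simple form, and that the \<open>k\<close>-th one depends on the entry \<open>v\<close> of \<open>V\<close> at \<open>k\<close> only, is what
  makes the expansion a sum over words.
\<close>

definition zeta :: "real \<Rightarrow> nat \<Rightarrow> real ^ 'n::{finite,linorder} \<Rightarrow> 'n \<Rightarrow> real" where
  "zeta \<tau> v y k = (if v = 1 then y $ k else (\<Sum>l | l \<le> k. y $ l) - \<tau>)"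

text \<open>
  For such shifts no point of \<open>y + \<int>\<^sup>d\<close> lies on the boundary of the dilated simplex, and \<open>y\<close> lies on
  no hyperplane on which a Bernoulli factor of the expansion jumps.
\<close>

definition generic :: "real \<Rightarrow> real ^ 'n::{finite,linorder} \<Rightarrow> bool" where
  "generic \<tau> y \<longleftrightarrow> (\<forall>v k. zeta \<tau> v y k \<notin> \<int>)"

text \<open>
  The points of the face whose dilation by \<open>\<tau>\<close> agrees with a point of the shifted lattice \<open>y + \<int>\<^sup>d\<close>
  in the coordinates of \<open>H\<close>.
\<close>

definition face_points :: "real \<Rightarrow> real ^ 'n \<Rightarrow> 'n set \<Rightarrow> (real ^ 'n) set" where
  "face_points \<tau> y H = {x \<in> simplex_face H. \<forall>k\<in>H. \<tau> * x $ k - y $ k \<in> \<int>}"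

definition letter_weight :: "real \<Rightarrow> real ^ 'n::{finite,linorder} \<Rightarrow> 'n \<Rightarrow> letter \<Rightarrow> real" where
  "letter_weight \<tau> y k = (\<lambda>(v, e, j). \<tau> powi (1 - int e - int j) * bernoulli (j + e) (zeta \<tau> v y k))"

definition letter_op ::
    "'n::{finite,linorder} \<Rightarrow> letter \<Rightarrow>
     (real ^ 'n::_ \<Rightarrow> 'b::euclidean_space) \<Rightarrow> real ^ 'n::_ \<Rightarrow> 'b" where
  "letter_op h = (\<lambda>(v, e, j). T_op h v e j)"

abbreviation word_op ::
    "('n::{finite,linorder} \<Rightarrow> letter) \<Rightarrow> 'n list \<Rightarrow>
     (real ^ 'n::_ \<Rightarrow> 'b::euclidean_space) \<Rightarrow> real ^ 'n::_ \<Rightarrow> 'b" where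
  "word_op a ps G \<equiv> foldr (\<lambda>k. letter_op k (a k)) ps G"

abbreviation word_weight ::
    "real \<Rightarrow> real ^ 'n::{finite,linorder} \<Rightarrow> 'n set \<Rightarrow> ('n \<Rightarrow> letter) \<Rightarrow> real" where
  "word_weight \<tau> y H a \<equiv> \<Prod>k\<in>H. letter_weight \<tau> y k (a k)"

abbreviation word_bound :: "real \<Rightarrow> real \<Rightarrow> 'n set \<Rightarrow> ('n \<Rightarrow> letter) \<Rightarrow> real" where
  "word_bound c b H a \<equiv> \<Prod>k\<in>H. c * b ^ snd (snd (a k))"

lemma letters_eq:
  "letters = {(1, 0, 0), (2, 0, 0)} \<union> ((\<lambda>j. (1, 1, j)) ` UNIV \<union> (\<lambda>j. (2, 1, j)) ` UNIV)"
  by (auto simp: letters_def)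

lemma has_sum_letters:
  fixes f :: "letter \<Rightarrow> 'b::{real_normed_vector}"
  assumes "((\<lambda>j. f (1, 1, j)) has_sum S1) UNIV" "((\<lambda>j. f (2, 1, j)) has_sum S2) UNIV"
  shows "(f has_sum (f (1, 0, 0) + f (2, 0, 0) + (S1 + S2))) letters"
proof -
  have "(f has_sum S1) ((\<lambda>j. (1, 1, j)) ` UNIV)"
    using assms(1) by (subst has_sum_reindex) (auto simp: o_def inj_on_def)
  moreover have "(f has_sum S2) ((\<lambda>j. (2, 1, j)) ` UNIV)"
    using assms(2) by (subst has_sum_reindex) (auto simp: o_def inj_on_def)
  moreover have "(f has_sum (f (1, 0, 0) + f (2, 0, 0))) {(1, 0, 0), (2, 0, 0)}"
    by (rule has_sum_finiteI) auto
  ultimately show ?thesis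
    unfolding letters_eq by (intro has_sum_Un_disjoint) auto
qed

lemma has_sum_finite_sum:
  fixes f :: "'a \<Rightarrow> 'b \<Rightarrow> 'c::topological_comm_monoid_add"
  assumes "\<And>x. x \<in> X \<Longrightarrow> (f x has_sum S x) A"
  shows "((\<lambda>l. \<Sum>x\<in>X. f x l) has_sum (\<Sum>x\<in>X. S x)) A"
  using assms
  by (induction X rule: infinite_finite_induct) (auto intro: has_sum_0 has_sum_add)

lemma sorted_prefix:
  assumes "sorted_list_of_set (UNIV :: 'n::{finite,linorder} set) = ps @ h # qs"
  shows "set ps = {..<h}" "set (ps @ [h]) = {..h}" "h \<notin> set ps"
proof -
  have "sorted_wrt (<) (ps @ h # qs)"
    using strict_sorted_list_of_set[of "UNIV :: 'n set"] assms by simp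
  then have less: "\<And>x. x \<in> set ps \<Longrightarrow> x < h" "\<And>x. x \<in> set qs \<Longrightarrow> h < x"
    by (auto simp: sorted_wrt_append)
  have "x \<in> set ps \<or> x = h \<or> x \<in> set qs" for x
    using arg_cong[OF assms, of set] by (auto simp: set_eq_iff)
  then have "x \<in> set ps \<longleftrightarrow> x < h" for x
    using less(1)[of x] less(2)[of x] order.strict_iff_not[of x h] order.strict_iff_not[of h x] by metis
  then show 1: "set ps = {..<h}" by auto
  have "{..h} = insert h {..<h}" by (simp add: set_eq_iff le_less disj_commute)
  then show "set (ps @ [h]) = {..h}" "h \<notin> set ps" unfolding set_append 1 by simp_all
qed

text \<open>
  One step of the recursion: the Euler-Maclaurin series along the coordinate \<open>h\<close>. The far endpoint
  of the segment depends on the lattice point \<open>x\<close> below it, but modulo 1 its position does not,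
  so that the Bernoulli factors are common to all segments.
\<close>

lemma euler_maclaurin_coordinate:
  fixes G :: "real ^ 'n::{finite,linorder} \<Rightarrow> 'b::euclidean_space"
  assumes \<tau>: "\<tau> > 0" and G: "C_infinity G" "deriv_bound {..h} C A G"
    and A: "0 < A" "A < 2 * pi * \<tau>" and y: "generic \<tau> y" and x: "x \<in> face_points \<tau> y {..<h}"
  shows "((\<lambda>l. letter_weight \<tau> y h l *\<^sub>R letter_op h l G x) has_sum
           (\<Sum>t\<in>lattice_points \<tau> (y $ h) (last_coord_max h x). G (set_coord x h t))) letters"
proof -
  define s where "s = last_coord_max h x"
  define \<phi> where "\<phi> = (\<lambda>j t. (partial h ^^ j) G (set_coord x h t))"
  have x': "x \<in> simplex_face {..<h}" "\<And>k. k < h \<Longrightarrow> \<tau> * x $ k - y $ k \<in> \<int>"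
    using x by (auto simp: face_points_def)
  have s: "0 \<le> s" using last_coord_max_nonneg[OF x'(1)] by (simp add: s_def)
  have set: "{l. l \<le> h} = insert h {l. l < h}" by auto
  have "(y $ h - \<tau> * s) - zeta \<tau> 2 y h = (\<Sum>l | l < h. \<tau> * x $ l - y $ l)"
    by (simp add: s_def zeta_def set sum_subtractf sum_distrib_left algebra_simps)
  also have "\<dots> \<in> \<int>" using x'(2) by (intro Ints_sum) auto
  finally have int: "(y $ h - \<tau> * s) - zeta \<tau> 2 y h \<in> \<int>" .
  have B: "bernoulli n (y $ h - \<tau> * s) = bernoulli n (zeta \<tau> 2 y h)" for n
    using bernoulli_add_Ints[OF int, of n "zeta \<tau> 2 y h"] by simp
  have ni: "y $ h \<notin> \<int>" "y $ h - \<tau> * s \<notin> \<int>"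
    using y Ints_diff[OF _ int] unfolding generic_def
    by (metis zeta_def, metis diff_diff_eq2 add_diff_cancel_left' diff_add_cancel)
  have der: "(\<phi> j has_vector_derivative \<phi> (Suc j) t) (at t)" for j t
    unfolding \<phi>_def using C_infinity_partial_power[OF G(1), where i = h and n = j]
    by (auto simp: C_infinity_def intro: C_k_partial_derivative[where k = 0])
  have bound: "norm (\<phi> j t) \<le> C * A ^ j" if "0 \<le> t" "t \<le> s" for j t
  proof -
    have "set_coord x h t \<in> simplex_face {..h}"
      using x'(1) that by (subst set_coord_in_face_iff) (auto simp: simplex_face_def s_def)
    moreover have "(partial h ^^ j) G = foldr partial (replicate j h) G"
      by (induction j) auto
    moreover have "set (replicate j h) \<subseteq> {..h}" by auto
    ultimately show ?thesis
      using G(2) unfolding deriv_bound_def \<phi>_def by (metis length_replicate)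
  qed
  obtain S0 S1 where
    S0: "((\<lambda>j. (bernoulli (Suc j) (y $ h) / \<tau> ^ j) *\<^sub>R \<phi> j 0) has_sum S0) UNIV" and
    S1: "((\<lambda>j. (bernoulli (Suc j) (y $ h - \<tau> * s) / \<tau> ^ j) *\<^sub>R \<phi> j s) has_sum S1) UNIV" and
    eq: "(\<Sum>t\<in>lattice_points \<tau> (y $ h) s. \<phi> 0 t) = \<tau> *\<^sub>R integral {0..s} (\<phi> 0) + S1 - S0"
    using euler_maclaurin_series[where g = \<phi>, OF \<tau> s ni der bound _ A(2)] A(1) by auto
  define f where "f = (\<lambda>l. letter_weight \<tau> y h l *\<^sub>R letter_op h l G x)"
  have pw: "\<tau> powi (1 - int 1 - int j) = 1 / \<tau> ^ j" for j
    by (simp add: power_int_minus field_simps)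
  have f1: "f (1, 1, j) = (-1) *\<^sub>R ((bernoulli (Suc j) (y $ h) / \<tau> ^ j) *\<^sub>R \<phi> j 0)" for j
    unfolding f_def letter_weight_def letter_op_def prod.case pw T_op_simps
    by (simp add: zeta_def \<phi>_def)
  have f2: "f (2, 1, j) = (bernoulli (Suc j) (y $ h - \<tau> * s) / \<tau> ^ j) *\<^sub>R \<phi> j s" for j
    unfolding f_def letter_weight_def letter_op_def prod.case pw T_op_simps B
    by (simp add: \<phi>_def s_def)
  have "continuous_on UNIV (\<lambda>t. G (set_coord x h t))"
    by (intro continuous_on_compose2[OF C_infinity_continuous[OF G(1)]] continuous_intros) auto
  then have "set_integrable lborel {0..s} (\<lambda>t. G (set_coord x h t))"
    by (intro borel_integrable_atLeastAtMost') (auto intro: continuous_on_subset)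
  from interval_integral_eq_integral[OF s this]
  have "T_op h 1 0 0 G x = integral {0..s} (\<phi> 0)"
    unfolding T_op_def Let_def by (simp add: s_def[symmetric] \<phi>_def zero_ereal_def)
  then have f3: "f (1, 0, 0) = \<tau> *\<^sub>R integral {0..s} (\<phi> 0)"
    by (simp add: f_def letter_weight_def letter_op_def)
  have f4: "f (2, 0, 0) = 0"
    unfolding f_def letter_op_def prod.case T_op_simps by simp
  have "(f has_sum (f (1, 0, 0) + f (2, 0, 0) + ((-1) *\<^sub>R S0 + S1))) letters"
    by (rule has_sum_letters) (unfold f1 f2, rule has_sum_scaleR[OF S0], rule S1)
  moreover have "f (1, 0, 0) + f (2, 0, 0) + ((-1) *\<^sub>R S0 + S1) = (\<Sum>t\<in>lattice_points \<tau> (y $ h) s. \<phi> 0 t)"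
    unfolding f3 f4 eq by simp
  ultimately have "(f has_sum (\<Sum>t\<in>lattice_points \<tau> (y $ h) s. \<phi> 0 t)) letters" by (simp only:)
  then show ?thesis by (simp add: f_def \<phi>_def s_def)
qed

text \<open>
  The points over the next face are fibred over those of the smaller one, with lattice points of a
  segment as fibres.
\<close>

lemma face_points_step:
  fixes y :: "real ^ 'n::{finite,linorder}"
  shows "face_points \<tau> y {..h} = (\<lambda>(x, t). set_coord x h t) `
      Sigma (face_points \<tau> y {..<h}) (\<lambda>x. lattice_points \<tau> (y $ h) (last_coord_max h x))" (is "?L = ?R")
    and "inj_on (\<lambda>(x, t). set_coord x h t) (Sigma (face_points \<tau> y {..<h}) B)"
proof -
  show "inj_on (\<lambda>(x, t). set_coord x h t) (Sigma (face_points \<tau> y {..<h}) B)"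
  proof (rule inj_onI, clarsimp)
    fix x t x' t'
    assume "x \<in> face_points \<tau> y {..<h}" "x' \<in> face_points \<tau> y {..<h}" "set_coord x h t = set_coord x' h t'"
    then show "x = x' \<and> t = t'"
      by (simp add: vec_eq_iff face_points_def simplex_face_def) (metis order_less_irrefl)
  qed
  show "?L = ?R"
  proof (intro equalityI subsetI)
    fix z assume z: "z \<in> ?L"
    define x where "x = set_coord z h 0"
    have zx: "z = set_coord x h (z $ h)" by (simp add: x_def)
    have x0: "\<forall>k. k \<notin> {..<h} \<longrightarrow> x $ k = 0"
      using z by (auto simp: x_def face_points_def simplex_face_def)
    have "set_coord x h (z $ h) \<in> simplex_face {..h}"
      using z zx by (simp add: face_points_def)
    then have "x \<in> simplex_face {..<h} \<and> 0 \<le> z $ h \<and> z $ h \<le> last_coord_max h x"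
      using set_coord_in_face_iff[OF x0] by blast
    moreover have "\<forall>k\<in>{..<h}. \<tau> * x $ k - y $ k \<in> \<int>" "\<tau> * z $ h - y $ h \<in> \<int>"
      using z by (auto simp: x_def face_points_def)
    ultimately have "(x, z $ h) \<in> Sigma (face_points \<tau> y {..<h}) (\<lambda>x. lattice_points \<tau> (y $ h) (last_coord_max h x))"
      by (auto simp: face_points_def lattice_points_def)
    then show "z \<in> ?R" using zx by (intro image_eqI[of _ _ "(x, z $ h)"]) auto
  next
    fix z assume "z \<in> ?R"
    then obtain x t where z: "z = set_coord x h t" and x: "x \<in> face_points \<tau> y {..<h}"
      and t: "t \<in> lattice_points \<tau> (y $ h) (last_coord_max h x)" by auto
    have "z \<in> simplex_face {..h}"
      unfolding z using x t by (subst set_coord_in_face_iff)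
        (auto simp: face_points_def simplex_face_def lattice_points_def)
    then show "z \<in> ?L" using x t by (auto simp: face_points_def z lattice_points_def)
  qed
qed

lemma sum_face_points_step:
  fixes y :: "real ^ 'n::{finite,linorder}" and G :: "real ^ 'n::_ \<Rightarrow> 'b::comm_monoid_add"
  assumes "\<tau> > 0" "finite (face_points \<tau> y {..<h})"
  shows "(\<Sum>x\<in>face_points \<tau> y {..h}. G x) =
    (\<Sum>x\<in>face_points \<tau> y {..<h}. \<Sum>t\<in>lattice_points \<tau> (y $ h) (last_coord_max h x). G (set_coord x h t))"
  unfolding face_points_step(1)
  by (subst sum.reindex[OF face_points_step(2)], subst sum.Sigma)
     (use assms finite_lattice_points in \<open>auto intro!: sum.cong\<close>)

lemma simplex_face_empty: "simplex_face {} = {0}"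
  by (auto simp: simplex_face_def std_simplex_def vec_eq_iff)

lemma finite_face_points:
  fixes y :: "real ^ 'n::{finite,linorder}"
  assumes "\<tau> > 0" and "sorted_list_of_set UNIV = ps @ qs"
  shows "finite (face_points \<tau> y (set ps))"
  using assms(2)
proof (induction ps arbitrary: qs rule: rev_induct)
  case Nil
  then show ?case by (simp add: face_points_def simplex_face_empty)
next
  case (snoc h ps)
  then have s: "sorted_list_of_set UNIV = ps @ h # qs" by simp
  have "finite (face_points \<tau> y {..<h})" using snoc.IH[OF s] sorted_prefix[OF s] by simp
  then show ?case
    unfolding sorted_prefix(2)[OF s] face_points_step(1)
    using finite_lattice_points[OF assms(1)] by (intro finite_imageI finite_SigmaI) auto
qed

lemma foldr_letter_op_snoc:
  assumes "h \<notin> set ps"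
  shows "word_op (a(h := l)) (ps @ [h]) G =
    word_op a ps (letter_op h l G)"
  using assms by (auto intro: foldr_cong)

text \<open>
  Each coordinate doubles the growth rate of the derivatives, but the doubled rate matters only
  for the derivatives that are still to be taken; the rate at the last one is \<open>2\<^sup>d\<^sup>-\<^sup>1\<close> times the
  initial one.
\<close>

lemma letter_op_bound:
  fixes G :: "real ^ 'n::{finite,linorder} \<Rightarrow> 'b::euclidean_space"
  assumes "sorted_list_of_set UNIV = ps @ qs" and "C_infinity G" "deriv_bound (set ps) C A G"
    and "0 \<le> C" "0 < A0" "A0 \<le> A" "A * 2 ^ length ps \<le> 2 * A'" and "\<forall>k\<in>set ps. a k \<in> letters"
  shows "norm (word_op a ps G 0) \<le> C * word_bound (1 + 1 / A0) A' (set ps) a"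
  using assms
proof (induction ps arbitrary: qs G C A rule: rev_induct)
  case Nil
  then have "norm (foldr partial [] G 0) \<le> C * A ^ length ([] :: 'n list)"
    unfolding deriv_bound_def list.set(1) simplex_face_empty by (metis empty_subsetI list.set(1) singletonI)
  then show ?case by simp
next
  case (snoc h ps)
  have s: "sorted_list_of_set UNIV = ps @ h # qs" using snoc.prems(1) by simp
  obtain v e j where l: "a h = (v, e, j)" by (cases "a h")
  have A: "0 < A" "0 < A'"
  proof -
    show "0 < A" using snoc.prems by simp
    then have "0 < A * 2 ^ length (ps @ [h])" by simp
    then show "0 < A'" using snoc.prems(7) by simp
  qed
  have "A * 1 \<le> A * 2 ^ length ps" using A by (intro mult_left_mono) auto
  then have AA': "A \<le> A'" using snoc.prems(7) by simp
  have C': "C * (1 + 1 / A) * A ^ j \<le> C * ((1 + 1 / A0) * A' ^ j)"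
  proof -
    have "(1 + 1 / A) * A ^ j \<le> (1 + 1 / A0) * A' ^ j"
      using snoc.prems(5,6) A AA' by (intro mult_mono power_mono add_left_mono divide_left_mono) auto
    then show ?thesis using snoc.prems(4) by (simp add: mult.assoc mult_left_mono)
  qed
  have lin: "(v, e, j) \<in> letters" using snoc.prems(8) l by (metis in_set_conv_decomp)
  have db: "deriv_bound {..h} C A G" using snoc.prems(3) sorted_prefix(2)[OF s] by simp
  note T = T_op_smooth_bound[OF lin snoc.prems(2) db A(1) snoc.prems(4)]
  have "norm (word_op a ps (T_op h v e j G) 0) \<le>
      (C * ((1 + 1 / A0) * A' ^ j)) * word_bound (1 + 1 / A0) A' (set ps) a"
  proof (rule snoc.IH[OF s T(1)])
    show "deriv_bound (set ps) (C * ((1 + 1 / A0) * A' ^ j)) (2 * A) (T_op h v e j G)"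
      using deriv_bound_mono[OF T(2) C'] A sorted_prefix(1)[OF s] by simp
  qed (use snoc.prems A in auto)
  moreover have "word_op a (ps @ [h]) G = word_op a ps (T_op h v e j G)"
    by (simp add: letter_op_def l)
  moreover have "word_bound (1 + 1 / A0) A' (set (ps @ [h])) a =
      ((1 + 1 / A0) * A' ^ j) * word_bound (1 + 1 / A0) A' (set ps) a"
    using sorted_prefix(3)[OF s] by (simp add: l)
  ultimately show ?case by (simp only: mult.assoc)
qed

lemma summable_on_letters:
  fixes \<rho> M :: real
  assumes "0 \<le> \<rho>" "\<rho> < 1"
  shows "(\<lambda>l. M * \<rho> ^ snd (snd l)) summable_on letters"
proof -
  have "((\<lambda>j. M * \<rho> ^ j) has_sum (M * (1 / (1 - \<rho>)))) (UNIV :: nat set)"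
    using assms geometric_sums[of \<rho>]
    by (intro has_sum_cmult_right norm_summable_imp_has_sum) (auto simp: summable_geometric norm_power)
  then show ?thesis
    by (intro has_sum_imp_summable[OF has_sum_letters]) simp_all
qed

lemma summable_on_words:
  fixes \<rho> M :: real
  assumes "0 \<le> \<rho>" "\<rho> < 1" "0 \<le> M" "finite H"
  shows "(word_bound M \<rho> H) summable_on PiE H (\<lambda>_. letters)"
proof -
  have "(\<lambda>l. norm (M * \<rho> ^ snd (snd l))) summable_on letters"
    using summable_on_letters[OF assms(1,2), of M] assms(1,3) by (simp add: abs_mult)
  then have "Infinite_Set_Sum.abs_summable_on (\<lambda>l. M * \<rho> ^ snd (snd l)) letters"
    by (rule abs_summable_equivalent[THEN iffD1])
  then have "Infinite_Set_Sum.abs_summable_on (word_bound M \<rho> H) (PiE H (\<lambda>_. letters))"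
    using assms(4) by (intro abs_summable_on_prod_PiE countableI_type) auto
  then have "(\<lambda>a. norm (word_bound M \<rho> H a)) summable_on PiE H (\<lambda>_. letters)"
    by (rule abs_summable_equivalent[THEN iffD2])
  then show ?thesis by (rule abs_summable_summable)
qed

lemma letter_weight_bound:
  assumes "\<tau> > 0" "0 < r" "\<And>n x. \<bar>bernoulli n x\<bar> \<le> K / r ^ n" "0 \<le> K" "l \<in> letters"
  shows "\<bar>letter_weight \<tau> y k l\<bar> \<le> (K * (\<tau> + 1 / r)) * (1 / (\<tau> * r)) ^ snd (snd l)"
proof -
  obtain v e j where l: "l = (v, e, j)" by (cases l)
  have "\<bar>letter_weight \<tau> y k l\<bar> = \<tau> powi (1 - int e - int j) * \<bar>bernoulli (j + e) (zeta \<tau> v y k)\<bar>"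
    using assms(1) by (simp add: l letter_weight_def abs_mult)
  also have "\<dots> \<le> \<tau> powi (1 - int e - int j) * (K / r ^ (j + e))"
    using assms by (intro mult_left_mono) auto
  also have "\<dots> \<le> (K * (\<tau> + 1 / r)) * (1 / (\<tau> * r)) ^ j"
  proof (cases "e = 0")
    case True
    then have "j = 0" using assms(5) by (simp add: l letters_def)
    then show ?thesis using True assms by (simp add: algebra_simps)
  next
    case False
    then have e: "e = 1" using assms(5) by (simp add: l letters_def)
    have "\<tau> powi (1 - int e - int j) * (K / r ^ (j + e)) = (K * (1 / r)) * (1 / (\<tau> * r)) ^ j"
      using assms(1,2) by (simp add: e power_int_minus power_mult_distrib field_simps)
    also have "\<dots> \<le> (K * (\<tau> + 1 / r)) * (1 / (\<tau> * r)) ^ j"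
      using assms by (intro mult_right_mono mult_left_mono) auto
    finally show ?thesis .
  qed
  finally show ?thesis by (simp add: l)
qed

text \<open>
  The operators contribute \<open>A'\<close> for every derivative, the Bernoulli functions and the dilation
  \<open>1 / (\<tau> r)\<close>; so the terms decay geometrically in the order of the word as soon as \<open>A' < \<tau> r\<close>.
\<close>

lemma word_term_bound:
  fixes G :: "real ^ 'n::{finite,linorder} \<Rightarrow> 'b::euclidean_space"
  assumes \<tau>: "\<tau> > 0" and r: "0 < r" "\<And>n x. \<bar>bernoulli n x\<bar> \<le> K / r ^ n" "0 \<le> K"
    and ps: "sorted_list_of_set UNIV = ps @ qs" and G: "C_infinity G" "deriv_bound (set ps) C A G"
    and A: "0 \<le> C" "0 < A0" "A0 \<le> A" "A * 2 ^ length ps \<le> 2 * A'" and a: "a \<in> PiE (set ps) (\<lambda>_. letters)"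
  shows "norm (word_weight \<tau> y (set ps) a *\<^sub>R word_op a ps G 0) \<le>
    C * word_bound ((1 + 1 / A0) * (K * (\<tau> + 1 / r))) (A' / (\<tau> * r)) (set ps) a"
proof -
  have al: "\<forall>k\<in>set ps. a k \<in> letters" using a by (auto simp: PiE_def)
  have "norm (word_weight \<tau> y (set ps) a *\<^sub>R word_op a ps G 0) \<le>
      word_bound (K * (\<tau> + 1 / r)) (1 / (\<tau> * r)) (set ps) a *
      (C * word_bound (1 + 1 / A0) A' (set ps) a)"
    unfolding norm_scaleR real_norm_def abs_prod
  proof (intro mult_mono prod_mono conjI)
    show "norm (word_op a ps G 0) \<le> C * word_bound (1 + 1 / A0) A' (set ps) a"
      by (rule letter_op_bound[OF ps G A al])
    show "\<bar>letter_weight \<tau> y k (a k)\<bar> \<le> K * (\<tau> + 1 / r) * (1 / (\<tau> * r)) ^ snd (snd (a k))"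
      if "k \<in> set ps" for k
      using al that by (intro letter_weight_bound[OF \<tau> r]) blast
  qed (use \<tau> r in \<open>auto intro!: prod_nonneg\<close>)
  also have "\<dots> = C * word_bound ((1 + 1 / A0) * (K * (\<tau> + 1 / r))) (A' / (\<tau> * r)) (set ps) a"
    unfolding divide_inverse[of A'] inverse_eq_divide by (simp only: power_mult_distrib prod.distrib mult_ac)
  finally show ?thesis .
qed

text \<open>
  Iteration of the expansion along one coordinate, from the last coordinate down. The sum over
  the last letter stands outside the expansions of the functions it produces; the majorant of the
  previous lemma makes the double series absolutely convergent, so that it is a sum over words.
\<close>

lemma simplex_expansion_prefix:
  fixes G :: "real ^ 'n::{finite,linorder} \<Rightarrow> 'b::euclidean_space"
  assumes \<tau>: "\<tau> > 0" and y: "generic \<tau> y"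
    and r: "0 < r" "\<And>n x. \<bar>bernoulli n x\<bar> \<le> K / r ^ n" "0 \<le> K" "r < 2 * pi" "A' < \<tau> * r" and A0: "0 < A0"
    and "sorted_list_of_set UNIV = ps @ qs" and "C_infinity G" "deriv_bound (set ps) C A G"
    and "0 \<le> C" "A0 \<le> A" "A * 2 ^ length ps \<le> 2 * A'"
  shows "((\<lambda>a. word_weight \<tau> y (set ps) a *\<^sub>R word_op a ps G 0) has_sum
    (\<Sum>x\<in>face_points \<tau> y (set ps). G x)) (PiE (set ps) (\<lambda>_. letters))"
  using assms(9-)
proof (induction ps arbitrary: qs G C A rule: rev_induct)
  case Nil
  then show ?case
    by (intro has_sum_finiteI) (auto simp: face_points_def simplex_face_empty)
next
  case (snoc h ps)
  have s: "sorted_list_of_set UNIV = ps @ h # qs" using snoc.prems(1) by simp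
  have ps: "set ps = {..<h}" "set (ps @ [h]) = {..h}" "h \<notin> set ps" using sorted_prefix[OF s] by auto
  have A: "0 < A" "0 < A'"
  proof -
    show "0 < A" using snoc.prems A0 by simp
    then have "0 < A * 2 ^ length (ps @ [h])" by simp
    then show "0 < A'" using snoc.prems(6) by simp
  qed
  have "A * 1 \<le> A * 2 ^ length ps" using A by (intro mult_left_mono) auto
  then have AA': "A \<le> A'" using snoc.prems(6) by simp
  have "\<tau> * r < 2 * pi * \<tau>" using \<tau> r by simp
  then have A2: "A < 2 * pi * \<tau>" using AA' r(5) by linarith
  have db: "deriv_bound {..h} C A G" using snoc.prems(3) ps by simp
  define wterm where "wterm = (\<lambda>a. word_weight \<tau> y (set (ps @ [h])) a *\<^sub>R
      word_op a (ps @ [h]) G 0)"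
  define W where "W = (\<lambda>a. \<Prod>k\<in>set ps. letter_weight \<tau> y k (a k))"
  define \<rho> where "\<rho> = A' / (\<tau> * r)"
  define M where "M = (1 + 1 / A0) * (K * (\<tau> + 1 / r))"
  have \<rho>: "0 \<le> \<rho>" "\<rho> < 1" using A r \<tau> by (auto simp: \<rho>_def field_simps)
  have M: "0 \<le> M" using A0 r \<tau> by (simp add: M_def)
  have wterm_upd: "wterm (a(h := l)) = letter_weight \<tau> y h l *\<^sub>R (W a *\<^sub>R word_op a ps (letter_op h l G) 0)"
    for a l
  proof -
    have "(\<Prod>k\<in>set (ps @ [h]). letter_weight \<tau> y k ((a(h := l)) k)) = letter_weight \<tau> y h l * W a"
      using ps(3) by (auto simp: W_def intro!: prod.cong)
    then show ?thesis
      unfolding wterm_def foldr_letter_op_snoc[OF ps(3)] by simp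
  qed
  have wterm_bound: "norm (wterm a) \<le> C * word_bound M \<rho> (set (ps @ [h])) a"
    if a: "a \<in> PiE (set (ps @ [h])) (\<lambda>_. letters)" for a
    using word_term_bound[OF \<tau> r(1-3) snoc.prems(1-4) A0 snoc.prems(5,6) a]
    by (simp only: wterm_def M_def \<rho>_def)
  have "(\<lambda>a. C * word_bound M \<rho> (set (ps @ [h])) a) summable_on (PiE (set (ps @ [h])) (\<lambda>_. letters))"
    by (intro summable_on_cmult_right summable_on_words[OF \<rho> M]) auto
  then have "(\<lambda>a. norm (wterm a)) summable_on (PiE (set (ps @ [h])) (\<lambda>_. letters))"
    by (rule summable_on_comparison_test) (use wterm_bound in auto)
  then have sum: "wterm summable_on (PiE (set (ps @ [h])) (\<lambda>_. letters))"
    by (rule abs_summable_summable)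
  have PiE_eq: "PiE (set (ps @ [h])) (\<lambda>_. letters) = (\<lambda>(l, a). a(h := l)) ` (letters \<times> PiE (set ps) (\<lambda>_. letters))"
    using PiE_insert_eq[of h "set ps" "\<lambda>_. letters"] by simp
  have inj: "inj_on (\<lambda>(l, a). a(h := l)) (letters \<times> PiE (set ps) (\<lambda>_. letters))"
    using inj_combinator[OF ps(3), of "\<lambda>_. letters"] by simp
  define g where "g = (\<lambda>l. letter_weight \<tau> y h l *\<^sub>R (\<Sum>x\<in>face_points \<tau> y (set ps). letter_op h l G x))"
  have "((\<lambda>(l, a). wterm (a(h := l))) has_sum (\<Sum>x\<in>face_points \<tau> y (set (ps @ [h])). G x))
      (Sigma letters (\<lambda>_. PiE (set ps) (\<lambda>_. letters)))"
  proof (rule has_sum_SigmaI)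
    fix l assume l: "l \<in> letters"
    obtain v e j where vej: "l = (v, e, j)" by (cases l)
    have "letter_op h l G = T_op h v e j G" by (simp add: vej letter_op_def)
    then have T: "C_infinity (letter_op h l G)" "deriv_bound (set ps) (C * (1 + 1 / A) * A ^ j) (2 * A) (letter_op h l G)"
      using T_op_smooth_bound[OF _ snoc.prems(2) db A(1) snoc.prems(4), of v e j] l ps by (auto simp: vej)
    have "((\<lambda>a. W a *\<^sub>R word_op a ps (letter_op h l G) 0) has_sum
        (\<Sum>x\<in>face_points \<tau> y (set ps). letter_op h l G x)) (PiE (set ps) (\<lambda>_. letters))"
      unfolding W_def
      by (rule snoc.IH[OF s T]) (use snoc.prems A in auto)
    from has_sum_scaleR[OF this, of "letter_weight \<tau> y h l"]
    show "((\<lambda>a. case (l, a) of (l, a) \<Rightarrow> wterm (a(h := l))) has_sum g l) (PiE (set ps) (\<lambda>_. letters))"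
      by (simp add: wterm_upd g_def)
  next
    have "(g has_sum (\<Sum>x\<in>face_points \<tau> y (set ps). \<Sum>t\<in>lattice_points \<tau> (y $ h) (last_coord_max h x). G (set_coord x h t))) letters"
      unfolding g_def scaleR_sum_right
    proof (intro has_sum_finite_sum)
      fix x assume "x \<in> face_points \<tau> y (set ps)"
      then show "((\<lambda>l. letter_weight \<tau> y h l *\<^sub>R letter_op h l G x) has_sum
          (\<Sum>t\<in>lattice_points \<tau> (y $ h) (last_coord_max h x). G (set_coord x h t))) letters"
        using euler_maclaurin_coordinate[OF \<tau> snoc.prems(2) db A(1) A2 y] ps by simp
    qed
    then show "(g has_sum (\<Sum>x\<in>face_points \<tau> y (set (ps @ [h])). G x)) letters"
      unfolding ps(2) using sum_face_points_step[OF \<tau>, of y h G] finite_face_points[OF \<tau> s, of y] ps by simp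
    show "(\<lambda>(l, a). wterm (a(h := l))) summable_on (Sigma letters (\<lambda>_. PiE (set ps) (\<lambda>_. letters)))"
      using sum unfolding PiE_eq summable_on_reindex[OF inj] by (simp add: o_def split_def)
  qed
  then have "(wterm has_sum (\<Sum>x\<in>face_points \<tau> y (set (ps @ [h])). G x)) (PiE (set (ps @ [h])) (\<lambda>_. letters))"
    unfolding PiE_eq has_sum_reindex[OF inj] by (simp add: o_def split_def)
  then show ?case unfolding wterm_def .
qed

section \<open>The unimodular bases\<close>

lemma fold_set_coord_notin: "l \<notin> set xs \<Longrightarrow> fold (\<lambda>i b. set_coord b i (c i b)) xs b $ l = b $ l"
  by (induction xs arbitrary: b) auto

text \<open>
  The steps after the one that sets the coordinate \<open>i\<close> change neither this coordinate nor the
  preceding ones, from which it was computed.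
\<close>

lemma fold_set_coord_rec:
  fixes c :: "'n::{finite,linorder} \<Rightarrow> real ^ 'n::_ \<Rightarrow> real" and i :: 'n
  assumes c: "\<And>i b b'. (\<And>l. l < i \<Longrightarrow> b $ l = b' $ l) \<Longrightarrow> c i b = c i b'"
  defines "F \<equiv> fold (\<lambda>i b. set_coord b i (c i b)) (sorted_list_of_set UNIV) 0"
  shows "F $ i = c i F"
proof -
  obtain ps qs where s: "sorted_list_of_set UNIV = ps @ i # qs"
    using split_list[of i "sorted_list_of_set UNIV"] by auto
  define b where "b = fold (\<lambda>i b. set_coord b i (c i b)) ps 0"
  have F: "F = fold (\<lambda>i b. set_coord b i (c i b)) qs (set_coord b i (c i b))"
    by (simp add: F_def s b_def)
  have "distinct (ps @ i # qs)" unfolding s[symmetric] by simp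
  then have d: "i \<notin> set qs" "set ps \<inter> set qs = {}" by auto
  have "b $ l = F $ l" if "l < i" for l
  proof -
    have "l \<in> set ps" using that sorted_prefix(1)[OF s] by simp
    then have "l \<notin> set qs" using d by blast
    then show ?thesis unfolding F using less_imp_neq[OF that] by (simp add: fold_set_coord_notin)
  qed
  then have "c i b = c i F" by (rule c)
  then show ?thesis
    by (subst F) (simp add: fold_set_coord_notin[OF d(1)])
qed

lemma basis_vec_rec:
  "basis_vec V k $ i = (if i = k then 1 else if V i = 1 then 0 else - (\<Sum>l | l < i. basis_vec V k $ l))"
  unfolding basis_vec_def by (rule fold_set_coord_rec) (auto intro!: sum.cong)

lemma lambda_vec_rec:
  "lambda_vec V $ i = (if V i = 1 then 0 else 1 - (\<Sum>l | l < i. lambda_vec V $ l))"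
  unfolding lambda_vec_def by (rule fold_set_coord_rec) (auto intro!: sum.cong)

lemma finite_linorder_induct:
  fixes i :: "'n::{finite,linorder}"
  assumes "\<And>i. (\<And>l. l < i \<Longrightarrow> P l) \<Longrightarrow> P i"
  shows "P i"
proof (induction "card {l. l < i}" arbitrary: i rule: less_induct)
  case less
  show ?case
  proof (rule assms)
    fix l assume "l < i"
    then have "{k. k < l} \<subset> {k. k < i}" by auto
    then have "card {k. k < l} < card {k. k < i}" by (intro psubset_card_mono) auto
    then show "P l" by (rule less)
  qed
qed

lemma basis_vec_eq_0: "i < k \<Longrightarrow> basis_vec V k $ i = 0"
proof (induction i rule: finite_linorder_induct)
  case (1 i)
  then have "(\<Sum>l | l < i. basis_vec V k $ l) = 0" by (intro sum.neutral) auto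
  then show ?case using 1 by (subst basis_vec_rec) auto
qed

lemma basis_vec_Ints: "basis_vec V k $ i \<in> \<int>"
proof (induction i rule: finite_linorder_induct)
  case (1 i)
  then have "(\<Sum>l | l < i. basis_vec V k $ l) \<in> \<int>" by (intro Ints_sum) auto
  then show ?case by (subst basis_vec_rec) auto
qed

text \<open>
  The inverse of the basis of index \<open>V\<close>. When the \<open>k\<close>-th coordinate is appended with \<open>V k = 2\<close>, the
  vectors created earlier are extended so that their entries sum to 0; therefore the partial sum of
  the entries of a vector up to \<open>k\<close> is its \<open>k\<close>-th coordinate in the basis.
\<close>

definition unshear :: "('n::{finite,linorder} \<Rightarrow> nat) \<Rightarrow> real ^ 'n::_ \<Rightarrow> real ^ 'n::_" where
  "unshear V y = (\<chi> k. if V k = 1 then y $ k else \<Sum>l | l \<le> k. y $ l)"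

lemma linear_unshear: "linear (unshear V)"
  by (rule linearI) (auto simp: unshear_def vec_eq_iff sum.distrib sum_distrib_left)

lemma sum_le_eq:
  fixes k :: "'n::{finite,linorder}" and f :: "'n \<Rightarrow> real"
  shows "(\<Sum>l | l \<le> k. f l) = f k + (\<Sum>l | l < k. f l)"
proof -
  have "{l. l \<le> k} = insert k {l. l < k}" by auto
  then show ?thesis by simp
qed

lemma unshear_basis_vec: "unshear V (basis_vec V k) = axis k 1"
proof -
  have "unshear V (basis_vec V k) $ i = axis k 1 $ i" for i
  proof (cases "i = k")
    case True
    have "(\<Sum>l | l < k. basis_vec V k $ l) = 0"
      by (intro sum.neutral) (auto simp: basis_vec_eq_0)
    then show ?thesis using True basis_vec_rec[of V k k]
      by (simp add: unshear_def sum_le_eq axis_def)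
  next
    case False
    then show ?thesis using basis_vec_rec[of V k i]
      by (auto simp: unshear_def sum_le_eq axis_def)
  qed
  then show ?thesis by (simp add: vec_eq_iff)
qed

lemma unshear_lambda_vec: "unshear V (lambda_vec V) $ k = (if V k = 1 then 0 else 1)"
  using lambda_vec_rec[of V k] by (simp add: unshear_def sum_le_eq)

lemma unshear_basis_mat: "unshear V (basis_mat V *v x) = x"
proof -
  interpret linear "unshear V" by (rule linear_unshear)
  have "basis_mat V *v x = (\<Sum>k\<in>UNIV. x $ k *\<^sub>R basis_vec V k)"
    by (simp add: basis_mat_def matrix_vector_mult_def vec_eq_iff mult.commute)
  then have "unshear V (basis_mat V *v x) = (\<Sum>k\<in>UNIV. x $ k *\<^sub>R axis k 1)"
    by (simp add: sum scale unshear_basis_vec)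
  also have "\<dots> = x" by (simp add: basis_expansion scalar_mult_eq_scaleR[symmetric])
  finally show ?thesis .
qed

lemma matrix_unshear_mult: "matrix (unshear V) ** basis_mat V = mat 1" "basis_mat V ** matrix (unshear V) = mat 1"
proof -
  have "(matrix (unshear V) ** basis_mat V) *v x = mat 1 *v x" for x
    by (simp add: matrix_vector_mul_assoc[symmetric] fun_cong[OF matrix_vector_mul(2)[OF linear_unshear]] unshear_basis_mat)
  then show "matrix (unshear V) ** basis_mat V = mat 1" using matrix_eq by blast
  then show "basis_mat V ** matrix (unshear V) = mat 1" by (simp add: matrix_left_right_inverse)
qed

lemma basis_mat_unshear: "basis_mat V *v unshear V x = x"
proof -
  have "basis_mat V *v unshear V x = (basis_mat V ** matrix (unshear V)) *v x"
    by (simp add: matrix_vector_mul_assoc[symmetric] fun_cong[OF matrix_vector_mul(2)[OF linear_unshear]])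
  then show ?thesis by (simp add: matrix_unshear_mult)
qed

lemma int_lattice_add: "x \<in> int_lattice \<Longrightarrow> y \<in> int_lattice \<Longrightarrow> x + y \<in> int_lattice"
  by (simp add: int_lattice_def)

lemma int_lattice_diff: "x \<in> int_lattice \<Longrightarrow> y \<in> int_lattice \<Longrightarrow> x - y \<in> int_lattice"
  by (simp add: int_lattice_def)

lemma int_lattice_matrix:
  "(\<And>i j. A $ i $ j \<in> \<int>) \<Longrightarrow> x \<in> int_lattice \<Longrightarrow> A *v x \<in> int_lattice"
  by (auto simp: int_lattice_def matrix_vector_mult_def intro!: Ints_sum Ints_mult)

lemma int_lattice_unshear: "x \<in> int_lattice \<Longrightarrow> unshear V x \<in> int_lattice"
  by (auto simp: int_lattice_def unshear_def intro!: Ints_sum)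

lemma int_lattice_basis_mat: "x \<in> int_lattice \<Longrightarrow> basis_mat V *v x \<in> int_lattice"
  by (rule int_lattice_matrix) (auto simp: basis_mat_def basis_vec_Ints)

lemma det_Ints:
  fixes A :: "real ^ 'n ^ 'n"
  assumes "\<And>i j. A $ i $ j \<in> \<int>"
  shows "det A \<in> \<int>"
  unfolding det_def using assms by (intro Ints_sum Ints_mult Ints_prod) auto

text \<open>
  The basis matrix and its inverse both have integer entries.
\<close>

lemma abs_det_basis_mat: "\<bar>det (basis_mat V)\<bar> = 1"
proof -
  have "matrix (unshear V) $ i $ j \<in> \<int>" for i j
    using int_lattice_unshear[of "axis j 1" V]
    by (auto simp: matrix_def int_lattice_def axis_def)
  then obtain a where a: "det (matrix (unshear V)) = of_int a"
    using det_Ints by (metis Ints_cases)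
  obtain b where b: "det (basis_mat V) = of_int b"
    using det_Ints[of "basis_mat V"] by (auto simp: basis_mat_def basis_vec_Ints elim: Ints_cases)
  have "of_int (a * b) = (1::real)"
    using arg_cong[OF matrix_unshear_mult(1)[of V], of det] by (simp add: det_mul a b)
  then have "b * a = 1" by (simp only: of_int_eq_1_iff mult.commute)
  then have "\<bar>b\<bar> = 1" by (intro abs_zmult_eq_1[of b a]) simp
  then show ?thesis by (simp add: b flip: of_int_abs)
qed

section \<open>Lattice sums over cosets\<close>

text \<open>
  Representatives of the classes of the lattice \<open>M\<^sup>-\<^sup>1 \<int>\<^sup>d\<close> modulo its sublattice \<open>\<int>\<^sup>d\<close>. In the
  coordinates of the simplex, summing over \<open>\<int>\<^sup>d\<close> becomes summing over the former lattice; the latter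
  one is what the standard simplex is expanded with.
\<close>

definition coset_reps :: "real ^ 'n ^ 'n \<Rightarrow> (real ^ 'n) set" where
  "coset_reps M = {r. M *v r \<in> int_lattice \<and> (\<forall>k. 0 \<le> r $ k \<and> r $ k < 1)}"

definition floor_vec :: "real ^ 'n \<Rightarrow> real ^ 'n" where
  "floor_vec x = (\<chi> k. of_int \<lfloor>x $ k\<rfloor>)"

lemma floor_vec_int: "floor_vec x \<in> int_lattice"
  by (simp add: floor_vec_def int_lattice_def)

lemma floor_vec_bounds: "0 \<le> (x - floor_vec x) $ k" "(x - floor_vec x) $ k < 1"
  by (simp_all add: floor_vec_def) linarith+

lemma int_lattice_eqI:
  assumes "x - y \<in> int_lattice" "\<And>k. 0 \<le> x $ k" "\<And>k. x $ k < 1" "\<And>k. 0 \<le> y $ k" "\<And>k. y $ k < 1"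
  shows "x = y"
proof -
  have "x $ k - y $ k = 0" for k
  proof -
    obtain m where m: "x $ k - y $ k = of_int m"
      using assms(1) by (auto simp: int_lattice_def elim: Ints_cases)
    have "of_int m < (1::real)" "of_int m > (-1::real)"
      using assms(2-5)[of k] m by linarith+
    then have "m = 0" by linarith
    then show ?thesis using m by simp
  qed
  then show ?thesis by (simp add: vec_eq_iff)
qed

lemma finite_int_lattice_bounded:
  fixes S :: "(real ^ 'n) set"
  assumes "bounded S"
  shows "finite (int_lattice \<inter> S)"
proof -
  obtain B where B: "\<And>x. x \<in> S \<Longrightarrow> norm x \<le> B" using assms by (auto simp: bounded_iff)
  define I where "I = {- \<lceil>B\<rceil>..\<lceil>B\<rceil>}"
  have "int_lattice \<inter> S \<subseteq> (\<lambda>f. \<chi> k. of_int (f k)) ` (PiE UNIV (\<lambda>_. I))"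
  proof
    fix x assume x: "x \<in> int_lattice \<inter> S"
    then have fl: "of_int \<lfloor>x $ k\<rfloor> = x $ k" for k by (auto simp: int_lattice_def elim!: Ints_cases)
    have "\<bar>x $ k\<bar> \<le> B" for k using component_le_norm_cart[of x k] B[of x] x by auto
    then have "\<lfloor>x $ k\<rfloor> \<in> I" for k
    proof -
      have "\<bar>of_int \<lfloor>x $ k\<rfloor> :: real\<bar> \<le> B" using fl[of k] \<open>\<bar>x $ k\<bar> \<le> B\<close> by (simp only:)
      then show ?thesis unfolding I_def atLeastAtMost_iff by linarith
    qed
    then have "(\<lambda>k. \<lfloor>x $ k\<rfloor>) \<in> PiE UNIV (\<lambda>_. I)" by auto
    moreover have "x = (\<chi> k. of_int \<lfloor>x $ k\<rfloor>)" by (simp add: vec_eq_iff fl)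
    ultimately show "x \<in> (\<lambda>f. \<chi> k. of_int (f k)) ` (PiE UNIV (\<lambda>_. I))"
      by (intro image_eqI[of _ _ "\<lambda>k. \<lfloor>x $ k\<rfloor>"])
  qed
  moreover have "finite (PiE (UNIV :: 'n set) (\<lambda>_. I))" by (intro finite_PiE) (auto simp: I_def)
  ultimately show ?thesis by (meson finite_imageI finite_subset)
qed

context
  fixes M :: "real ^ 'n ^ 'n"
  assumes M_int: "\<And>i j. M $ i $ j \<in> \<int>" and M_det: "det M \<noteq> 0"
begin

lemma matrix_inv_cancel: "M *v (matrix_inv M *v x) = x" "matrix_inv M *v (M *v x) = x"
proof -
  have "invertible M" using M_det by (simp add: invertible_det_nz)
  then have "M ** matrix_inv M = mat 1 \<and> matrix_inv M ** M = mat 1"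
    unfolding invertible_def matrix_inv_def by (rule someI_ex)
  then show "M *v (matrix_inv M *v x) = x" "matrix_inv M *v (M *v x) = x"
    by (simp_all add: matrix_vector_mul_assoc)
qed

lemma finite_coset_reps: "finite (coset_reps M)"
proof -
  have "bounded {r :: real ^ 'n. \<forall>k. 0 \<le> r $ k \<and> r $ k < 1}"
    by (rule bounded_subset[of "cbox 0 1"]) (auto simp: mem_box_cart less_imp_le)
  then have "bounded ((*v) M ` {r. \<forall>k. 0 \<le> r $ k \<and> r $ k < 1})"
    by (intro bounded_linear_image) (auto intro: linear_linear[THEN iffD1])
  then have "finite (int_lattice \<inter> (*v) M ` {r. \<forall>k. 0 \<le> r $ k \<and> r $ k < 1})"
    by (rule finite_int_lattice_bounded)
  then have "finite ((*v) (matrix_inv M) ` (int_lattice \<inter> (*v) M ` {r. \<forall>k. 0 \<le> r $ k \<and> r $ k < 1}))"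
    by (rule finite_imageI)
  moreover have "coset_reps M \<subseteq> (*v) (matrix_inv M) ` (int_lattice \<inter> (*v) M ` {r. \<forall>k. 0 \<le> r $ k \<and> r $ k < 1})"
    by (auto simp: coset_reps_def image_iff matrix_inv_cancel intro!: bexI[of _ "M *v _"])
  ultimately show ?thesis by (rule finite_subset[rotated])
qed

lemma coset_rep_exists:
  assumes "n \<in> int_lattice"
  shows "matrix_inv M *v n - floor_vec (matrix_inv M *v n) \<in> coset_reps M"
  using assms floor_vec_bounds[of "matrix_inv M *v n"]
  by (auto simp: coset_reps_def matrix_vector_mult_diff_distrib matrix_inv_cancel
      intro!: int_lattice_diff int_lattice_matrix[OF M_int] floor_vec_int)

end

lemma coset_reps_unique:
  assumes "r \<in> coset_reps M" "r' \<in> coset_reps M" "r - r' \<in> int_lattice"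
  shows "r = r'"
  using assms by (intro int_lattice_eqI) (auto simp: coset_reps_def)

context
  fixes M :: "real ^ 'n::{finite,linorder} ^ 'n::_"
  assumes M_int: "\<And>i j. M $ i $ j \<in> \<int>" and M_det: "det M \<noteq> 0"
begin

lemma transpose_inv_apply:
  "transpose (matrix_inv (transpose (M ** basis_mat V))) *v x = unshear V (matrix_inv M *v x)"
proof -
  define L where "L = transpose (M ** basis_mat V)"
  have "det L \<noteq> 0"
    using M_det abs_det_basis_mat[of V] by (auto simp: L_def det_mul)
  then have "invertible L" by (simp add: invertible_det_nz)
  then have "L ** matrix_inv L = mat 1 \<and> matrix_inv L ** L = mat 1"
    unfolding invertible_def matrix_inv_def by (rule someI_ex)
  then have "transpose (L ** matrix_inv L) = mat 1" by simp
  then have Q: "transpose (matrix_inv L) ** (M ** basis_mat V) = mat 1"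
    by (simp add: matrix_transpose_mul L_def)
  have "x = (M ** basis_mat V) *v unshear V (matrix_inv M *v x)"
    by (simp add: matrix_vector_mul_assoc[symmetric] basis_mat_unshear matrix_inv_cancel[OF M_int M_det])
  then have "transpose (matrix_inv L) *v x =
      transpose (matrix_inv L) *v ((M ** basis_mat V) *v unshear V (matrix_inv M *v x))" by simp
  also have "\<dots> = unshear V (matrix_inv M *v x)"
    by (subst matrix_vector_mul_assoc) (simp add: Q)
  finally show ?thesis by (simp add: L_def)
qed

text \<open>
  For each representative \<open>r\<close> the translate of \<open>\<int>\<^sup>d\<close> by \<open>M\<^sup>-\<^sup>1 X + r\<close> contains exactly one point whose
  coordinates in the basis all lie in \<open>[0, 1)\<close>, because the basis is unimodular. There the truncated
  Bernoulli polynomials agree with the periodic ones, and at the other points they vanish.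
\<close>

lemma bernoulli_lattice_sum:
  "(\<Sum>\<^sub>\<infinity>n\<in>int_lattice. bernoulli_mat J (transpose (M ** basis_mat V)) (X + n)) =
     inverse \<bar>det M\<bar> * (\<Sum>r\<in>coset_reps M. \<Prod>k\<in>UNIV. bernoulli (J k) (unshear V (matrix_inv M *v X + r) $ k))"
proof -
  interpret u: linear "unshear V" by (rule linear_unshear)
  note Minv = matrix_inv_cancel[OF M_int M_det]
  define z where "z = (\<lambda>r. unshear V (matrix_inv M *v X + r))"
  define \<phi> where "\<phi> = (\<lambda>r. M *v (r - basis_mat V *v floor_vec (z r)))"
  define b where "b = (\<lambda>n. bernoulli_multi J (unshear V (matrix_inv M *v (X + n))))"
  have z_\<phi>: "unshear V (matrix_inv M *v (X + \<phi> r)) = z r - floor_vec (z r)" for r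
    by (simp add: \<phi>_def z_def matrix_vector_right_distrib Minv u.add u.diff unshear_basis_mat algebra_simps)
  have \<phi>_int: "\<phi> r \<in> int_lattice" if "r \<in> coset_reps M" for r
    using that unfolding \<phi>_def matrix_vector_mult_diff_distrib
    by (auto simp: coset_reps_def intro!: int_lattice_diff int_lattice_matrix[OF M_int]
        int_lattice_basis_mat floor_vec_int)
  have inj: "inj_on \<phi> (coset_reps M)"
  proof (rule inj_onI)
    fix r r' assume r: "r \<in> coset_reps M" "r' \<in> coset_reps M" "\<phi> r = \<phi> r'"
    then have "matrix_inv M *v \<phi> r = matrix_inv M *v \<phi> r'" by simp
    then have "r - r' = basis_mat V *v floor_vec (z r) - basis_mat V *v floor_vec (z r')"
      by (simp add: \<phi>_def Minv algebra_simps)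
    then have "r - r' \<in> int_lattice" by (simp add: int_lattice_diff int_lattice_basis_mat floor_vec_int)
    then show "r = r'" using r coset_reps_unique by blast
  qed
  have surj: "n \<in> \<phi> ` coset_reps M" if n: "n \<in> int_lattice" and "b n \<noteq> 0" for n
  proof -
    define w where "w = unshear V (matrix_inv M *v (X + n))"
    have w: "0 \<le> w $ k" "w $ k < 1" for k
      using that(2) by (auto simp: b_def bernoulli_multi_def w_def split: if_splits)
    define r where "r = matrix_inv M *v n - floor_vec (matrix_inv M *v n)"
    have r: "r \<in> coset_reps M" unfolding r_def by (rule coset_rep_exists[OF M_int M_det n])
    have "w - (z r - floor_vec (z r)) = unshear V (floor_vec (matrix_inv M *v n)) + floor_vec (z r)"
      by (simp add: w_def z_def r_def matrix_vector_right_distrib u.add u.diff)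
    also have "\<dots> \<in> int_lattice"
      by (intro int_lattice_add int_lattice_unshear floor_vec_int)
    finally have "w = z r - floor_vec (z r)"
      by (rule int_lattice_eqI) (rule w floor_vec_bounds)+
    then have "basis_mat V *v w = basis_mat V *v z r - basis_mat V *v floor_vec (z r)"
      by (simp add: matrix_vector_mult_diff_distrib)
    then have "matrix_inv M *v n = r - basis_mat V *v floor_vec (z r)"
      by (simp add: w_def z_def basis_mat_unshear matrix_vector_right_distrib algebra_simps)
    then have "\<phi> r = M *v (matrix_inv M *v n)" by (simp add: \<phi>_def)
    then show ?thesis using r by (auto simp: Minv)
  qed
  have b_\<phi>: "b (\<phi> r) = (\<Prod>k\<in>UNIV. bernoulli (J k) (z r $ k))" for r
  proof -
    have "bernoulli (J k) ((z r - floor_vec (z r)) $ k) = bernoulli (J k) (z r $ k)" for k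
      using bernoulli_add_int[of "J k" "(z r - floor_vec (z r)) $ k" "\<lfloor>z r $ k\<rfloor>"]
      by (simp add: floor_vec_def)
    then show ?thesis
      using floor_vec_bounds[of "z r"] by (simp add: b_def z_\<phi> bernoulli_multi_def del: vector_minus_component)
  qed
  have "(\<Sum>\<^sub>\<infinity>n\<in>int_lattice. b n) = (\<Sum>\<^sub>\<infinity>n\<in>\<phi> ` coset_reps M. b n)"
    by (rule infsum_cong_neutral) (use surj \<phi>_int in auto)
  also have "\<dots> = (\<Sum>n\<in>\<phi> ` coset_reps M. b n)"
    by (intro infsum_finite finite_imageI finite_coset_reps M_int M_det)
  also have "\<dots> = (\<Sum>r\<in>coset_reps M. b (\<phi> r))"
    by (simp add: sum.reindex[OF inj])
  finally have "(\<Sum>\<^sub>\<infinity>n\<in>int_lattice. b n) = (\<Sum>r\<in>coset_reps M. \<Prod>k\<in>UNIV. bernoulli (J k) (z r $ k))"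
    by (simp add: b_\<phi>)
  moreover have "bernoulli_mat J (transpose (M ** basis_mat V)) (X + n) = inverse \<bar>det M\<bar> * b n" for n
    unfolding bernoulli_mat_def transpose_inv_apply b_def
    by (simp add: det_mul abs_mult abs_det_basis_mat)
  ultimately show ?thesis
    by (simp add: infsum_cmult_right' z_def)
qed

text \<open>
  A lattice point \<open>n\<close> belongs to the class of the fractional part of \<open>M\<^sup>-\<^sup>1 n\<close>.
\<close>

lemma polytope_lattice_sum:
  fixes G :: "real ^ 'n::_ \<Rightarrow> 'b::comm_monoid_add"
  assumes \<tau>: "\<tau> > 0" and fin: "\<And>r. r \<in> coset_reps M \<Longrightarrow> finite (face_points \<tau> (matrix_inv M *v X + r) UNIV)"
  shows "(\<Sum>n\<in>{n\<in>int_lattice. \<exists>x\<in>std_simplex. X + n = \<tau> *\<^sub>R (M *v x)}. G ((1 / \<tau>) *\<^sub>R (matrix_inv M *v (X + n)))) =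
    (\<Sum>r\<in>coset_reps M. \<Sum>x\<in>face_points \<tau> (matrix_inv M *v X + r) UNIV. G x)"
proof -
  note Minv = matrix_inv_cancel[OF M_int M_det]
  have pt: "(1 / \<tau>) *\<^sub>R (matrix_inv M *v (\<tau> *\<^sub>R (M *v x))) = x" for x
    using \<tau> by (simp add: matrix_vector_mult_scaleR Minv)
  have "(\<Sum>r\<in>coset_reps M. \<Sum>x\<in>face_points \<tau> (matrix_inv M *v X + r) UNIV. G x) =
    (\<Sum>(r, x)\<in>Sigma (coset_reps M) (\<lambda>r. face_points \<tau> (matrix_inv M *v X + r) UNIV). G x)"
    using fin by (intro sum.Sigma finite_coset_reps M_int M_det) auto
  also have "\<dots> = (\<Sum>n\<in>{n\<in>int_lattice. \<exists>x\<in>std_simplex. X + n = \<tau> *\<^sub>R (M *v x)}. G ((1 / \<tau>) *\<^sub>R (matrix_inv M *v (X + n))))"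
  proof (rule sum.reindex_bij_witness[where
        j = "\<lambda>(r, x). \<tau> *\<^sub>R (M *v x) - X" and
        i = "\<lambda>n. (matrix_inv M *v n - floor_vec (matrix_inv M *v n), (1 / \<tau>) *\<^sub>R (matrix_inv M *v (X + n)))"])
    fix p assume p: "p \<in> Sigma (coset_reps M) (\<lambda>r. face_points \<tau> (matrix_inv M *v X + r) UNIV)"
    obtain r x where rx: "p = (r, x)" by (cases p)
    have r: "r \<in> coset_reps M" and x: "x \<in> std_simplex"
      and int: "\<tau> *\<^sub>R x - (matrix_inv M *v X + r) \<in> int_lattice"
      using p by (auto simp: rx face_points_def simplex_face_def int_lattice_def)
    define n where "n = \<tau> *\<^sub>R (M *v x) - X"
    have Minv_n: "matrix_inv M *v n = \<tau> *\<^sub>R x - matrix_inv M *v X"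
      by (simp add: n_def matrix_vector_mult_diff_distrib matrix_vector_mult_scaleR Minv)
    have "n = M *v (\<tau> *\<^sub>R x - (matrix_inv M *v X + r)) + M *v r"
      by (simp add: n_def matrix_vector_mult_diff_distrib matrix_vector_right_distrib matrix_vector_mult_scaleR Minv)
    also have "\<dots> \<in> int_lattice"
      using r by (intro int_lattice_add int_lattice_matrix[OF M_int int]) (simp add: coset_reps_def)
    finally have n: "n \<in> int_lattice" .
    have "r = matrix_inv M *v n - floor_vec (matrix_inv M *v n)"
    proof (rule coset_reps_unique[OF r coset_rep_exists[OF M_int M_det n]])
      have "r - (matrix_inv M *v n - floor_vec (matrix_inv M *v n)) =
          floor_vec (matrix_inv M *v n) - (\<tau> *\<^sub>R x - (matrix_inv M *v X + r))"
        by (simp add: Minv_n)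
      also have "\<dots> \<in> int_lattice" by (intro int_lattice_diff floor_vec_int int)
      finally show "r - (matrix_inv M *v n - floor_vec (matrix_inv M *v n)) \<in> int_lattice" .
    qed
    then show "(matrix_inv M *v (case p of (r, x) \<Rightarrow> \<tau> *\<^sub>R (M *v x) - X) - floor_vec (matrix_inv M *v (case p of (r, x) \<Rightarrow> \<tau> *\<^sub>R (M *v x) - X)),
        (1 / \<tau>) *\<^sub>R (matrix_inv M *v (X + (case p of (r, x) \<Rightarrow> \<tau> *\<^sub>R (M *v x) - X)))) = p"
      by (simp add: rx n_def[symmetric]) (simp add: n_def pt)
    show "(case p of (r, x) \<Rightarrow> \<tau> *\<^sub>R (M *v x) - X) \<in> {n\<in>int_lattice. \<exists>x\<in>std_simplex. X + n = \<tau> *\<^sub>R (M *v x)}"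
      using n x by (auto simp: rx n_def)
    show "G ((1 / \<tau>) *\<^sub>R (matrix_inv M *v (X + (case p of (r, x) \<Rightarrow> \<tau> *\<^sub>R (M *v x) - X)))) = (case p of (r, x) \<Rightarrow> G x)"
      by (simp add: rx pt)
  next
    fix n assume "n \<in> {n\<in>int_lattice. \<exists>x\<in>std_simplex. X + n = \<tau> *\<^sub>R (M *v x)}"
    then obtain x where n: "n \<in> int_lattice" and x: "x \<in> std_simplex" "X + n = \<tau> *\<^sub>R (M *v x)" by auto
    define r where "r = matrix_inv M *v n - floor_vec (matrix_inv M *v n)"
    have r: "r \<in> coset_reps M" unfolding r_def by (rule coset_rep_exists[OF M_int M_det n])
    have "\<tau> *\<^sub>R x = matrix_inv M *v (X + n)" by (simp add: x matrix_vector_mult_scaleR Minv)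
    then have "\<tau> *\<^sub>R x - (matrix_inv M *v X + r) = floor_vec (matrix_inv M *v n)"
      by (simp add: r_def matrix_vector_right_distrib)
    then have "\<tau> *\<^sub>R x - (matrix_inv M *v X + r) \<in> int_lattice" using floor_vec_int by simp
    then have "x \<in> face_points \<tau> (matrix_inv M *v X + r) UNIV"
      using x by (auto simp: face_points_def simplex_face_def int_lattice_def)
    moreover have "(1 / \<tau>) *\<^sub>R (matrix_inv M *v (X + n)) = x" by (simp add: x pt)
    ultimately show "(matrix_inv M *v n - floor_vec (matrix_inv M *v n), (1 / \<tau>) *\<^sub>R (matrix_inv M *v (X + n)))
        \<in> Sigma (coset_reps M) (\<lambda>r. face_points \<tau> (matrix_inv M *v X + r) UNIV)"
      using r by (simp add: r_def)
    show "(case (matrix_inv M *v n - floor_vec (matrix_inv M *v n), (1 / \<tau>) *\<^sub>R (matrix_inv M *v (X + n))) of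
        (r, x) \<Rightarrow> \<tau> *\<^sub>R (M *v x) - X) = n"
      using x by (simp add: pt Minv algebra_simps)
  qed
  finally show ?thesis by simp
qed

end

section \<open>Regularization by ball averages\<close>

definition ball_average :: "(real ^ 'n \<Rightarrow> 'b::{banach,second_countable_topology}) \<Rightarrow> real ^ 'n \<Rightarrow> real \<Rightarrow> 'b" where
  "ball_average f x \<epsilon> = (1 / measure lborel (cball (0 :: real ^ 'n) 1)) *\<^sub>R
     (LINT y:cball 0 1|lborel. f (x - \<epsilon> *\<^sub>R y))"

text \<open>
  A limit along almost every ray from \<open>x\<close> is the form of piecewise continuity that passes to products
  of functions jumping along different hyperplanes. With boundedness it makes the ball averages
  converge, by dominated convergence in the unit ball.
\<close>

definition has_radial_limits :: "(real ^ 'n \<Rightarrow> real) \<Rightarrow> real ^ 'n \<Rightarrow> bool" where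
  "has_radial_limits f x \<longleftrightarrow> f \<in> borel_measurable borel \<and> (\<exists>B. \<forall>z. \<bar>f z\<bar> \<le> B) \<and>
     (AE y in lborel. \<exists>l. ((\<lambda>\<epsilon>. f (x - \<epsilon> *\<^sub>R y)) \<longlongrightarrow> l) (at_right 0))"

lemma measure_unit_ball_pos: "0 < measure lborel (cball (0 :: real ^ 'n) 1)"
  using content_cball_pos[of 1 "0 :: real ^ 'n"] by simp

lemma set_integrable_ball:
  fixes f :: "real ^ 'n \<Rightarrow> 'b::{banach,second_countable_topology}"
  assumes "f \<in> borel_measurable borel" "\<And>z. norm (f z) \<le> B"
  shows "set_integrable lborel (cball 0 1) (\<lambda>y. f (x - \<epsilon> *\<^sub>R y))"
proof -
  have [measurable]: "f \<in> borel_measurable borel" by fact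
  have "emeasure lborel (cball (0 :: real ^ 'n) 1) < \<infinity>"
    by (intro emeasure_bounded_finite bounded_cball)
  then show ?thesis
    unfolding set_integrable_def
    by (intro integrableI_bounded_set_indicator[where B = B])
       (auto simp: assms(2) intro: measurable_compose[of "\<lambda>y. x - \<epsilon> *\<^sub>R y" _ borel])
qed

lemma regularize_tendsto:
  fixes f :: "real ^ 'n \<Rightarrow> real"
  assumes "has_radial_limits f x"
  shows "(ball_average f x \<longlongrightarrow> regularize f x) (at_right 0)"
proof -
  obtain B where B: "\<And>z. \<bar>f z\<bar> \<le> B" using assms by (auto simp: has_radial_limits_def)
  have [measurable]: "f \<in> borel_measurable borel" using assms by (simp add: has_radial_limits_def)
  define l where "l = (\<lambda>y. lim (\<lambda>n. f (x - inverse (real (Suc n)) *\<^sub>R y)))"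
  have [measurable]: "l \<in> borel_measurable borel" unfolding l_def by measurable
  have fin: "emeasure lborel (cball (0 :: real ^ 'n) 1) < \<infinity>"
    by (intro emeasure_bounded_finite bounded_cball)
  have lim: "AE y in lborel. ((\<lambda>u. f (x - inverse u *\<^sub>R y)) \<longlongrightarrow> l y) at_top"
    using assms unfolding has_radial_limits_def
  proof (elim conjE, elim eventually_mono, elim exE)
    fix y L assume L: "((\<lambda>\<epsilon>. f (x - \<epsilon> *\<^sub>R y)) \<longlongrightarrow> L) (at_right 0)"
    then have *: "((\<lambda>u. f (x - inverse u *\<^sub>R y)) \<longlongrightarrow> L) at_top"
      by (simp add: filterlim_at_right_to_top)
    have "filterlim (\<lambda>n. real (Suc n)) at_top sequentially"
      by (intro filterlim_compose[OF filterlim_real_sequentially] filterlim_Suc)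
    from filterlim_compose[OF * this] have "l y = L" unfolding l_def by (rule limI)
    then show "((\<lambda>u. f (x - inverse u *\<^sub>R y)) \<longlongrightarrow> l y) at_top" using * by simp
  qed
  have "((\<lambda>u. \<integral>y. indicator (cball 0 1) y *\<^sub>R f (x - inverse u *\<^sub>R y) \<partial>lborel) \<longlongrightarrow>
      (\<integral>y. indicator (cball 0 1) y *\<^sub>R l y \<partial>lborel)) at_top"
  proof (rule integral_dominated_convergence_at_top[where w = "\<lambda>y. indicator (cball 0 1) y * B"])
    show "integrable lborel (\<lambda>y::real^'n. indicator (cball 0 1) y * B)"
      using fin by (intro integrable_mult_left integrable_real_indicator) auto
    show "\<forall>\<^sub>F u in at_top. AE y in lborel. norm (indicator (cball 0 1) y *\<^sub>R f (x - inverse u *\<^sub>R y)) \<le> indicator (cball 0 1) y * B"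
      using B by (intro always_eventually allI AE_I2) (auto simp: indicator_def)
    show "AE y in lborel. ((\<lambda>u. indicator (cball 0 1) y *\<^sub>R f (x - inverse u *\<^sub>R y)) \<longlongrightarrow> indicator (cball 0 1) y *\<^sub>R l y) at_top"
      using lim by eventually_elim (intro tendsto_intros)
    have [measurable]: "(\<lambda>y. f (x - inverse u *\<^sub>R y)) \<in> borel_measurable lborel" for u
      by (rule measurable_compose[of "\<lambda>y. x - inverse u *\<^sub>R y" _ borel]) auto
    have [measurable]: "(\<lambda>y. indicator (cball 0 1) y :: real) \<in> borel_measurable (lborel :: (real ^ 'n) measure)"
      by (intro borel_measurable_indicator) auto
    show "(\<lambda>y. indicator (cball 0 1) y *\<^sub>R f (x - inverse u *\<^sub>R y)) \<in> borel_measurable lborel" for u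
      by (intro borel_measurable_scaleR) measurable
    show "(\<lambda>y. indicator (cball 0 1) y *\<^sub>R l y) \<in> borel_measurable lborel"
      by (intro borel_measurable_scaleR) auto
  qed
  then have "((\<lambda>\<epsilon>. LINT y:cball 0 1|lborel. f (x - \<epsilon> *\<^sub>R y)) \<longlongrightarrow> (LINT y:cball 0 1|lborel. l y)) (at_right 0)"
    unfolding filterlim_at_right_to_top set_lebesgue_integral_def .
  then have L: "(ball_average f x \<longlongrightarrow> (1 / measure lborel (cball (0 :: real ^ 'n) 1)) *\<^sub>R (LINT y:cball 0 1|lborel. l y)) (at_right 0)"
    unfolding ball_average_def by (intro tendsto_intros)
  moreover have "regularize f x = Lim (at_right 0) (ball_average f x)"
    by (simp add: regularize_def ball_average_def[abs_def])
  ultimately show ?thesis by (simp add: tendsto_Lim)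
qed

text \<open>
  A bound that holds almost everywhere near a point survives regularization, although the values
  at the point itself may violate it.
\<close>

lemma norm_regularize_combination_le:
  fixes c :: "'i \<Rightarrow> complex" and h :: "'i \<Rightarrow> real ^ 'n \<Rightarrow> real"
  assumes h: "\<And>i. i \<in> I \<Longrightarrow> has_radial_limits (h i) x" and "finite I" and "\<delta> > 0"
    and bound: "\<And>\<epsilon>. 0 < \<epsilon> \<Longrightarrow> \<epsilon> < \<delta> \<Longrightarrow>
      AE y in lborel. y \<in> cball 0 1 \<longrightarrow> norm (\<Sum>i\<in>I. c i * of_real (h i (x - \<epsilon> *\<^sub>R y))) \<le> B"
  shows "norm (\<Sum>i\<in>I. c i * of_real (regularize (h i) x)) \<le> B"
proof -
  define v where "v = measure lborel (cball (0 :: real ^ 'n) 1)"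
  have v: "v > 0" unfolding v_def by (rule measure_unit_ball_pos)
  have fin: "emeasure lborel (cball (0 :: real ^ 'n) 1) < \<infinity>"
    by (intro emeasure_bounded_finite bounded_cball)
  have le: "norm (\<Sum>i\<in>I. c i * of_real (ball_average (h i) x \<epsilon>)) \<le> B" if e: "0 < \<epsilon>" "\<epsilon> < \<delta>" for \<epsilon>
  proof -
    define F where "F = (\<lambda>y. \<Sum>i\<in>I. c i * of_real (h i (x - \<epsilon> *\<^sub>R y)))"
    have int: "set_integrable lborel (cball 0 1) (\<lambda>y. h i (x - \<epsilon> *\<^sub>R y))" if "i \<in> I" for i
      using h[OF that] by (auto simp: has_radial_limits_def intro!: set_integrable_ball)
    have int': "integrable lborel (\<lambda>y. indicator (cball 0 1) y *\<^sub>R (c i * of_real (h i (x - \<epsilon> *\<^sub>R y))))" if "i \<in> I" for i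
    proof -
      have "integrable lborel (\<lambda>y. c i * of_real (indicator (cball 0 1) y *\<^sub>R h i (x - \<epsilon> *\<^sub>R y)))"
        using int[OF that] unfolding set_integrable_def by (intro integrable_mult_right integrable_of_real)
      then show ?thesis by (simp add: scaleR_conv_of_real algebra_simps)
    qed
    have "(LINT y:cball 0 1|lborel. F y) = (\<Sum>i\<in>I. LINT y:cball 0 1|lborel. c i * of_real (h i (x - \<epsilon> *\<^sub>R y)))"
      unfolding F_def set_lebesgue_integral_def scaleR_sum_right using int' by (intro Bochner_Integration.integral_sum)
    also have "\<dots> = (\<Sum>i\<in>I. c i * of_real (LINT y:cball 0 1|lborel. h i (x - \<epsilon> *\<^sub>R y)))"
    proof (intro sum.cong refl)
      fix i assume "i \<in> I"
      have "(LINT y:cball 0 1|lborel. c i * complex_of_real (h i (x - \<epsilon> *\<^sub>R y))) =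
          (\<integral>y. c i * of_real (indicator (cball 0 1) y *\<^sub>R h i (x - \<epsilon> *\<^sub>R y)) \<partial>lborel)"
        unfolding set_lebesgue_integral_def by (simp add: scaleR_conv_of_real algebra_simps)
      then show "(LINT y:cball 0 1|lborel. c i * complex_of_real (h i (x - \<epsilon> *\<^sub>R y))) =
          c i * of_real (LINT y:cball 0 1|lborel. h i (x - \<epsilon> *\<^sub>R y))"
        unfolding set_lebesgue_integral_def by (simp only: integral_mult_right_zero integral_complex_of_real)
    qed
    finally have S: "(\<Sum>i\<in>I. c i * of_real (ball_average (h i) x \<epsilon>)) = (1 / v) *\<^sub>R (LINT y:cball 0 1|lborel. F y)"
      by (simp add: ball_average_def v_def[symmetric] sum_distrib_left scaleR_conv_of_real mult_ac)
    have N: "norm (LINT y:cball 0 1|lborel. F y) \<le> (\<integral>y. indicator (cball 0 1) y * B \<partial>(lborel :: (real ^ 'n) measure))"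
    proof -
      have F: "integrable lborel (\<lambda>y. indicator (cball 0 1) y *\<^sub>R F y)"
        unfolding F_def scaleR_sum_right using int' by (intro Bochner_Integration.integrable_sum)
      have "norm (LINT y:cball 0 1|lborel. F y) \<le> (\<integral>y. norm (indicator (cball 0 1) y *\<^sub>R F y) \<partial>lborel)"
        unfolding set_lebesgue_integral_def by (rule Bochner_Integration.integral_norm_bound)
      also have "\<dots> \<le> (\<integral>y. indicator (cball 0 1) y * B \<partial>(lborel :: (real ^ 'n) measure))"
      proof (rule Bochner_Integration.integral_mono_AE)
        show "integrable lborel (\<lambda>y. norm (indicator (cball 0 1) y *\<^sub>R F y))"
          using F by (rule integrable_norm)
        show "integrable lborel (\<lambda>y::real^'n. indicator (cball 0 1) y * B)"
          using fin by (intro integrable_mult_left integrable_real_indicator) auto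
        show "AE y in lborel. norm (indicator (cball 0 1) y *\<^sub>R F y) \<le> indicator (cball 0 1) y * B"
          using bound[OF e] by eventually_elim (auto simp: F_def indicator_def)
      qed
      finally show ?thesis .
    qed
    have "(\<integral>y. indicator (cball 0 1) y * B \<partial>(lborel :: (real ^ 'n) measure)) = v * B"
      by (simp add: v_def)
    then have "norm (LINT y:cball 0 1|lborel. F y) \<le> v * B" using N by (simp only:)
    then have "(1 / v) * norm (LINT y:cball 0 1|lborel. F y) \<le> (1 / v) * (v * B)"
      using v by (intro mult_left_mono) auto
    then show ?thesis unfolding S norm_scaleR using v by simp
  qed
  have "((\<lambda>\<epsilon>. \<Sum>i\<in>I. c i * of_real (ball_average (h i) x \<epsilon>)) \<longlongrightarrow> (\<Sum>i\<in>I. c i * of_real (regularize (h i) x))) (at_right 0)"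
    using h by (intro tendsto_intros regularize_tendsto)
  then have "((\<lambda>\<epsilon>. norm (\<Sum>i\<in>I. c i * of_real (ball_average (h i) x \<epsilon>))) \<longlongrightarrow> norm (\<Sum>i\<in>I. c i * of_real (regularize (h i) x))) (at_right 0)"
    by (rule tendsto_norm)
  moreover have "\<forall>\<^sub>F \<epsilon> in at_right 0. norm (\<Sum>i\<in>I. c i * of_real (ball_average (h i) x \<epsilon>)) \<le> B"
    using eventually_at_right_real[OF \<open>\<delta> > 0\<close>] by eventually_elim (auto intro: le)
  ultimately show ?thesis
    by (intro tendsto_upperbound[OF _ _ trivial_limit_at_right_real])
qed

lemma regularize_shift: "regularize f (x + v) = regularize (\<lambda>z. f (z + v)) x"
  unfolding regularize_def by (simp add: algebra_simps)

lemma AE_affine_notin_Ints: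
  fixes a :: "real ^ 'n"
  assumes "a \<noteq> 0"
  shows "AE y in lborel. a \<bullet> y + b \<notin> \<int>"
proof -
  have null: "{y. a \<bullet> y = c} \<in> null_sets lborel" for c
  proof -
    have "negligible {y. a \<bullet> y = c}" using assms by (rule negligible_hyperplane[OF disjI1])
    then have "{y. a \<bullet> y = c} \<in> null_sets (completion lborel)" by (simp add: negligible_iff_null_sets)
    then show ?thesis by (simp add: null_sets_completion_iff closed_hyperplane)
  qed
  have "(\<Union>m::int. {y. a \<bullet> y = of_int m - b}) \<in> null_sets lborel"
    by (intro null_sets_UN null)
  then show ?thesis
  proof (rule AE_I')
    show "{y \<in> space lborel. \<not> a \<bullet> y + b \<notin> \<int>} \<subseteq> (\<Union>m::int. {y. a \<bullet> y = of_int m - b})"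
      by (auto elim!: Ints_cases simp: algebra_simps)
  qed
qed

lemma AE_inner_nonzero:
  fixes a :: "real ^ 'n"
  assumes "a \<noteq> 0"
  shows "AE y in lborel. a \<bullet> y \<noteq> 0"
  using AE_affine_notin_Ints[OF assms, of 0] by eventually_elim auto

text \<open>
  The intersection of a convex set with a ray is an interval, so its indicator is eventually
  constant as the ray shrinks to its origin.
\<close>

lemma has_radial_limits_indicator:
  fixes A :: "(real ^ 'n) set"
  assumes "convex A" "closed A"
  shows "has_radial_limits (\<lambda>z. indicator A (z + v)) x"
  unfolding has_radial_limits_def
proof (intro conjI AE_I2)
  have [measurable]: "A \<in> sets borel" using assms(2) by simp
  show "(\<lambda>z. indicator A (z + v)) \<in> borel_measurable borel" by measurable
  show "\<exists>B. \<forall>z. \<bar>indicator A (z + v) :: real\<bar> \<le> B" by (intro exI[of _ 1]) (auto simp: indicator_def)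
  fix y
  define T where "T = {\<epsilon>. 0 < \<epsilon> \<and> x - \<epsilon> *\<^sub>R y + v \<in> A}"
  show "\<exists>l::real. ((\<lambda>\<epsilon>. indicator A (x - \<epsilon> *\<^sub>R y + v)) \<longlongrightarrow> l) (at_right 0)"
  proof (cases "\<exists>d>0. \<forall>\<epsilon>. 0 < \<epsilon> \<longrightarrow> \<epsilon> < d \<longrightarrow> \<epsilon> \<notin> T")
    case True
    then obtain d where d: "d > 0" "\<And>\<epsilon>. 0 < \<epsilon> \<Longrightarrow> \<epsilon> < d \<Longrightarrow> \<epsilon> \<notin> T" by auto
    have "\<forall>\<^sub>F \<epsilon> in at_right 0. (indicator A (x - \<epsilon> *\<^sub>R y + v) :: real) = 0"
      using eventually_at_right_real[OF d(1)] by eventually_elim (use d(2) in \<open>auto simp: T_def\<close>)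
    then show ?thesis by (intro exI[of _ 0] tendsto_eventually)
  next
    case False
    then obtain e where e: "e > 0" "e \<in> T" by (metis zero_less_one)
    have inT: "\<epsilon> \<in> T" if "0 < \<epsilon>" "\<epsilon> < e" for \<epsilon>
    proof -
      obtain s where s: "0 < s" "s < \<epsilon>" "s \<in> T" using False \<open>0 < \<epsilon>\<close> by blast
      define u where "u = (\<epsilon> - s) / (e - s)"
      have u: "0 \<le> u" "u \<le> 1" using s that by (auto simp: u_def field_simps)
      have "u * (e - s) = \<epsilon> - s" using s that by (simp add: u_def)
      then have eps: "\<epsilon> = (1 - u) * s + u * e" by (simp add: algebra_simps)
      have "(1 - u) *\<^sub>R (x - s *\<^sub>R y + v) + u *\<^sub>R (x - e *\<^sub>R y + v) \<in> A"
        using s e u by (intro convexD[OF assms(1)]) (auto simp: T_def)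
      also have "(1 - u) *\<^sub>R (x - s *\<^sub>R y + v) + u *\<^sub>R (x - e *\<^sub>R y + v) = x - \<epsilon> *\<^sub>R y + v"
        unfolding eps by (simp add: algebra_simps)
      finally show ?thesis using that by (simp add: T_def)
    qed
    have "\<forall>\<^sub>F \<epsilon> in at_right 0. (indicator A (x - \<epsilon> *\<^sub>R y + v) :: real) = 1"
      using eventually_at_right_real[OF e(1)] by eventually_elim (use inT in \<open>auto simp: T_def\<close>)
    then show ?thesis by (intro exI[of _ 1] tendsto_eventually)
  qed
qed

section \<open>Assembling the expansion\<close>

text \<open>
  A derivative applied from outside is moved by Clairaut's theorem to its place in the fixed order
  of coordinates in which a multi-index is read.
\<close>

lemma partial_multi_partial:
  fixes G :: "real ^ 'n::{finite,linorder} \<Rightarrow> 'b::euclidean_space"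
  assumes G: "C_infinity G" and "distinct xs" "i \<in> set xs"
  shows "partial i (foldr (\<lambda>k. partial k ^^ \<alpha> k) xs G) =
    foldr (\<lambda>k. partial k ^^ (\<alpha>(i := Suc (\<alpha> i))) k) xs G"
  using assms(2,3)
proof (induction xs)
  case (Cons x xs)
  have C: "C_infinity (foldr (\<lambda>k. partial k ^^ \<beta> k) ys G)" for \<beta> ys
    using G by (induction ys) (auto intro: C_infinity_partial_power)
  have comm: "partial i ((partial x ^^ n) F) = (partial x ^^ n) (partial i F)"
    if "C_infinity F" for n and F :: "real ^ 'n::_ \<Rightarrow> 'b"
  proof (induction n)
    case (Suc n)
    then show ?case
      using C_infinity_partial_commute[OF C_infinity_partial_power[OF that], where h = i and i = x] by simp
  qed simp
  show ?case
  proof (cases "x = i")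
    case True
    then have "foldr (\<lambda>k. partial k ^^ (\<alpha>(i := Suc (\<alpha> i))) k) xs G = foldr (\<lambda>k. partial k ^^ \<alpha> k) xs G"
      using Cons.prems by (intro foldr_cong) auto
    then show ?thesis using True by simp
  next
    case False
    then show ?thesis using Cons comm[OF C] by simp
  qed
qed simp

lemma foldr_partial_eq_multi_partial:
  fixes G :: "real ^ 'n::{finite,linorder} \<Rightarrow> 'b::euclidean_space"
  assumes "C_infinity G"
  shows "\<exists>\<alpha>. multi_sum \<alpha> = length ws \<and> foldr partial ws G = multi_partial \<alpha> G"
proof (induction ws)
  case Nil
  have "foldr (\<lambda>k. partial k ^^ 0) xs G = G" for xs by (induction xs) auto
  then have "multi_partial (\<lambda>_. 0) G = G" by (simp only: multi_partial_def)
  then show ?case by (intro exI[of _ "\<lambda>_. 0"]) auto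
next
  case (Cons i ws)
  then obtain \<alpha> where \<alpha>: "multi_sum \<alpha> = length ws" "foldr partial ws G = multi_partial \<alpha> G" by auto
  have "multi_sum (\<alpha>(i := Suc (\<alpha> i))) = Suc (multi_sum \<alpha>)"
    by (subst (1 2) sum.remove[of _ i]) auto
  moreover have "partial i (multi_partial \<alpha> G) = multi_partial (\<alpha>(i := Suc (\<alpha> i))) G"
    unfolding multi_partial_def by (intro partial_multi_partial assms) auto
  ultimately show ?case
    using \<alpha> by (intro exI[of _ "\<alpha>(i := Suc (\<alpha> i))"]) (simp del: fun_upd_apply)
qed

lemma prod_power_int:
  fixes x :: real
  assumes "x \<noteq> 0"
  shows "(\<Prod>k\<in>A. x powi f k) = x powi (\<Sum>k\<in>A. f k)"
  by (induction A rule: infinite_finite_induct) (auto simp: power_int_add assms)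

lemma zeta_eq_unshear:
  "zeta \<tau> (V k) y k = unshear V (y - \<tau> *\<^sub>R lambda_vec V) $ k"
proof -
  interpret linear "unshear V" by (rule linear_unshear)
  show ?thesis
    unfolding diff scale using unshear_lambda_vec[of V k] by (simp add: zeta_def unshear_def)
qed

lemma convex_hull_columns:
  fixes M :: "real ^ 'n ^ 'n"
  shows "convex hull (insert 0 (columns M)) = (*v) M ` std_simplex"
proof -
  have "std_simplex = convex hull (insert 0 (Basis :: (real ^ 'n) set))"
  proof -
    have "(\<forall>i\<in>Basis. 0 \<le> x \<bullet> i) \<longleftrightarrow> (\<forall>j. 0 \<le> x $ j)" for x :: "real ^ 'n"
      by (auto simp: Basis_vec_def inner_axis)
    moreover have "(\<Sum>b\<in>Basis. x \<bullet> b) = (\<Sum>j\<in>UNIV. x $ j)" for x :: "real ^ 'n"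
    proof -
      have "(\<Sum>b\<in>Basis. x \<bullet> b) = (\<Sum>j\<in>UNIV. x \<bullet> axis j 1)"
        unfolding Basis_vec_def
        by (rule sum.reindex_bij_witness[of _ "\<lambda>j. axis j 1" "\<lambda>b. THE j. b = axis j 1"])
           (auto simp: axis_eq_axis)
      then show ?thesis by (simp add: inner_axis)
    qed
    ultimately show ?thesis
      unfolding std_simplex by (auto simp: std_simplex_def)
  qed
  moreover have "columns M = (*v) M ` (Basis :: (real ^ 'n) set)"
  proof -
    have B: "(Basis :: (real ^ 'n) set) = range (\<lambda>i. axis i 1)" by (auto simp: Basis_vec_def)
    have "columns M = range (\<lambda>i. M *v axis i 1)"
      by (auto simp: columns_def matrix_vector_mult_basis)
    then show ?thesis unfolding B image_image .
  qed
  moreover have "(*v) M ` (convex hull (insert 0 Basis)) = convex hull ((*v) M ` insert 0 Basis)"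
    by (rule convex_hull_linear_image) (rule matrix_vector_mul_linear)
  ultimately show ?thesis by simp
qed

lemma finite_nat_functions: "finite {J :: 'n::finite \<Rightarrow> nat. \<forall>k. J k \<in> S}" if "finite S"
proof -
  have "{J :: 'n \<Rightarrow> nat. \<forall>k. J k \<in> S} = PiE UNIV (\<lambda>_. S)" by (auto simp: PiE_def)
  then show ?thesis using that by (simp add: finite_PiE)
qed

definition words_upto :: "nat \<Rightarrow> ('n::finite \<Rightarrow> letter) set" where
  "words_upto w = {a. (\<forall>k. a k \<in> letters) \<and> (\<Sum>k\<in>UNIV. snd (snd (a k))) \<le> w}"

lemma words_eq: "PiE UNIV (\<lambda>_. letters) = {a. \<forall>k. a k \<in> letters}"
  by (auto simp: PiE_def)

lemma finite_multi_index: "finite {J :: 'n::finite \<Rightarrow> nat. multi_sum J \<le> w}"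
proof (rule finite_subset[OF _ finite_nat_functions[of "{..w}"]])
  show "{J :: 'n \<Rightarrow> nat. multi_sum J \<le> w} \<subseteq> {J. \<forall>k. J k \<in> {..w}}"
  proof (intro subsetI CollectI allI)
    fix J :: "'n \<Rightarrow> nat" and k assume "J \<in> {J. multi_sum J \<le> w}"
    moreover have "J k \<le> multi_sum J" by (rule member_le_sum) auto
    ultimately show "J k \<in> {..w}" by simp
  qed
qed simp

lemma sum_words_upto:
  fixes f :: "('n::finite \<Rightarrow> nat) \<Rightarrow> ('n \<Rightarrow> nat) \<Rightarrow> ('n \<Rightarrow> nat) \<Rightarrow> 'b::comm_monoid_add"
  shows "(\<Sum>V\<in>{V. \<forall>k. V k \<in> {1, 2}}. \<Sum>I\<in>{I. \<forall>k. I k \<in> {0, 1}}. \<Sum>J\<in>{J. J \<sqsubseteq> I \<and> multi_sum J \<le> w}. f V I J) =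
    (\<Sum>a\<in>words_upto w. f (\<lambda>k. fst (a k)) (\<lambda>k. fst (snd (a k))) (\<lambda>k. snd (snd (a k))))"
      (is "(\<Sum>V\<in>?VV. \<Sum>I\<in>?II. \<Sum>J\<in>?JJ I. f V I J) = ?rhs")
    and finite_words_upto: "finite (words_upto w :: ('n \<Rightarrow> letter) set)"
proof -
  define S where "S = (SIGMA V:?VV. SIGMA I:?II. ?JJ I)"
  have finJ: "finite (?JJ I)" for I
    by (rule finite_subset[OF _ finite_multi_index[of w]]) auto
  have finVI: "finite ?VV" "finite ?II"
    by (intro finite_nat_functions; simp)+
  have letters_iff: "p \<in> letters \<longleftrightarrow> fst p \<in> {1, 2} \<and> fst (snd p) \<in> {0, 1} \<and> (fst (snd p) = 0 \<longrightarrow> snd (snd p) = 0)" for p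
    by (cases p) (simp add: letters_def)
  have bij: "bij_betw (\<lambda>a. (\<lambda>k. fst (a k), \<lambda>k. fst (snd (a k)), \<lambda>k. snd (snd (a k)))) (words_upto w) S"
  proof (rule bij_betw_byWitness[where f' = "\<lambda>(V, I, J) k. (V k, I k, J k)"])
    show "(\<lambda>a. (\<lambda>k. fst (a k), \<lambda>k. fst (snd (a k)), \<lambda>k. snd (snd (a k)))) ` words_upto w \<subseteq> S"
      by (auto simp: S_def words_upto_def letters_iff subordinate_def)
    show "(\<lambda>(V, I, J) k. (V k, I k, J k)) ` S \<subseteq> words_upto w"
      by (auto simp: S_def words_upto_def letters_iff subordinate_def)
  qed auto
  have "finite S" unfolding S_def using finVI finJ by (intro finite_SigmaI) auto
  then show "finite (words_upto w :: ('n \<Rightarrow> letter) set)"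
    using bij_betw_finite[OF bij] by simp
  have "?rhs = (\<Sum>(V, I, J)\<in>S. f V I J)"
    using sum.reindex_bij_betw[OF bij, of "\<lambda>(V, I, J). f V I J"] by simp
  also have "\<dots> = (\<Sum>V\<in>?VV. \<Sum>(I, J)\<in>Sigma ?II ?JJ. f V I J)"
    unfolding S_def using finVI finJ by (subst sum.Sigma) (auto intro!: finite_SigmaI simp: split_def)
  also have "\<dots> = (\<Sum>V\<in>?VV. \<Sum>I\<in>?II. \<Sum>J\<in>?JJ I. f V I J)"
    using finVI finJ by (intro sum.cong refl, subst sum.Sigma) auto
  finally show "(\<Sum>V\<in>?VV. \<Sum>I\<in>?II. \<Sum>J\<in>?JJ I. f V I J) = ?rhs" by simp
qed

lemma mu_eq_foldr_letter_op:
  "mu (\<lambda>k. fst (a k)) (\<lambda>k. fst (snd (a k))) (\<lambda>k. snd (snd (a k))) G =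
    word_op a (sorted_list_of_set UNIV) G 0"
  by (simp add: mu_def letter_op_def split_def)

lemma filterlim_words_upto:
  "filterlim words_upto (finite_subsets_at_top (PiE UNIV (\<lambda>_. letters))) sequentially"
  unfolding filterlim_finite_subsets_at_top
proof (intro allI impI)
  fix X :: "('n::finite \<Rightarrow> letter) set"
  assume X: "finite X \<and> X \<subseteq> PiE UNIV (\<lambda>_. letters)"
  define w0 where "w0 = (\<Sum>a\<in>X. \<Sum>k\<in>UNIV. snd (snd (a k)))"
  have "finite (words_upto w) \<and> X \<subseteq> words_upto w \<and> words_upto w \<subseteq> PiE UNIV (\<lambda>_. letters)" if "w \<ge> w0" for w
  proof -
    have "(\<Sum>k\<in>UNIV. snd (snd (a k))) \<le> w" if "a \<in> X" for a
      using member_le_sum[of a X "\<lambda>a. \<Sum>k\<in>UNIV. snd (snd (a k))"] X \<open>w \<ge> w0\<close> that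
      unfolding w0_def by (meson dual_order.trans zero_le)
    then show ?thesis
      using X finite_words_upto unfolding words_eq by (auto simp: words_upto_def)
  qed
  then show "\<forall>\<^sub>F w in sequentially. finite (words_upto w) \<and> X \<subseteq> words_upto w \<and> words_upto w \<subseteq> PiE UNIV (\<lambda>_. letters)"
    unfolding eventually_sequentially by blast
qed

text \<open>
  The majorant of the terms is independent of the shift, so its tails bound the truncation error for
  all generic shifts at once.
\<close>

lemma simplex_expansion_uniform:
  fixes G :: "real ^ 'n::{finite,linorder} \<Rightarrow> 'b::euclidean_space"
  assumes \<tau>: "\<tau> > 0" and G: "C_infinity G" "deriv_bound UNIV C A G" and "0 \<le> C"
    and A: "0 < A" "2 ^ CARD('n) * A < 4 * pi * \<tau>"
  obtains tail :: "nat \<Rightarrow> real" where "tail \<longlonglongrightarrow> 0"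
    "\<And>w y. generic \<tau> y \<Longrightarrow>
      norm ((\<Sum>x\<in>face_points \<tau> y UNIV. G x) -
        (\<Sum>a\<in>words_upto w. word_weight \<tau> y UNIV a *\<^sub>R
           word_op a (sorted_list_of_set UNIV) G 0)) \<le> tail w"
proof -
  define W where "W = (PiE UNIV (\<lambda>_. letters) :: ('n \<Rightarrow> letter) set)"
  define ps where "ps = sorted_list_of_set (UNIV :: 'n set)"
  have ps: "sorted_list_of_set UNIV = ps @ []" "set ps = UNIV" "length ps = CARD('n)"
    by (simp_all add: ps_def)
  \<comment> \<open>The growth rate of the derivatives after \<open>d - 1\<close> doublings.\<close>
  define A' where "A' = A * 2 ^ CARD('n) / 2"
  obtain r where r: "A' / \<tau> < r" "r < 2 * pi"
    using A \<tau> dense[of "A' / \<tau>" "2 * pi"] by (auto simp: A'_def field_simps)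
  have A'pos: "0 < A'" using A by (simp add: A'_def)
  then have "0 < A' / \<tau>" using \<tau> by simp
  then have r0: "0 < r" using r(1) by linarith
  have A'r: "A' < \<tau> * r" using r \<tau> by (simp add: field_simps)
  obtain K where K: "K > 0" "\<And>n x. \<bar>bernoulli n x\<bar> \<le> K / r ^ n"
    using bernoulli_bound[OF r0 r(2)] by blast
  define M where "M = (1 + 1 / A) * (K * (\<tau> + 1 / r))"
  define \<rho> where "\<rho> = A' / (\<tau> * r)"
  have \<rho>: "0 \<le> \<rho>" "\<rho> < 1" using A'pos r0 \<tau> A'r by (auto simp: \<rho>_def)
  have M: "0 \<le> M" using A K r0 \<tau> by (simp add: M_def)
  define maj where "maj = (\<lambda>a :: 'n \<Rightarrow> letter. C * word_bound M \<rho> UNIV a)"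
  have "maj summable_on W"
    unfolding maj_def W_def by (intro summable_on_cmult_right summable_on_words[OF \<rho> M]) auto
  then have maj: "(maj has_sum infsum maj W) W" by (rule has_sum_infsum)
  define tail where "tail = (\<lambda>w. infsum maj W - sum maj (words_upto w))"
  have sub: "words_upto w \<subseteq> W" for w by (auto simp: words_upto_def W_def words_eq)
  have fin: "finite (words_upto w :: ('n \<Rightarrow> letter) set)" for w by (rule finite_words_upto)
  show ?thesis
  proof (rule that)
    have "(\<lambda>w. sum maj (words_upto w)) \<longlonglongrightarrow> infsum maj W"
      using filterlim_compose[OF maj[unfolded has_sum_def W_def] filterlim_words_upto]
      by (simp add: W_def)
    then have "tail \<longlonglongrightarrow> infsum maj W - infsum maj W"
      unfolding tail_def by (intro tendsto_intros)
    then show "tail \<longlonglongrightarrow> 0" by simp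
    fix w and y :: "real ^ 'n::_" assume y: "generic \<tau> y"
    define t where "t = (\<lambda>a :: 'n \<Rightarrow> letter. word_weight \<tau> y UNIV a *\<^sub>R word_op a ps G 0)"
    define L where "L = (\<Sum>x\<in>face_points \<tau> y UNIV. G x)"
    have le: "A * 2 ^ length ps \<le> 2 * A'" by (simp add: A'_def ps)
    have t: "(t has_sum L) W"
      using simplex_expansion_prefix[OF \<tau> y r0 K(2) _ r(2) A'r A(1) ps(1) G(1), of C A] G(2) K(1) \<open>0 \<le> C\<close> le
      unfolding t_def L_def W_def ps(2) by simp
    have bound: "norm (t a) \<le> maj a" if "a \<in> W" for a
      using word_term_bound[OF \<tau> r0 K(2) _ ps(1) G(1) _ \<open>0 \<le> C\<close> A(1) order_refl le, of a y] G(2) K(1) that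
      unfolding t_def maj_def W_def M_def \<rho>_def ps(2) by simp
    have "norm (L - sum t (words_upto w)) \<le> infsum maj W - sum maj (words_upto w)"
    proof (rule norm_infsum_le)
      show "(t has_sum (L - sum t (words_upto w))) (W - words_upto w)"
        by (intro has_sum_Diff t sub has_sum_finite fin)
      show "(maj has_sum (infsum maj W - sum maj (words_upto w))) (W - words_upto w)"
        by (intro has_sum_Diff maj sub has_sum_finite fin)
    qed (use bound in auto)
    then show "norm ((\<Sum>x\<in>face_points \<tau> y UNIV. G x) -
        (\<Sum>a\<in>words_upto w. word_weight \<tau> y UNIV a *\<^sub>R
           word_op a (sorted_list_of_set UNIV) G 0)) \<le> tail w"
      by (simp add: t_def L_def tail_def ps_def)
  qed
qed

lemma bounded_bernoulli: "\<exists>K. \<forall>x. \<bar>bernoulli n x\<bar> \<le> K"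
proof -
  have "(1::real) < 2 * pi" using pi_gt3 by linarith
  then obtain K where "\<And>n x. \<bar>bernoulli n x\<bar> \<le> K / 1 ^ n"
    using bernoulli_bound[of 1] by (metis zero_less_one)
  then show ?thesis by auto
qed

text \<open>
  Along a ray on which none of the linear coordinates is constant every factor approaches a
  one-sided limit of a Bernoulli polynomial.
\<close>

lemma has_radial_limits_bernoulli_products:
  fixes Q :: "real ^ 'n ^ 'n"
  assumes "finite R" and Q: "\<And>k. Q $ k \<noteq> 0"
  shows "has_radial_limits (\<lambda>z. c * (\<Sum>r\<in>R. \<Prod>k\<in>UNIV. bernoulli (J k) ((Q *v z) $ k + s r k))) x"
  unfolding has_radial_limits_def
proof (intro conjI)
  have [measurable]: "(\<lambda>z. (Q *v z) $ k) \<in> borel_measurable borel" for k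
    unfolding matrix_vector_mul_component
    by (intro borel_measurable_continuous_onI continuous_intros)
  show "(\<lambda>z. c * (\<Sum>r\<in>R. \<Prod>k\<in>UNIV. bernoulli (J k) ((Q *v z) $ k + s r k))) \<in> borel_measurable borel"
    by measurable
  obtain K where K: "\<And>n x. \<bar>bernoulli n x\<bar> \<le> K n" using bounded_bernoulli by metis
  have "\<bar>c * (\<Sum>r\<in>R. \<Prod>k\<in>UNIV. bernoulli (J k) ((Q *v z) $ k + s r k))\<bar> \<le> \<bar>c\<bar> * (\<Sum>r\<in>R. \<Prod>k\<in>UNIV. K (J k))" for z
    unfolding abs_mult
    by (intro mult_left_mono order_trans[OF sum_abs] sum_mono)
       (auto simp: abs_prod K intro!: prod_mono)
  then show "\<exists>B. \<forall>z. \<bar>c * (\<Sum>r\<in>R. \<Prod>k\<in>UNIV. bernoulli (J k) ((Q *v z) $ k + s r k))\<bar> \<le> B" by blast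
  have "AE y in lborel. \<forall>k. Q $ k \<bullet> y \<noteq> 0"
    using Q by (subst AE_all_countable) (auto intro: AE_inner_nonzero)
  then show "AE y in lborel. \<exists>l. ((\<lambda>\<epsilon>. c * (\<Sum>r\<in>R. \<Prod>k\<in>UNIV. bernoulli (J k) ((Q *v (x - \<epsilon> *\<^sub>R y)) $ k + s r k))) \<longlongrightarrow> l) (at_right 0)"
  proof eventually_elim
    case (elim y)
    have "\<exists>l. ((\<lambda>\<epsilon>. bernoulli (J k) ((Q *v (x - \<epsilon> *\<^sub>R y)) $ k + s r k)) \<longlongrightarrow> l) (at_right 0)" for r k
    proof -
      have "(Q *v (x - \<epsilon> *\<^sub>R y)) $ k + s r k = ((Q *v x) $ k + s r k) - \<epsilon> * (Q $ k \<bullet> y)" for \<epsilon>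
        unfolding matrix_vector_mul_component by (simp add: inner_diff_right)
      then show ?thesis using bernoulli_ray_limit[of "Q $ k \<bullet> y" "J k" "(Q *v x) $ k + s r k"] elim by (simp only: simp_thms)
    qed
    then have "((\<lambda>\<epsilon>. bernoulli (J k) ((Q *v (x - \<epsilon> *\<^sub>R y)) $ k + s r k)) \<longlongrightarrow>
        (SOME l. ((\<lambda>\<epsilon>. bernoulli (J k) ((Q *v (x - \<epsilon> *\<^sub>R y)) $ k + s r k)) \<longlongrightarrow> l) (at_right 0))) (at_right 0)" for r k
      by (rule someI_ex)
    note lim = this
    define l where "l = (\<lambda>r k. SOME l. ((\<lambda>\<epsilon>. bernoulli (J k) ((Q *v (x - \<epsilon> *\<^sub>R y)) $ k + s r k)) \<longlongrightarrow> l) (at_right 0))"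
    have "((\<lambda>\<epsilon>. bernoulli (J k) ((Q *v (x - \<epsilon> *\<^sub>R y)) $ k + s r k)) \<longlongrightarrow> l r k) (at_right 0)" for r k
      unfolding l_def by (rule lim)
    then show ?case
      by (intro exI[of _ "c * (\<Sum>r\<in>R. \<Prod>k\<in>UNIV. l r k)"] tendsto_intros)
  qed
qed

context
  fixes M :: "real ^ 'n::{finite,linorder} ^ 'n::_"
  assumes M_int: "\<And>i j. M $ i $ j \<in> \<int>" and M_det: "det M \<noteq> 0"
begin

abbreviation coord_mat :: "('n \<Rightarrow> nat) \<Rightarrow> real ^ 'n::_ ^ 'n::_" where
  "coord_mat V \<equiv> transpose (matrix_inv (transpose (M ** basis_mat V)))"

lemma coord_mat_row_nonzero: "coord_mat V $ k \<noteq> 0"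
proof
  assume 0: "coord_mat V $ k = 0"
  have "(coord_mat V *v (M *v (basis_mat V *v axis k 1))) $ k = 1"
    unfolding transpose_inv_apply[OF M_int M_det] matrix_inv_cancel[OF M_int M_det] unshear_basis_mat by (simp add: axis_def)
  moreover have "(coord_mat V *v (M *v (basis_mat V *v axis k 1))) $ k = 0"
    unfolding matrix_vector_mul_component[of "coord_mat V"] 0 by simp
  ultimately show False by simp
qed

text \<open>
  Each coordinate is a nonconstant affine function of \<open>y\<close>, so it takes integer values on countably
  many hyperplanes only.
\<close>

lemma AE_generic:
  assumes "\<epsilon> \<noteq> 0"
  shows "AE y in lborel. \<forall>r\<in>coset_reps M. generic \<tau> (matrix_inv M *v (X - \<epsilon> *\<^sub>R y) + r)"
proof -
  have "AE y in lborel. \<forall>k. zeta \<tau> v (matrix_inv M *v (X - \<epsilon> *\<^sub>R y) + r) k \<notin> \<int>" for v r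
  proof (subst AE_all_countable, intro allI)
    fix k
    define V where "V = (\<lambda>_::'n. v)"
    define b where "b = unshear V (matrix_inv M *v X + r - \<tau> *\<^sub>R lambda_vec V) $ k"
    interpret linear "unshear V" by (rule linear_unshear)
    have eq: "zeta \<tau> v (matrix_inv M *v (X - \<epsilon> *\<^sub>R y) + r) k = (- \<epsilon> *\<^sub>R (coord_mat V $ k)) \<bullet> y + b" for y
    proof -
      have "zeta \<tau> v (matrix_inv M *v (X - \<epsilon> *\<^sub>R y) + r) k =
          unshear V (matrix_inv M *v (X - \<epsilon> *\<^sub>R y) + r - \<tau> *\<^sub>R lambda_vec V) $ k"
        using zeta_eq_unshear[of \<tau> V k] by (simp add: V_def)
      also have "matrix_inv M *v (X - \<epsilon> *\<^sub>R y) + r - \<tau> *\<^sub>R lambda_vec V =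
          (matrix_inv M *v X + r - \<tau> *\<^sub>R lambda_vec V) - \<epsilon> *\<^sub>R (matrix_inv M *v y)"
        by (simp add: matrix_vector_mult_diff_distrib matrix_vector_mult_scaleR)
      also have "unshear V \<dots> $ k = b - \<epsilon> * (unshear V (matrix_inv M *v y) $ k)"
        unfolding diff[of "matrix_inv M *v X + r - \<tau> *\<^sub>R lambda_vec V"] scale by (simp add: b_def)
      also have "unshear V (matrix_inv M *v y) $ k = coord_mat V $ k \<bullet> y"
        unfolding transpose_inv_apply[OF M_int M_det, symmetric] by (rule matrix_vector_mul_component)
      finally show ?thesis by simp
    qed
    have "- \<epsilon> *\<^sub>R (coord_mat V $ k) \<noteq> 0" using assms coord_mat_row_nonzero[of V k] by simp
    then show "AE y in lborel. zeta \<tau> v (matrix_inv M *v (X - \<epsilon> *\<^sub>R y) + r) k \<notin> \<int>"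
      unfolding eq by (rule AE_affine_notin_Ints)
  qed
  then have "AE y in lborel. \<forall>v k. zeta \<tau> v (matrix_inv M *v (X - \<epsilon> *\<^sub>R y) + r) k \<notin> \<int>" for r
    by (subst AE_all_countable) blast
  then show ?thesis
    unfolding generic_def
    by (intro AE_finite_allI finite_coset_reps M_int M_det)
qed

text \<open>
  The translation by \<open>\<tau> M \<lambda>\<^sub>V\<close> turns the coordinates in the basis of index \<open>V\<close> into the arguments of
  the Bernoulli factors in the expansion for the standard simplex.
\<close>

lemma bernoulli_lattice_sum_shift:
  "(\<Sum>\<^sub>\<infinity>n\<in>int_lattice. bernoulli_mat J (transpose (M ** basis_mat V)) (Z + - (\<tau> *\<^sub>R (M *v lambda_vec V)) + n)) =
     inverse \<bar>det M\<bar> * (\<Sum>r\<in>coset_reps M. \<Prod>k\<in>UNIV. bernoulli (J k) (zeta \<tau> (V k) (matrix_inv M *v Z + r) k))"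
proof -
  have "matrix_inv M *v (Z + - (\<tau> *\<^sub>R (M *v lambda_vec V))) + r = (matrix_inv M *v Z + r) - \<tau> *\<^sub>R lambda_vec V" for r
    by (simp add: matrix_vector_mult_diff_distrib matrix_vector_mult_scaleR matrix_inv_cancel[OF M_int M_det])
  then show ?thesis
    unfolding bernoulli_lattice_sum[OF M_int M_det] by (simp only: zeta_eq_unshear)
qed

lemma has_radial_limits_lattice_sum:
  "has_radial_limits (\<lambda>Z. \<Sum>\<^sub>\<infinity>n\<in>int_lattice. bernoulli_mat J (transpose (M ** basis_mat V)) (Z + v + n)) X"
proof -
  interpret linear "unshear V" by (rule linear_unshear)
  have eq: "unshear V (matrix_inv M *v (Z + v) + r) $ k =
      (coord_mat V *v Z) $ k + unshear V (matrix_inv M *v v + r) $ k" for Z r k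
    unfolding transpose_inv_apply[OF M_int M_det] by (simp add: matrix_vector_right_distrib add)
  show ?thesis
    unfolding bernoulli_lattice_sum[OF M_int M_det] eq
    by (intro has_radial_limits_bernoulli_products finite_coset_reps M_int M_det coord_mat_row_nonzero)
qed

end

lemma prod_letter_weight:
  fixes a :: "'n::{finite,linorder} \<Rightarrow> letter"
  assumes "\<tau> > 0"
  shows "word_weight \<tau> y UNIV a =
    \<tau> powi (int CARD('n) - int (\<Sum>k\<in>UNIV. fst (snd (a k))) - int (\<Sum>k\<in>UNIV. snd (snd (a k)))) *
    (\<Prod>k\<in>UNIV. bernoulli (snd (snd (a k)) + fst (snd (a k))) (zeta \<tau> (fst (a k)) y k))"
proof -
  have "word_weight \<tau> y UNIV a =
      (\<Prod>k\<in>UNIV. \<tau> powi (1 - int (fst (snd (a k))) - int (snd (snd (a k))))) *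
      (\<Prod>k\<in>UNIV. bernoulli (snd (snd (a k)) + fst (snd (a k))) (zeta \<tau> (fst (a k)) y k))"
    by (simp add: letter_weight_def split_def prod.distrib)
  also have "(\<Prod>k\<in>UNIV. \<tau> powi (1 - int (fst (snd (a k))) - int (snd (snd (a k))))) =
      \<tau> powi (\<Sum>k\<in>UNIV. 1 - int (fst (snd (a k))) - int (snd (snd (a k))))"
    using assms by (simp add: prod_power_int)
  also have "(\<Sum>k\<in>(UNIV :: 'n set). 1 - int (fst (snd (a k))) - int (snd (snd (a k)))) =
      int CARD('n) - int (\<Sum>k\<in>UNIV. fst (snd (a k))) - int (\<Sum>k\<in>UNIV. snd (snd (a k)))"
    by (simp add: sum_subtractf)
  finally show ?thesis .
qed

lemma solid_angle_eq_0:
  fixes A :: "(real ^ 'n) set"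
  assumes "convex A" "closed A" and "\<And>y. norm y \<le> 1 \<Longrightarrow> x - y \<notin> A"
  shows "solid_angle A x = 0"
proof -
  have lim: "(ball_average (indicator A) x \<longlongrightarrow> solid_angle A x) (at_right 0)"
    unfolding solid_angle_def
    using regularize_tendsto has_radial_limits_indicator[OF assms(1,2), of 0 x] by simp
  have "\<forall>\<^sub>F \<epsilon> in at_right 0. ball_average (indicator A) x \<epsilon> = (0::real)"
    using eventually_at_right_real[OF zero_less_one]
  proof eventually_elim
    case (elim \<epsilon>)
    have "x - \<epsilon> *\<^sub>R y \<notin> A" if "y \<in> cball 0 1" for y
      using that elim by (intro assms(3)) (auto intro: mult_le_one)
    then have "(LINT y:cball 0 1|lborel. (indicator A (x - \<epsilon> *\<^sub>R y) :: real)) = (LINT y:cball (0 :: real ^ 'n) 1|lborel. 0)"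
      unfolding set_lebesgue_integral_def by (intro Bochner_Integration.integral_cong) (auto simp: indicator_def)
    then show ?case by (simp add: ball_average_def)
  qed
  then have "(ball_average (indicator A) x \<longlongrightarrow> (0::real)) (at_right 0)" by (rule tendsto_eventually)
  with lim show ?thesis by (intro tendsto_unique[OF trivial_limit_at_right_real])
qed

theorem corollary8:
  fixes M :: "real ^ 'n::{finite,linorder} ^ 'n::_"
    and P :: "(real ^ 'n::_) set"
    and q :: "real ^ 'n::_ \<Rightarrow> complex"
    and \<tau> c \<delta> :: real
  assumes "\<And>i j. M $ i $ j \<in> \<int>"
    and "det M \<noteq> 0"
    and "P = convex hull (insert 0 (columns M))"
    and "C_infinity q"
    and "\<tau> > 0" and "c > 0" and "\<delta> > 0"
    and "\<And>(w::nat) (\<alpha>::'n \<Rightarrow> nat) x. multi_sum \<alpha> = w \<Longrightarrow> x \<in> std_simplex \<Longrightarrow>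
           norm (multi_partial \<alpha> (dilated \<tau> M q) x)
             \<le> c * \<tau> ^ w * (2 powi (int CARD('n) - 2) * inverse pi + \<delta>) powi (- int w)"
  shows "uniform_limit UNIV
     (\<lambda>(w::nat) (x::real ^ 'n::_).
        of_real \<bar>det M\<bar> *
        (\<Sum>V\<in>{V::'n \<Rightarrow> nat. \<forall>k. V k \<in> {1, 2}}.
         \<Sum>I\<in>{I::'n \<Rightarrow> nat. \<forall>k. I k \<in> {0, 1}}.
         \<Sum>J\<in>{J::'n \<Rightarrow> nat. J \<sqsubseteq> I \<and> multi_sum J \<le> w}.
           of_real (\<tau> powi (int CARD('n) - int (multi_sum I) - int (multi_sum J))) *
           mu V I J (dilated \<tau> M q) *
           of_real (bernoulli_per (\<lambda>k. J k + I k) (transpose (M ** basis_mat V))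
                      (x - \<tau> *\<^sub>R (M *v lambda_vec V)))))
     (\<lambda>x. \<Sum>\<^sub>\<infinity>n\<in>int_lattice.
        of_real (solid_angle ((\<lambda>y. \<tau> *\<^sub>R y) ` P) (x + n)) * q (x + n))
     sequentially"
proof -
  note M_int = assms(1) and M_det = assms(2) and \<tau> = assms(5)
  define G where "G = dilated \<tau> M q"
  define R where "R = coset_reps M"
  have finR: "finite R" unfolding R_def by (intro finite_coset_reps M_int M_det)
  define \<beta> where "\<beta> = 2 powi (int CARD('n) - 2) * inverse pi + \<delta>"
  have \<beta>: "\<beta> > 0" using assms(7) by (simp add: \<beta>_def add_nonneg_pos)
  define A where "A = \<tau> / \<beta>"

  have linM: "linear (\<lambda>x. \<tau> *\<^sub>R (M *v x))"
    by (intro linear_compose_scale_right matrix_vector_mul_linear)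
  have G: "C_infinity G"
    using C_infinity_affine[OF assms(4) linM, of 0] by (simp add: G_def dilated_def[abs_def])
  have db: "deriv_bound UNIV c A G"
    unfolding deriv_bound_def
  proof (intro allI impI)
    fix ws and x :: "real ^ 'n::_" assume x: "x \<in> simplex_face UNIV"
    obtain \<alpha> where \<alpha>: "multi_sum \<alpha> = length ws" "foldr partial ws G = multi_partial \<alpha> G"
      using foldr_partial_eq_multi_partial[OF G] by blast
    have "norm (multi_partial \<alpha> G x) \<le> c * \<tau> ^ length ws * \<beta> powi (- int (length ws))"
      unfolding G_def \<beta>_def using x by (intro assms(8) \<alpha>(1)) (auto simp: simplex_face_def)
    then show "norm (foldr partial ws G x) \<le> c * A ^ length ws"
      by (simp add: \<alpha>(2) A_def power_divide power_int_minus field_simps)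
  qed
  have A0: "0 < A" using \<tau> \<beta> by (simp add: A_def)
  \<comment> \<open>This is what the constant \<open>2\<^sup>d\<^sup>-\<^sup>2 / \<pi>\<close> in the hypothesis is for.\<close>
  have A4: "2 ^ CARD('n) * A < 4 * pi * \<tau>"
  proof -
    have "(2::real) ^ CARD('n) = 4 * 2 powi (int CARD('n) - 2)"
      by (simp add: power_int_diff)
    also have "\<dots> < 4 * (pi * \<beta>)"
      using assms(7) by (simp add: \<beta>_def field_simps)
    finally show ?thesis using \<beta> \<tau> by (simp add: A_def field_simps)
  qed
  obtain tail where tail: "tail \<longlonglongrightarrow> 0"
    "\<And>w y. generic \<tau> y \<Longrightarrow>
      norm ((\<Sum>x\<in>face_points \<tau> y UNIV. G x) -
        (\<Sum>a\<in>words_upto w. word_weight \<tau> y UNIV a *\<^sub>R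
           word_op a (sorted_list_of_set UNIV) G 0)) \<le> tail w"
    by (rule simplex_expansion_uniform[OF \<tau> G db less_imp_le[OF assms(6)] A0 A4]) (rule that)

  define \<nu> where "\<nu> = (\<lambda>a :: 'n \<Rightarrow> letter. word_op a (sorted_list_of_set UNIV) G 0)"
  define pw where "pw = (\<lambda>a :: 'n \<Rightarrow> letter.
    \<tau> powi (int CARD('n) - int (\<Sum>k\<in>UNIV. fst (snd (a k))) - int (\<Sum>k\<in>UNIV. snd (snd (a k)))))"
  define cf where "cf = (\<lambda>a. of_real (\<bar>det M\<bar> * pw a) * \<nu> a)"
  define h where "h = (\<lambda>(a :: 'n \<Rightarrow> letter) Z. \<Sum>\<^sub>\<infinity>n\<in>int_lattice.
    bernoulli_mat (\<lambda>k. snd (snd (a k)) + fst (snd (a k))) (transpose (M ** basis_mat (\<lambda>k. fst (a k))))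
      (Z + - (\<tau> *\<^sub>R (M *v lambda_vec (\<lambda>k. fst (a k)))) + n))"

  let "uniform_limit _ ?S ?L _" = ?thesis
  have series: "?S w X = (\<Sum>a\<in>words_upto w. cf a * of_real (regularize (h a) X))" for w X
    unfolding sum_words_upto(1) sum_distrib_left mu_eq_foldr_letter_op
    by (intro sum.cong refl)
       (simp add: cf_def pw_def \<nu>_def G_def h_def bernoulli_per_def regularize_shift[of _ X "- _", simplified] mult_ac)

  define S where "S = (\<lambda>y. \<tau> *\<^sub>R y) ` P"
  have S_eq: "S = (\<lambda>x. \<tau> *\<^sub>R (M *v x)) ` std_simplex"
    by (simp add: S_def assms(3) convex_hull_columns image_image)
  have S: "convex S" "closed S" "bounded S"
  proof -
    have "compact P" unfolding assms(3)
      by (intro compact_convex_hull finite_imp_compact) (simp add: columns_def full_SetCompr_eq)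
    then have "compact S" unfolding S_def by (rule compact_scaling)
    then show "closed S" "bounded S" by (auto simp: compact_imp_closed compact_imp_bounded)
    show "convex S" unfolding S_def assms(3) by (intro convex_scaling convex_convex_hull)
  qed

  \<comment> \<open>The estimate before regularization: the expansion for the standard simplex, summed over the
    cosets.\<close>
  have point_bound: "norm ((\<Sum>n\<in>{n\<in>int_lattice. Z + n \<in> S}. q (Z + n)) - (\<Sum>a\<in>words_upto w. cf a * of_real (h a Z)))
      \<le> real (card R) * tail w"
    if Z: "\<forall>r\<in>R. generic \<tau> (matrix_inv M *v Z + r)" for Z w
  proof -
    have fin: "finite (face_points \<tau> y UNIV)" for y :: "real ^ 'n::_"
      using finite_face_points[OF \<tau>, of "sorted_list_of_set UNIV" "[]" y] by simp
    have "(\<Sum>n\<in>{n\<in>int_lattice. Z + n \<in> S}. q (Z + n)) =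
        (\<Sum>n\<in>{n\<in>int_lattice. \<exists>x\<in>std_simplex. Z + n = \<tau> *\<^sub>R (M *v x)}. G ((1 / \<tau>) *\<^sub>R (matrix_inv M *v (Z + n))))"
      using \<tau> by (intro sum.cong) (auto simp: S_eq G_def dilated_def matrix_vector_mult_scaleR matrix_inv_cancel[OF M_int M_det])
    also have "\<dots> = (\<Sum>r\<in>R. \<Sum>x\<in>face_points \<tau> (matrix_inv M *v Z + r) UNIV. G x)"
      unfolding R_def by (intro polytope_lattice_sum M_int M_det \<tau> fin)
    finally have 1: "(\<Sum>n\<in>{n\<in>int_lattice. Z + n \<in> S}. q (Z + n)) =
        (\<Sum>r\<in>R. \<Sum>x\<in>face_points \<tau> (matrix_inv M *v Z + r) UNIV. G x)" .
    have "cf a * of_real (h a Z) = (\<Sum>r\<in>R. word_weight \<tau> (matrix_inv M *v Z + r) UNIV a *\<^sub>R \<nu> a)" for a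
      unfolding h_def bernoulli_lattice_sum_shift[OF M_int M_det] prod_letter_weight[OF \<tau>] cf_def pw_def R_def
      using M_det by (simp add: sum_distrib_left scaleR_conv_of_real field_simps)
    then have 2: "(\<Sum>a\<in>words_upto w. cf a * of_real (h a Z)) =
        (\<Sum>r\<in>R. \<Sum>a\<in>words_upto w. word_weight \<tau> (matrix_inv M *v Z + r) UNIV a *\<^sub>R \<nu> a)"
      by (simp only: sum.swap[of _ R])
    have "norm (\<Sum>r\<in>R. (\<Sum>x\<in>face_points \<tau> (matrix_inv M *v Z + r) UNIV. G x) -
        (\<Sum>a\<in>words_upto w. word_weight \<tau> (matrix_inv M *v Z + r) UNIV a *\<^sub>R \<nu> a)) \<le> (\<Sum>r\<in>R. tail w)"
      using Z tail(2) unfolding \<nu>_def by (intro order_trans[OF norm_sum] sum_mono) auto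
    then show ?thesis unfolding 1 2 by (simp add: sum_subtractf)
  qed

  have error: "norm ((\<Sum>\<^sub>\<infinity>n\<in>int_lattice. of_real (solid_angle S (X + n)) * q (X + n)) -
      (\<Sum>a\<in>words_upto w. cf a * of_real (regularize (h a) X))) \<le> real (card R) * tail w" for w X
  proof (rule field_le_epsilon)
    fix \<eta> :: real assume \<eta>: "\<eta> > 0"
    define N where "N = int_lattice \<inter> {n. \<exists>y. norm y \<le> 1 \<and> X + n - y \<in> S}"
    have "bounded {n. \<exists>y. norm y \<le> 1 \<and> X + n - y \<in> S}"
    proof -
      obtain B where B: "\<And>x. x \<in> S \<Longrightarrow> norm x \<le> B" using S(3) by (auto simp: bounded_iff)
      have "norm n \<le> B + 1 + norm X" if "norm y \<le> 1" "X + n - y \<in> S" for n y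
      proof -
        have "norm ((X + n - y) + y - X) \<le> norm ((X + n - y) + y) + norm X" by (rule norm_triangle_ineq4)
        also have "\<dots> \<le> norm (X + n - y) + norm y + norm X" by (simp only: add_le_cancel_right norm_triangle_ineq)
        finally show ?thesis using B[OF that(2)] that(1) by simp
      qed
      then show ?thesis unfolding bounded_iff by blast
    qed
    then have finN: "finite N" unfolding N_def by (rule finite_int_lattice_bounded)
    have infsum: "(\<Sum>\<^sub>\<infinity>n\<in>int_lattice. of_real (solid_angle S (X + n)) * q (X + n)) =
        (\<Sum>n\<in>N. q (X + n) * of_real (regularize (\<lambda>Z. indicator S (Z + n)) X))"
    proof -
      have "(\<Sum>\<^sub>\<infinity>n\<in>int_lattice. of_real (solid_angle S (X + n)) * q (X + n)) =
          (\<Sum>\<^sub>\<infinity>n\<in>N. of_real (solid_angle S (X + n)) * q (X + n))"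
      proof (rule infsum_cong_neutral)
        fix n assume "n \<in> int_lattice - N"
        then have "solid_angle S (X + n) = 0"
          by (intro solid_angle_eq_0 S) (auto simp: N_def)
        then show "complex_of_real (solid_angle S (X + n)) * q (X + n) = 0" by simp
      qed (auto simp: N_def)
      also have "\<dots> = (\<Sum>n\<in>N. of_real (solid_angle S (X + n)) * q (X + n))"
        using finN by (rule infsum_finite)
      finally show ?thesis by (simp add: solid_angle_def regularize_shift mult.commute)
    qed
    have "\<exists>d>0. \<forall>n\<in>N. \<forall>u. dist u (X + n) < d \<longrightarrow> norm (q u - q (X + n)) \<le> \<eta> / (real (card N) + 1)"
    proof -
      have "\<exists>d>0. \<forall>u. dist u (X + n) < d \<longrightarrow> norm (q u - q (X + n)) \<le> \<eta> / (real (card N) + 1)" for n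
      proof -
        have "isCont q (X + n)"
          using C_infinity_continuous[OF assms(4)] by (simp add: continuous_on_eq_continuous_at)
        moreover have "\<eta> / (real (card N) + 1) > 0" using \<eta> by simp
        ultimately show ?thesis
          unfolding continuous_at_eps_delta dist_norm by (meson less_imp_le)
      qed
      then obtain d where d: "\<And>n. d n > 0" "\<And>n u. dist u (X + n) < d n \<Longrightarrow> norm (q u - q (X + n)) \<le> \<eta> / (real (card N) + 1)"
        by metis
      define d0 where "d0 = Min (insert 1 (d ` N))"
      have "d0 > 0" unfolding d0_def using finN d(1) by (subst Min_gr_iff) auto
      moreover have "d0 \<le> d n" if "n \<in> N" for n unfolding d0_def using finN that by (intro Min_le) auto
      ultimately show ?thesis using d(2) by (intro exI[of _ d0]) force
    qed
    then obtain d where d: "d > 0" "\<And>n u. n \<in> N \<Longrightarrow> dist u (X + n) < d \<Longrightarrow> norm (q u - q (X + n)) \<le> \<eta> / (real (card N) + 1)"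
      by blast
    define \<gamma> where "\<gamma> = min d 1"
    have \<gamma>: "\<gamma> > 0" using d by (simp add: \<gamma>_def)

    \<comment> \<open>Near \<open>X\<close> the values of \<open>q\<close> at the lattice points can be frozen, at the cost of \<open>\<eta>\<close>.\<close>
    have frozen: "norm ((\<Sum>n\<in>N. q (X + n) * of_real (indicator S (Z + n))) - (\<Sum>n\<in>{n\<in>int_lattice. Z + n \<in> S}. q (Z + n))) \<le> \<eta>"
      if Z: "dist Z X < \<gamma>" for Z
    proof -
      have sub: "{n\<in>int_lattice. Z + n \<in> S} = {n\<in>N. Z + n \<in> S}"
      proof -
        have "\<exists>y. norm y \<le> 1 \<and> X + n - y \<in> S" if "Z + n \<in> S" for n
          using Z that by (intro exI[of _ "X - Z"]) (auto simp: \<gamma>_def dist_norm norm_minus_commute algebra_simps)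
        then show ?thesis by (auto simp: N_def)
      qed
      have "(\<Sum>n\<in>{n\<in>int_lattice. Z + n \<in> S}. q (Z + n)) = (\<Sum>n\<in>N. q (Z + n) * of_real (indicator S (Z + n)))"
        unfolding sub sum.inter_filter[OF finN] by (intro sum.cong) (auto simp: indicator_def)
      then have "norm ((\<Sum>n\<in>N. q (X + n) * of_real (indicator S (Z + n))) - (\<Sum>n\<in>{n\<in>int_lattice. Z + n \<in> S}. q (Z + n))) =
          norm (\<Sum>n\<in>N. (q (X + n) - q (Z + n)) * of_real (indicator S (Z + n)))"
        by (simp add: sum_subtractf left_diff_distrib)
      also have "\<dots> \<le> (\<Sum>n\<in>N. \<eta> / (real (card N) + 1))"
      proof (intro order_trans[OF norm_sum] sum_mono)
        fix n assume n: "n \<in> N"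
        have "dist (Z + n) (X + n) < d" using Z by (simp add: \<gamma>_def dist_norm)
        then have "norm (q (X + n) - q (Z + n)) \<le> \<eta> / (real (card N) + 1)"
          using d(2)[OF n] by (simp only: norm_minus_commute[of "q (X + n)"])
        then show "norm ((q (X + n) - q (Z + n)) * of_real (indicator S (Z + n))) \<le> \<eta> / (real (card N) + 1)"
          using \<eta> by (auto simp: indicator_def)
      qed
      also have "\<dots> = \<eta> * (real (card N) / (real (card N) + 1))" by simp
      also have "\<dots> \<le> \<eta> * 1" using \<eta> by (intro mult_left_mono) auto
      finally show ?thesis by simp
    qed

    \<comment> \<open>The difference of the two sides is one linear combination of regularized functions, indexed
      by the lattice points near the polytope together with the words of the truncated expansion.\<close>
    define idx where "idx = N <+> (words_upto w :: ('n \<Rightarrow> letter) set)"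
    define C where "C = case_sum (\<lambda>n. q (X + n)) (\<lambda>a. - cf a)"
    define H where "H = case_sum (\<lambda>n Z. indicator S (Z + n)) h"
    have sum_idx: "(\<Sum>i\<in>idx. C i * of_real (F (H i))) =
        (\<Sum>n\<in>N. q (X + n) * of_real (F (\<lambda>Z. indicator S (Z + n)))) - (\<Sum>a\<in>words_upto w. cf a * of_real (F (h a)))"
      for F :: "(real ^ 'n::_ \<Rightarrow> real) \<Rightarrow> real"
      unfolding idx_def
      by (subst sum.Plus[OF finN finite_words_upto]) (simp add: C_def H_def sum_negf o_def)
    have "norm (\<Sum>i\<in>idx. C i * of_real (regularize (H i) X)) \<le> real (card R) * tail w + \<eta>"
    proof (rule norm_regularize_combination_le)
      have "has_radial_limits (h a) X" for a
        unfolding h_def by (intro has_radial_limits_lattice_sum M_int M_det)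
      then show "has_radial_limits (H i) X" if "i \<in> idx" for i
        unfolding H_def using has_radial_limits_indicator[OF S(1,2)] by (cases i) simp_all
      show "finite idx" unfolding idx_def using finN finite_words_upto by auto
      fix \<epsilon> assume \<epsilon>: "0 < \<epsilon>" "\<epsilon> < \<gamma>"
      have "AE y in lborel. \<forall>r\<in>R. generic \<tau> (matrix_inv M *v (X - \<epsilon> *\<^sub>R y) + r)"
        unfolding R_def using \<epsilon> by (intro AE_generic M_int M_det) simp
      then show "AE y in lborel. y \<in> cball 0 1 \<longrightarrow> norm (\<Sum>i\<in>idx. C i * of_real (H i (X - \<epsilon> *\<^sub>R y))) \<le> real (card R) * tail w + \<eta>"
      proof (eventually_elim, intro impI)
        fix y assume gen: "\<forall>r\<in>R. generic \<tau> (matrix_inv M *v (X - \<epsilon> *\<^sub>R y) + r)" and y: "y \<in> cball (0 :: real ^ 'n::_) 1"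
        define Z where "Z = X - \<epsilon> *\<^sub>R y"
        have "\<epsilon> * norm y \<le> \<epsilon>" using \<epsilon> y by (simp add: mult_left_le)
        moreover have "dist Z X = \<epsilon> * norm y" using \<epsilon> by (simp add: Z_def dist_norm)
        ultimately have "dist Z X < \<gamma>" using \<epsilon> by linarith
        from norm_triangle_mono[OF frozen[OF this] point_bound[OF gen[folded Z_def], of w]]
        have "norm ((\<Sum>n\<in>N. q (X + n) * of_real (indicator S (Z + n))) - (\<Sum>a\<in>words_upto w. cf a * of_real (h a Z))) \<le> \<eta> + real (card R) * tail w"
          by simp
        then show "norm (\<Sum>i\<in>idx. C i * of_real (H i (X - \<epsilon> *\<^sub>R y))) \<le> real (card R) * tail w + \<eta>"
          using sum_idx[of "\<lambda>f. f Z"] by (simp add: Z_def add.commute)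
      qed
    qed (fact \<gamma>)
    then show "norm ((\<Sum>\<^sub>\<infinity>n\<in>int_lattice. of_real (solid_angle S (X + n)) * q (X + n)) -
      (\<Sum>a\<in>words_upto w. cf a * of_real (regularize (h a) X))) \<le> real (card R) * tail w + \<eta>"
      unfolding sum_idx[of "\<lambda>f. regularize f X"] infsum .
  qed

  show ?thesis
    unfolding series S_def[symmetric]
  proof (rule uniform_limitI)
    fix e :: real assume "e > 0"
    have "(\<lambda>w. real (card R) * tail w) \<longlonglongrightarrow> real (card R) * 0"
      by (intro tendsto_intros tail(1))
    then have "\<forall>\<^sub>F w in sequentially. real (card R) * tail w < e"
      using \<open>e > 0\<close> by (intro order_tendstoD(2)) auto
    then show "\<forall>\<^sub>F w in sequentially. \<forall>x\<in>UNIV. dist (\<Sum>a\<in>words_upto w. cf a * of_real (regularize (h a) x))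
        (\<Sum>\<^sub>\<infinity>n\<in>int_lattice. of_real (solid_angle S (x + n)) * q (x + n)) < e"
    proof (eventually_elim, intro ballI)
      fix w x assume "real (card R) * tail w < e"
      then show "dist (\<Sum>a\<in>words_upto w. cf a * of_real (regularize (h a) x))
        (\<Sum>\<^sub>\<infinity>n\<in>int_lattice. of_real (solid_angle S (x + n)) * q (x + n)) < e"
        using error[of x w] by (simp add: dist_norm norm_minus_commute)
    qed
  qed
qed

end
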